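(* Let $(\phi_t)$ be a non-elliptic holomorphic semigroup in $\mathbb{D}$, not a group, with Denjoy-Wolff point $\tau\in\partial\mathbb{D}$ and spectral value $\lambda\ge0$. Let $h$ be the associated Königs function and $\sigma\in\partial\mathbb{D}$. The following are equivalent: (1) $\sigma$ is a repelling fixed point of $(\phi_t)$; (2) $\lim_{z\to\sigma}\operatorname{Im}h(z)=-\infty$ and $-\infty<\angle\liminf_{z\to\sigma}\operatorname{Re}h(z)\ne\angle\limsup_{z\to\sigma}\operatorname{Re}h(z)<+\infty$; (3) $\lim_{z\to\sigma}\operatorname{Im}h(z)=-\infty$ and $-\infty<\liminf_{z\to\sigma}\operatorname{Re}h(z)\ne\limsup_{z\to\sigma}\operatorname{Re}h(z)<+\infty$. Moreover, if $\sigma$ is a repelling fixed point for $(\phi_t)$ with repelling spectral value $\nu\in(-\infty,0)$, then there exists $a\in\mathbb{R}$ such that, if $\{z_n\}\subset\mathbb{D}$ is a sequence converging to $\sigma$ and $\lim_{n\to\infty}\mathrm{Arg}(1-\overline{\sigma}z_n)=\beta\in(-\pi/2,\pi/2)$, then $$\lim_{n\to\infty}\operatorname{Re}h(z_n)=a+\frac{\beta}{\nu}.$$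
   Context: $\mathbb{D}$ is the open unit disc in $\mathbb{C}$. A holomorphic semigroup in $\mathbb{D}$ is a family $(\phi_t)_{t\ge0}$ of holomorphic self-maps of $\mathbb{D}$ with $\phi_0=\mathrm{id}$, $\phi_{t+s}=\phi_t\circ\phi_s$, continuous in $t$ for uniform convergence on compacta. It is a group if $\phi_t$ is an automorphism of $\mathbb{D}$ for some (equivalently all) $t>0$. If it is not a group, the Denjoy-Wolff point is the unique $\tau\in\overline{\mathbb{D}}$ with $\phi_t\to\tau$ uniformly on compacta as $t\to+\infty$; the semigroup is non-elliptic if $\tau\in\partial\mathbb{D}$, and then $\angle\lim_{z\to\tau}\phi_t'(z)=e^{-\lambda t}$ with $\lambda\ge0$ the spectral value; it is hyperbolic if $\lambda>0$, parabolic if $\lambda=0$. $\angle\lim$, $\angle\liminf$, $\angle\limsup$ refer to non-tangential approach (the infimum, respectively supremum, of all limits along sequences in $\mathbb{D}$ converging non-tangentially to $\sigma$); $\lim,\liminf,\limsup$ without $\angle$ are unrestricted in $\mathbb{D}$. $\sigma\in\partial\mathbb{D}$ is a repelling fixed point if $\angle\lim_{z\to\sigma}\phi_t(z)=\sigma$ and $\angle\lim_{z\to\sigma}\phi_t'(z)=e^{-\nu t}$ for all $t\ge0$, with some $\nu<0$ (repelling spectral value at $\sigma$). The Königs function of a non-elliptic semigroup is the univalent map $h:\mathbb{D}\to\mathbb{C}$ of its canonical model: $h(\phi_t(z))=h(z)+it$ and $\bigcup_{t\ge0}(h(\mathbb{D})-it)=\Omega$, where $\Omega=\{0<\operatorname{Re}\zeta<\pi/\lambda\}$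 in the hyperbolic case and $\Omega$ is one of $\{\operatorname{Re}\zeta>0\}$, $\{\operatorname{Re}\zeta<0\}$, $\mathbb{C}$ in the parabolic case (such a model exists and is unique up to isomorphism of models). $\mathrm{Arg}$ is the principal argument. *)

theory Defs
  imports "HOL-Complex_Analysis.Complex_Analysis"
begin

abbreviation unit_disc :: "complex set" where
  "unit_disc \<equiv> ball 0 1"

abbreviation unit_circle :: "complex set" where
  "unit_circle \<equiv> sphere 0 1"

text \<open>Stolz region with vertex \<open>\<sigma>\<close>; it is empty for \<open>R \<le> 1\<close>.\<close>

definition stolz :: "complex \<Rightarrow> real \<Rightarrow> complex set" where
  "stolz \<sigma> R = {z \<in> unit_disc. cmod (\<sigma> - z) < R * (1 - cmod z)}"

definition angular_lim :: "(complex \<Rightarrow> complex) \<Rightarrow> complex \<Rightarrow> complex \<Rightarrow> bool" where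
  "angular_lim f \<sigma> L \<longleftrightarrow> (\<forall>R>1. (f \<longlongrightarrow> L) (at \<sigma> within stolz \<sigma> R))"

definition nontangential_seq :: "(nat \<Rightarrow> complex) \<Rightarrow> complex \<Rightarrow> bool" where
  "nontangential_seq z \<sigma> \<longleftrightarrow> z \<longlonglongrightarrow> \<sigma> \<and> (\<exists>R>1. \<forall>n. z n \<in> stolz \<sigma> R)"

definition angular_limit_values :: "(complex \<Rightarrow> real) \<Rightarrow> complex \<Rightarrow> ereal set" where
  "angular_limit_values u \<sigma> =
     {l. \<exists>z. nontangential_seq z \<sigma> \<and> (\<lambda>n. ereal (u (z n))) \<longlonglongrightarrow> l}"

definition angular_liminf :: "(complex \<Rightarrow> real) \<Rightarrow> complex \<Rightarrow> ereal" where
  "angular_liminf u \<sigma> = Inf (angular_limit_values u \<sigma>)"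

definition angular_limsup :: "(complex \<Rightarrow> real) \<Rightarrow> complex \<Rightarrow> ereal" where
  "angular_limsup u \<sigma> = Sup (angular_limit_values u \<sigma>)"

text \<open>Only the values \<open>\<phi> t z\<close> with \<open>t \<ge> 0\<close> and \<open>z\<close> in the disc are meaningful.\<close>

definition holomorphic_semigroup :: "(real \<Rightarrow> complex \<Rightarrow> complex) \<Rightarrow> bool" where
  "holomorphic_semigroup \<phi> \<longleftrightarrow>
     (\<forall>t\<ge>0. \<phi> t holomorphic_on unit_disc \<and> \<phi> t ` unit_disc \<subseteq> unit_disc) \<and>
     (\<forall>z\<in>unit_disc. \<phi> 0 z = z) \<and>
     (\<forall>t\<ge>0. \<forall>s\<ge>0. \<forall>z\<in>unit_disc. \<phi> (t + s) z = \<phi> t (\<phi> s z)) \<and>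
     (\<forall>K t. compact K \<and> K \<subseteq> unit_disc \<and> t \<ge> 0 \<longrightarrow>
        uniform_limit K \<phi> (\<phi> t) (at t within {0..}))"

definition disc_automorphism :: "(complex \<Rightarrow> complex) \<Rightarrow> bool" where
  "disc_automorphism f \<longleftrightarrow> f holomorphic_on unit_disc \<and> bij_betw f unit_disc unit_disc"

definition is_group_semigroup :: "(real \<Rightarrow> complex \<Rightarrow> complex) \<Rightarrow> bool" where
  "is_group_semigroup \<phi> \<longleftrightarrow> (\<exists>t>0. disc_automorphism (\<phi> t))"

definition denjoy_wolff_point :: "(real \<Rightarrow> complex \<Rightarrow> complex) \<Rightarrow> complex \<Rightarrow> bool" where
  "denjoy_wolff_point \<phi> \<tau> \<longleftrightarrow> \<tau> \<in> cball 0 1 \<and>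
     (\<forall>K. compact K \<and> K \<subseteq> unit_disc \<longrightarrow> uniform_limit K \<phi> (\<lambda>_. \<tau>) at_top)"

definition spectral_value :: "(real \<Rightarrow> complex \<Rightarrow> complex) \<Rightarrow> complex \<Rightarrow> real \<Rightarrow> bool" where
  "spectral_value \<phi> \<tau> lam \<longleftrightarrow> lam \<ge> 0 \<and>
     (\<forall>t\<ge>0. angular_lim (deriv (\<phi> t)) \<tau> (of_real (exp (- lam * t))))"

definition repelling_spectral_value :: "(real \<Rightarrow> complex \<Rightarrow> complex) \<Rightarrow> complex \<Rightarrow> real \<Rightarrow> bool" where
  "repelling_spectral_value \<phi> \<sigma> \<nu> \<longleftrightarrow> \<nu> < 0 \<and>
     (\<forall>t\<ge>0. angular_lim (\<phi> t) \<sigma> \<sigma> \<and>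
            angular_lim (deriv (\<phi> t)) \<sigma> (of_real (exp (- \<nu> * t))))"

definition repelling_fixed_point :: "(real \<Rightarrow> complex \<Rightarrow> complex) \<Rightarrow> complex \<Rightarrow> bool" where
  "repelling_fixed_point \<phi> \<sigma> \<longleftrightarrow>
     \<sigma> \<in> unit_circle \<and> (\<exists>\<nu>. repelling_spectral_value \<phi> \<sigma> \<nu>)"

definition model_domains :: "real \<Rightarrow> complex set set" where
  "model_domains lam =
     (if lam > 0 then {{\<zeta>. 0 < Re \<zeta> \<and> Re \<zeta> < pi / lam}}
      else {{\<zeta>. Re \<zeta> > 0}, {\<zeta>. Re \<zeta> < 0}, UNIV})"

text \<open>The Koenigs function is unique only up to isomorphism of models, so this is a predicate
  satisfied by every choice of \<open>h\<close>.\<close>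

definition koenigs_function ::
    "(real \<Rightarrow> complex \<Rightarrow> complex) \<Rightarrow> real \<Rightarrow> (complex \<Rightarrow> complex) \<Rightarrow> bool" where
  "koenigs_function \<phi> lam h \<longleftrightarrow>
     h holomorphic_on unit_disc \<and> inj_on h unit_disc \<and>
     (\<forall>t\<ge>0. \<forall>z\<in>unit_disc. h (\<phi> t z) = h z + \<i> * of_real t) \<and>
     (\<Union>t\<in>{0..}. (\<lambda>z. h z - \<i> * of_real t) ` unit_disc) \<in> model_domains lam"

end

theory Submission
  imports Defs
begin

text \<open>
  A Cayley transform sends \<open>\<sigma>\<close> to \<open>0\<close>, \<open>\<tau>\<close> to \<open>\<infinity>\<close> and the disc to the right half plane.
  By Wolff's inequality the conjugated semigroup increases real parts, so that
  \<open>f = - \<i> h\<close>, read in the half plane, satisfies \<open>Re f' \<ge> 0\<close>. Let \<open>m \<ge> 0\<close> be the point mass at \<open>0\<close>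
  of the positive harmonic function \<open>Re f'\<close>, the largest \<open>m\<close> with \<open>Re f' \<ge> m Re (1/w)\<close>.
  Then \<open>w f' w\<close> tends to \<open>m\<close> in sectors, and \<open>f\<close> has there asymptotically the increments of \<open>m Ln w\<close>.

  Since \<open>f (\<phi>\<^sub>t w) = f w + t\<close>, the point \<open>\<sigma>\<close> is repelling exactly when \<open>m > 0\<close>, and then
  \<open>\<nu> = - 1 / m\<close>. If \<open>m > 0\<close>, monotonicity of \<open>Re f\<close> along horizontal lines gives
  \<open>Re f \<longlongrightarrow> - \<infinity>\<close>. Conversely, once \<open>Re f \<longlongrightarrow> - \<infinity>\<close>, any two limit values of \<open>Im f\<close> bound
  a horizontal strip inside the range of \<open>f\<close>, and comparing \<open>f\<close> with the Riemann map of that strip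
  shows that its width is at most \<open>\<pi> m\<close>. Rotating in a sector already produces the
  oscillation \<open>\<pi> m\<close>, which leaves no room for oscillation along the radius.
\<close>

subsection \<open>Positive real part in the right half plane\<close>

text \<open>In sectors \<open>deriv f w\<close> is \<open>mass / w\<close> up to an error that is
  only o(1/\<bar>w\<bar>). A primitive of the error varies slowly but could a priori drift, as ln
  \<bar>ln \<bar>w\<bar>\<bar> does, so the value \<open>a\<close> of the theorem cannot be obtained
  by integration. This is what makes the sharp bound on the oscillation necessary. The mass is an
  infimum rather than a value of a Herglotz measure: a nearly minimal point is a base point at which
  the Schwarz-Pick inequality is nearly sharp, and this gives the Julia-Wolff-Caratheodory
  estimates. The relation between \<nu> and the mass m comes from f(\<phi>_t w) - f(w) = t: in
  sectors the left side is m Ln(\<phi>_t w / w) up to o(1), so the multiplier of the flow is exp(t /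
  m). Since h = i f, Re h is - Im f and Im h is Re f. The chart is asymptotic to 1 - cnj \<sigma> z
  at \<sigma>, so its argument has the limit \<beta>, and the slope in \<beta> is - m = 1 / \<nu>.
  The chart requires \<sigma> \<noteq> \<tau>; for \<sigma> = \<tau> all three conditions are
  false.\<close>

abbreviation rhp :: "complex set" where
  "rhp \<equiv> {w. 0 < Re w}"

text \<open>For \<open>k = cos \<theta>\<close> this is the closed angle of half-opening \<theta>
  about the positive axis. It is written as a lower bound for \<open>Re w\<close> because that is
  how it enters the estimates, and it has no vertex because \<open>1 / w\<close> and
  \<open>Ln w\<close> are evaluated on it.\<close>

definition sector :: "real \<Rightarrow> complex set" where
  "sector k = {w. w \<noteq> 0 \<and> k * cmod w \<le> Re w}"

lemma open_rhp: "open rhp"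
  by (simp add: open_halfspace_Re_gt)

lemma convex_rhp: "convex rhp"
  by (simp add: convex_halfspace_Re_gt)

lemma sector_subset_rhp: "0 < k \<Longrightarrow> sector k \<subseteq> rhp"
  by (auto simp: sector_def) (metis less_le_trans mult_pos_pos zero_less_norm_iff)

lemma Re_inverse_pos: "w \<in> rhp \<Longrightarrow> 0 < Re (1 / w)"
  by (auto simp: Re_divide power2_eq_square[symmetric] sum_power2_gt_zero_iff)

lemma Re_one_over: "Re (1 / w) = Re w / (cmod w)\<^sup>2"
  by (simp add: Re_divide cmod_power2)

text \<open>The pseudohyperbolic distance of the half plane is
  \<open>cmod (a - b) / cmod (a + cnj b)\<close>; this identity eliminates its numerator.\<close>

lemma cmod_add_cnj_sq: "(cmod (a + cnj b))\<^sup>2 = (cmod (a - b))\<^sup>2 + 4 * Re a * Re b"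
  unfolding cmod_power2 by (simp add: algebra_simps power2_eq_square)

text \<open>The Schwarz lemma says that \<open>q\<close> contracts the pseudohyperbolic distance;
  \<open>cmod_add_cnj_sq\<close> then removes the differences. The resulting form keeps the real
  parts as factors, which is what is needed when \<open>v\<close> escapes to infinity or
  \<open>Re (q v)\<close> is nearly minimal.\<close>

lemma schwarz_pick_rhp_strict:
  assumes q: "q holomorphic_on rhp" "\<And>w. w \<in> rhp \<Longrightarrow> 0 < Re (q w)"
    and w: "w \<in> rhp" and v: "v \<in> rhp"
  shows "Re w * Re v * (cmod (q w + cnj (q v)))\<^sup>2 \<le> Re (q w) * Re (q v) * (cmod (w + cnj v))\<^sup>2"
proof -
  have lt: "cmod (a - b) < cmod (a + cnj b)" if "a \<in> rhp" "b \<in> rhp" for a b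
  proof -
    have "(cmod (a - b))\<^sup>2 < (cmod (a + cnj b))\<^sup>2"
      using that by (simp add: cmod_add_cnj_sq)
    then show ?thesis
      by (rule power_less_imp_less_base) simp
  qed
  have nz: "a + cnj b \<noteq> 0" if "a \<in> rhp" "b \<in> rhp" for a b
    using lt[OF that] by auto
  \<comment> \<open>\<open>S\<close> inverts the Cayley map \<open>(w - v) / (w + cnj v)\<close> and
    sends 0 to \<open>v\<close>; \<open>g\<close> is \<open>q\<close> read in the discs centred at
    \<open>v\<close> and \<open>q v\<close>.\<close>
  define S where "S = (\<lambda>\<xi>. (v + cnj v * \<xi>) / (1 - \<xi>))"
  define g where "g = (\<lambda>\<xi>. (q (S \<xi>) - q v) / (q (S \<xi>) + cnj (q v)))"
  have S_rhp: "S \<xi> \<in> rhp" if "cmod \<xi> < 1" for \<xi>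
  proof -
    have ne: "1 - \<xi> \<noteq> 0" using that by auto
    \<comment> \<open>The last bracket has the form x - cnj x, so it is purely imaginary and drops
      out of the real part.\<close>
    have "(v + cnj v * \<xi>) * cnj (1 - \<xi>) = (v - cnj v * (\<xi> * cnj \<xi>)) + (cnj v * \<xi> - cnj (cnj v * \<xi>))"
      by (simp add: algebra_simps)
    then have "Re ((v + cnj v * \<xi>) * cnj (1 - \<xi>)) = Re v * (1 - (cmod \<xi>)\<^sup>2)"
      unfolding cmod_power2 by (simp add: algebra_simps power2_eq_square)
    moreover have "(cmod \<xi>)\<^sup>2 < 1" using that by (simp add: abs_square_less_1)
    ultimately have "0 < Re ((v + cnj v * \<xi>) * cnj (1 - \<xi>))"
      using v by simp
    then show ?thesis
      using ne by (simp add: S_def complex_div_cnj[of _ "1 - \<xi>"] Re_divide_of_real del: complex_cnj_diff)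
  qed
  have Sh: "S holomorphic_on ball 0 1"
    unfolding S_def by (intro holomorphic_intros) auto
  have qS: "(\<lambda>\<xi>. q (S \<xi>)) holomorphic_on ball 0 1"
    using holomorphic_on_compose_gen[OF Sh q(1)] S_rhp by (simp add: o_def image_subset_iff)
  have qSr: "q (S \<xi>) \<in> rhp" if "cmod \<xi> < 1" for \<xi>
    using q(2)[OF S_rhp[OF that]] by simp
  have qv: "q v \<in> rhp" using q(2)[OF v] by simp
  have gh: "g holomorphic_on ball 0 1"
    unfolding g_def using nz[OF qSr qv] by (intro holomorphic_intros qS) auto
  have g1: "cmod (g \<xi>) < 1" if "cmod \<xi> < 1" for \<xi>
    using lt[OF qSr[OF that] qv] nz[OF qSr[OF that] qv] by (simp add: g_def norm_divide)
  have g0: "g 0 = 0" by (simp add: g_def S_def)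
  define \<xi> where "\<xi> = (w - v) / (w + cnj v)"
  have x1: "cmod \<xi> < 1"
    using lt[OF w v] nz[OF w v] by (simp add: \<xi>_def norm_divide)
  have nwv: "w + cnj v \<noteq> 0" using nz[OF w v] .
  have vv: "v + cnj v \<noteq> 0" using nz[OF v v] .
  have e1: "1 - \<xi> = (v + cnj v) / (w + cnj v)"
    using nwv by (simp add: \<xi>_def field_simps)
  have e2: "v + cnj v * \<xi> = w * (v + cnj v) / (w + cnj v)"
    using nwv by (simp add: \<xi>_def field_simps)
  have Sx: "S \<xi> = w"
    unfolding S_def e1 e2 using vv nwv by simp
  have "cmod (g \<xi>) \<le> cmod \<xi>"
    using Schwarz_Lemma(1)[OF gh g0 g1] x1 by auto
  then have "cmod (q w - q v) / cmod (q w + cnj (q v)) \<le> cmod (w - v) / cmod (w + cnj v)"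
    by (simp add: g_def Sx norm_divide) (simp add: \<xi>_def norm_divide)
  moreover have qq: "q w + cnj (q v) \<noteq> 0" using nz[of "q w" "q v"] q(2) w v by auto
  ultimately have "cmod (q w - q v) * cmod (w + cnj v) \<le> cmod (w - v) * cmod (q w + cnj (q v))"
    using nwv by (simp add: field_simps)
  then have "(cmod (q w - q v) * cmod (w + cnj v))\<^sup>2 \<le> (cmod (w - v) * cmod (q w + cnj (q v)))\<^sup>2"
    by (intro power_mono) auto
  then have "((cmod (q w + cnj (q v)))\<^sup>2 - 4 * Re (q w) * Re (q v)) * (cmod (w + cnj v))\<^sup>2
      \<le> ((cmod (w + cnj v))\<^sup>2 - 4 * Re w * Re v) * (cmod (q w + cnj (q v)))\<^sup>2"
    by (simp add: power_mult_distrib cmod_add_cnj_sq)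
  then show ?thesis by (simp add: algebra_simps)
qed

text \<open>The positive constant \<eta> is added to \<open>q\<close> and then sent to 0. The weak
  hypothesis matters for \<open>residual\<close>, whose real part may vanish.\<close>

lemma schwarz_pick_rhp:
  assumes q: "q holomorphic_on rhp" "\<And>w. w \<in> rhp \<Longrightarrow> 0 \<le> Re (q w)"
    and w: "w \<in> rhp" and v: "v \<in> rhp"
  shows "Re w * Re v * (cmod (q w + cnj (q v)))\<^sup>2 \<le> Re (q w) * Re (q v) * (cmod (w + cnj v))\<^sup>2"
proof -
  let ?l = "\<lambda>\<eta>::real. Re w * Re v * (cmod ((q w + of_real \<eta>) + cnj (q v + of_real \<eta>)))\<^sup>2"
  let ?r = "\<lambda>\<eta>::real. Re (q w + of_real \<eta>) * Re (q v + of_real \<eta>) * (cmod (w + cnj v))\<^sup>2"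
  have "?l \<eta> \<le> ?r \<eta>" if "\<eta> > 0" for \<eta>
    by (rule schwarz_pick_rhp_strict[where q = "\<lambda>z. q z + of_real \<eta>"])
       (use q w v that in \<open>auto intro!: holomorphic_intros add_nonneg_pos\<close>)
  then have ev: "eventually (\<lambda>\<eta>. ?l \<eta> \<le> ?r \<eta>) (at_right 0)"
    by (auto simp: eventually_at_right_less intro: eventually_mono[OF eventually_at_right_less])
  have "(?l \<longlongrightarrow> ?l 0) (at_right 0)" "(?r \<longlongrightarrow> ?r 0) (at_right 0)"
    by (intro tendsto_intros)+
  from tendsto_le[OF _ this(2,1) ev] show ?thesis by simp
qed

text \<open>Schwarz-Pick with base point 1, where the sum of the values has modulus at least
  \<open>Re (q 1)\<close>. Along the positive axis it says that a self-map decays at most linearly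
  at 0.\<close>

lemma Re_lower_bound_rhp:
  assumes q: "q holomorphic_on rhp" "\<And>w. w \<in> rhp \<Longrightarrow> 0 < Re (q w)" and w: "w \<in> rhp"
  shows "Re (q 1) * Re w / (cmod (w + 1))\<^sup>2 \<le> Re (q w)"
proof -
  have "Re w * (Re (q 1))\<^sup>2 \<le> Re w * (cmod (q w + cnj (q 1)))\<^sup>2"
  proof (intro mult_left_mono power_mono)
    have "Re (q 1) \<le> Re (q w + cnj (q 1))" using q(2)[OF w] by simp
    then show "Re (q 1) \<le> cmod (q w + cnj (q 1))" by (metis complex_Re_le_cmod order_trans)
  qed (use q(2)[of 1] w in auto)
  also have "\<dots> \<le> Re (q w) * Re (q 1) * (cmod (w + 1))\<^sup>2"
    using schwarz_pick_rhp_strict[OF q w, of 1] by simp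
  finally have "Re (q 1) * (Re w * Re (q 1)) \<le> Re (q 1) * (Re (q w) * (cmod (w + 1))\<^sup>2)"
    by (simp add: power2_eq_square algebra_simps)
  then have "Re w * Re (q 1) \<le> Re (q w) * (cmod (w + 1))\<^sup>2"
    using q(2)[of 1] by simp
  moreover have "w + 1 \<noteq> 0" using w by (auto simp: complex_eq_iff)
  ultimately show ?thesis by (simp add: field_simps)
qed

text \<open>Along an orbit escaping to infinity, \<open>\<bar>w\<bar>\<^sup>2 / Re w\<close> is unbounded, so it
  increases infinitely often; the invariant form of the Schwarz lemma at those steps yields
  Wolff's inequality in the limit.\<close>

lemma wolff_rhp:
  assumes q: "q holomorphic_on rhp" "\<And>w. w \<in> rhp \<Longrightarrow> 0 < Re (q w)"
    and v: "\<And>n. v n \<in> rhp" "\<And>n. q (v n) = v (Suc n)"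
    and lim: "filterlim v at_infinity sequentially"
    and w: "w \<in> rhp"
  shows "Re w \<le> Re (q w)"
proof -
  \<comment> \<open>This is \<open>1 / Re (1 / v n)\<close>, the factor that remains in the
    Schwarz-Pick inequality once \<open>cmod (w + cnj (v n))\<close> is normalised by
    \<open>cmod (v n)\<close>.\<close>
  define a where "a n = (cmod (v n))\<^sup>2 / Re (v n)" for n
  have nv: "cmod (v n) > 0" for n using v(1)[of n] by auto
  have a_pos: "a n > 0" for n using v(1)[of n] nv by (simp add: a_def)
  have a_ge: "cmod (v n) \<le> a n" for n
    using v(1)[of n] mult_right_mono[OF complex_Re_le_cmod[of "v n"], of "cmod (v n)"]
    by (simp add: a_def field_simps power2_eq_square)
  have nlim: "filterlim (\<lambda>n. cmod (v n)) at_top sequentially"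
    using lim by (simp add: filterlim_at_infinity_conv_norm_at_top)
  have a_lim: "filterlim a at_top sequentially"
    by (rule filterlim_at_top_mono[OF nlim]) (simp add: a_ge)
  \<comment> \<open>A sequence that eventually decreases is bounded above, whereas \<open>a\<close>
    tends to infinity.\<close>
  have freq: "\<exists>\<^sub>F n in sequentially. a n \<le> a (Suc n)"
  proof (rule ccontr)
    assume "\<not> ?thesis"
    then have "\<forall>\<^sub>F n in sequentially. a (Suc n) \<le> a n"
      by (simp add: not_frequently) (auto elim: eventually_mono)
    then obtain N where N: "\<And>n. n \<ge> N \<Longrightarrow> a (Suc n) \<le> a n"
      by (auto simp: eventually_sequentially)
    have "a (N + k) \<le> a N" for k
    proof (induction k)
      case (Suc k)
      then show ?case using N[of "N + k"] by simp
    qed simp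
    then have "\<And>n. n \<ge> N \<Longrightarrow> a n \<le> a N" by (metis le_iff_add)
    moreover from a_lim have "\<forall>\<^sub>F n in sequentially. a N < a n"
      by (simp add: filterlim_at_top_dense)
    then obtain M where "\<And>n. n \<ge> M \<Longrightarrow> a N < a n" by (auto simp: eventually_sequentially)
    ultimately show False by (metis linorder_not_less nle_le)
  qed
  have key: "Re w * (cmod (q w + cnj (v (Suc n))) / cmod (v (Suc n)))\<^sup>2 
      \<le> Re (q w) * (cmod (w + cnj (v n)) / cmod (v n))\<^sup>2" if n: "a n \<le> a (Suc n)" for n
  proof -
    have p: "Re (v n) > 0" "Re (v (Suc n)) > 0" using v(1) by auto
    have "Re w * Re (v n) * (cmod (q w + cnj (v (Suc n))))\<^sup>2
        \<le> Re (q w) * Re (v (Suc n)) * (cmod (w + cnj (v n)))\<^sup>2"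
      using schwarz_pick_rhp_strict[OF q w v(1)[of n]] by (simp add: v(2))
    then have "Re w * (cmod (q w + cnj (v (Suc n))))\<^sup>2 / Re (v (Suc n))
        \<le> Re (q w) * (cmod (w + cnj (v n)))\<^sup>2 / Re (v n)"
      using p by (simp add: field_simps)
    then have 1: "Re w * (cmod (q w + cnj (v (Suc n))) / cmod (v (Suc n)))\<^sup>2 * a (Suc n)
        \<le> Re (q w) * (cmod (w + cnj (v n)) / cmod (v n))\<^sup>2 * a n"
      using nv[of n] nv[of "Suc n"] by (simp add: a_def power_divide)
    also have "\<dots> \<le> Re (q w) * (cmod (w + cnj (v n)) / cmod (v n))\<^sup>2 * a (Suc n)"
      using n q(2)[OF w] by (intro mult_left_mono) auto
    finally show ?thesis using a_pos[of "Suc n"] by simp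
  qed
  have ratio: "(\<lambda>n. cmod (c + cnj (v n)) / cmod (v n)) \<longlonglongrightarrow> 1" for c
  proof -
    have "(\<lambda>n. c / cnj (v n)) \<longlonglongrightarrow> 0"
      by (rule tendsto_divide_0[OF tendsto_const])
         (use nlim in \<open>simp add: filterlim_at_infinity_conv_norm_at_top\<close>)
    then have "(\<lambda>n. cmod (c / cnj (v n) + 1)) \<longlonglongrightarrow> cmod (0 + 1)"
      by (intro tendsto_intros)
    moreover have "cmod (c / cnj (v n) + 1) = cmod (c + cnj (v n)) / cmod (v n)" for n
    proof -
      have "c / cnj (v n) + 1 = (c + cnj (v n)) / cnj (v n)"
        using nv[of n] by (simp add: field_simps)
      then show ?thesis by (simp add: norm_divide)
    qed
    ultimately show ?thesis by simp
  qed
  let ?L = "\<lambda>n. Re w * (cmod (q w + cnj (v (Suc n))) / cmod (v (Suc n)))\<^sup>2"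
  let ?R = "\<lambda>n. Re (q w) * (cmod (w + cnj (v n)) / cmod (v n))\<^sup>2"
  have "?L \<longlonglongrightarrow> Re w * 1\<^sup>2" 
    by (intro tendsto_intros LIMSEQ_Suc[OF ratio])
  moreover have "?R \<longlonglongrightarrow> Re (q w) * 1\<^sup>2"
    by (intro tendsto_intros ratio)
  ultimately have lim': "(\<lambda>n. ?R n - ?L n) \<longlonglongrightarrow> Re (q w) - Re w"
    using tendsto_diff by fastforce
  show ?thesis
  proof (rule ccontr)
    assume "\<not> ?thesis"
    then have "\<forall>\<^sub>F n in sequentially. ?R n - ?L n < 0"
      \<comment> \<open>Both normalised moduli tend to 1, so a failure of the claim would violate
        \<open>key\<close> at all large n, while \<open>key\<close> holds infinitely often.\<close>
      using order_tendstoD(2)[OF lim', of 0] by simp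
    with freq have "\<exists>\<^sub>F n in sequentially. a n \<le> a (Suc n) \<and> ?R n - ?L n < 0"
      by (rule frequently_eventually_conj[OF _ , simplified conj_commute])
    then show False using key by (auto dest!: frequently_ex) (smt (verit) key)
  qed
qed

subsection \<open>The mass of the linearizer at the boundary point\<close>

text \<open>The semigroup survives here only through \<open>shift\<close>: the range of
  \<open>f\<close> is invariant under translation to the right. It is recovered from
  \<open>f\<close> later, as \<open>flow\<close>.\<close>

locale half_plane_linearizer =
  fixes f :: "complex \<Rightarrow> complex"
  assumes holo: "f holomorphic_on rhp"
    and inj: "inj_on f rhp"
    and Re_deriv_nonneg: "w \<in> rhp \<Longrightarrow> 0 \<le> Re (deriv f w)"
    and shift: "w \<in> rhp \<Longrightarrow> 0 \<le> t \<Longrightarrow> f w + of_real t \<in> f ` rhp"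
begin

text \<open>For \<open>Re (deriv f w)\<close> this is the Herglotz weight of the boundary point 0.
  The infimum supplies both the global bound \<open>mass_le\<close> and the nearly extremal points
  of \<open>mass_approx\<close>.\<close>

definition mass :: real where
  "mass = Inf ((\<lambda>w. Re (deriv f w) / Re (1 / w)) ` rhp)"

lemma mass_nonneg: "0 \<le> mass"
  and mass_le: "w \<in> rhp \<Longrightarrow> mass * Re (1 / w) \<le> Re (deriv f w)"
  and mass_approx: "0 < \<epsilon> \<Longrightarrow> \<exists>w\<in>rhp. Re (deriv f w) \<le> (mass + \<epsilon>) * Re (1 / w)"
proof -
  define R where "R = (\<lambda>w. Re (deriv f w) / Re (1 / w)) ` rhp"
  have m: "mass = Inf R" by (simp add: mass_def R_def)
  have "1 \<in> rhp" by simp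
  then have ne: "R \<noteq> {}" unfolding R_def by blast
  have R0: "0 \<le> x" if x: "x \<in> R" for x
  proof -
    obtain w where w: "w \<in> rhp" "x = Re (deriv f w) / Re (1 / w)" using x unfolding R_def by blast
    show ?thesis unfolding w(2) by (intro divide_nonneg_pos Re_deriv_nonneg Re_inverse_pos w(1))
  qed
  have bdd: "bdd_below R" using R0 unfolding bdd_below_def by blast
  show "0 \<le> mass" unfolding m using ne R0 by (rule cInf_greatest)
  show "mass * Re (1 / w) \<le> Re (deriv f w)" if w: "w \<in> rhp"
  proof -
    have "mass \<le> Re (deriv f w) / Re (1 / w)"
      unfolding m by (intro cInf_lower bdd) (use w in \<open>simp add: R_def\<close>)
    then show ?thesis by (simp only: pos_le_divide_eq[OF Re_inverse_pos[OF w]])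
  qed
  show "\<exists>w\<in>rhp. Re (deriv f w) \<le> (mass + \<epsilon>) * Re (1 / w)" if "0 < \<epsilon>"
  proof -
    obtain x where x: "x \<in> R" "x < mass + \<epsilon>"
      using cInf_lessD[OF ne, of "mass + \<epsilon>"] \<open>0 < \<epsilon>\<close> by (auto simp: m)
    obtain w where w: "w \<in> rhp" "x = Re (deriv f w) / Re (1 / w)" using x(1) unfolding R_def by blast
    have "Re (deriv f w) < (mass + \<epsilon>) * Re (1 / w)"
      using x(2) by (simp only: w(2) pos_divide_less_eq[OF Re_inverse_pos[OF w(1)]])
    then show ?thesis using w(1) less_imp_le by blast
  qed
qed

lemma deriv_holo: "deriv f holomorphic_on rhp"
  by (intro holomorphic_deriv holo open_rhp)

lemma has_deriv: "w \<in> rhp \<Longrightarrow> (f has_field_derivative deriv f w) (at w)"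
  by (rule holomorphic_derivI[OF holo open_rhp])

definition residual :: "complex \<Rightarrow> complex" where
  "residual w = deriv f w - of_real mass / w"

lemma residual_holo: "residual holomorphic_on rhp"
  unfolding residual_def by (intro holomorphic_intros deriv_holo) auto

lemma Re_residual_nonneg: "w \<in> rhp \<Longrightarrow> 0 \<le> Re (residual w)"
  using mass_le[of w] by (simp add: residual_def Re_divide)

text \<open>A nearly extremal point for the mass makes \<open>Re (residual v)\<close> small compared
  with \<open>Re (1 / v)\<close>. Schwarz-Pick at \<open>v\<close> transfers this smallness to every
  \<open>w\<close> closer to 0, and since it controls the modulus of the sum, the imaginary part of
  \<open>residual\<close> is controlled as well.\<close>

lemma residual_bound:
  assumes "0 < \<epsilon>"
  obtains v where "v \<in> rhp"
    "\<And>w. w \<in> rhp \<Longrightarrow> cmod w \<le> cmod v \<Longrightarrow> cmod (residual w + cnj (residual v)) \<le> \<epsilon> / Re w"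
proof -
  \<comment> \<open>The 4 compensates for the square of
    \<open>cmod (w + cnj v) \<le> 2 * cmod v\<close>.\<close>
  obtain v where v: "v \<in> rhp" "Re (deriv f v) \<le> (mass + \<epsilon> / 4) * Re (1 / v)"
    using mass_approx[of "\<epsilon> / 4"] assms by auto
  have v0: "cmod v > 0" "Re v > 0" using v(1) by auto
  have rv: "Re (residual v) \<le> \<epsilon> / 4 * (Re v / (cmod v)\<^sup>2)"
  proof -
    have "Re (residual v) = Re (deriv f v) - mass * Re (1 / v)"
      by (simp add: residual_def Re_divide)
    also have "\<dots> \<le> (mass + \<epsilon> / 4) * Re (1 / v) - mass * Re (1 / v)"
      using v(2) by linarith
    also have "\<dots> = \<epsilon> / 4 * Re (1 / v)" by (simp only: distrib_right)
    finally show ?thesis by (simp only: Re_one_over)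
  qed
  show ?thesis
  proof (rule that[OF v(1)])
    fix w assume w: "w \<in> rhp" "cmod w \<le> cmod v"
    \<comment> \<open>Since \<open>Re (residual v)\<close> is nonnegative, \<open>Q\<close> also
      dominates \<open>Re (residual w)\<close>; one factor \<open>Q\<close> therefore cancels from
      the quadratic Schwarz-Pick inequality.\<close>
    define Q where "Q = cmod (residual w + cnj (residual v))"
    have Qw: "Re (residual w) \<le> Q"
      using Re_residual_nonneg[OF v(1)] complex_Re_le_cmod[of "residual w + cnj (residual v)"]
      by (simp add: Q_def)
    have Q0: "0 \<le> Q" by (simp add: Q_def)
    have sq: "(cmod (w + cnj v))\<^sup>2 \<le> (2 * cmod v)\<^sup>2"
      using norm_triangle_ineq[of w "cnj v"] w by (intro power_mono) auto
    have "Re (residual w) * Re (residual v) \<le> Q * (\<epsilon> / 4 * (Re v / (cmod v)\<^sup>2))"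
      by (rule mult_mono[OF Qw rv Q0 Re_residual_nonneg[OF v(1)]])
    then have "Re (residual w) * Re (residual v) * (cmod (w + cnj v))\<^sup>2
        \<le> Q * (\<epsilon> / 4 * (Re v / (cmod v)\<^sup>2)) * (2 * cmod v)\<^sup>2"
      by (rule mult_mono[OF _ sq]) (use Q0 assms v0 in auto)
    with schwarz_pick_rhp[OF residual_holo Re_residual_nonneg w(1) v(1)]
    have "Re w * Re v * Q\<^sup>2 \<le> Q * (\<epsilon> / 4 * (Re v / (cmod v)\<^sup>2)) * (2 * cmod v)\<^sup>2"
      unfolding Q_def by linarith
    also have "\<dots> = Q * \<epsilon> * Re v" using v0 by (simp add: power2_eq_square)
    finally have *: "(Re w * Q) * (Q * Re v) \<le> \<epsilon> * (Q * Re v)"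
      by (simp add: power2_eq_square algebra_simps)
    have "Re w * Q \<le> \<epsilon> \<or> Q = 0"
    proof (cases "Q = 0")
      case False
      then have "0 < Q * Re v" using Q0 v0 by simp
      then show ?thesis using * mult_le_cancel_right_pos by blast
    qed simp
    then show "cmod (residual w + cnj (residual v)) \<le> \<epsilon> / Re w"
      using w assms by (auto simp: Q_def[symmetric] field_simps)
  qed
qed

text \<open>The bound by \<open>1 / Re w\<close> instead of \<open>Re (1 / w)\<close> holds in a
  full half-disc, not just in sectors. It can thus be integrated along horizontal lines for
  unrestricted approach.\<close>

lemma Re_deriv_upper:
  assumes "0 < \<epsilon>"
  shows "\<exists>\<delta>>0. \<forall>w\<in>rhp. cmod w < \<delta> \<longrightarrow> Re (deriv f w) \<le> (mass + \<epsilon>) / Re w"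
proof -
  obtain v where v: "v \<in> rhp"
    and b: "\<And>w. w \<in> rhp \<Longrightarrow> cmod w \<le> cmod v \<Longrightarrow> cmod (residual w + cnj (residual v)) \<le> \<epsilon> / Re w"
    using residual_bound[OF assms] by blast
  show ?thesis
  proof (intro exI[of _ "cmod v"] conjI ballI impI)
    show "0 < cmod v" using v by auto
    fix w assume w: "w \<in> rhp" "cmod w < cmod v"
    have "Re (residual w) \<le> \<epsilon> / Re w"
      using b[of w] w Re_residual_nonneg[OF v] complex_Re_le_cmod[of "residual w + cnj (residual v)"]
      by simp
    moreover have "Re (1 / w) \<le> 1 / Re w"
    proof -
      have "(Re w)\<^sup>2 \<le> (cmod w)\<^sup>2" by (intro power_mono complex_Re_le_cmod) (use w in auto)
      moreover have "0 < (cmod w)\<^sup>2" "0 < Re w" using w by auto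
      ultimately have "Re w / (cmod w)\<^sup>2 \<le> 1 / Re w"
        by (simp add: divide_simps power2_eq_square)
      then show ?thesis by (simp only: Re_one_over)
    qed
    then have "mass * Re (1 / w) \<le> mass * (1 / Re w)" using mass_nonneg by (intro mult_left_mono)
    ultimately show "Re (deriv f w) \<le> (mass + \<epsilon>) / Re w"
      by (simp add: residual_def Re_divide add_divide_distrib)
  qed
qed

text \<open>In a sector \<open>Re w\<close> is comparable to \<open>cmod w\<close>, so
  \<open>residual_bound\<close> becomes an o(1/\<bar>w\<bar>) estimate; the fixed value
  \<open>residual v\<close> is negligible for small \<open>w\<close>.\<close>

lemma residual_sector:
  assumes "0 < k" "0 < \<epsilon>"
  shows "\<exists>\<delta>>0. \<forall>w\<in>sector k. cmod w < \<delta> \<longrightarrow> cmod (residual w) \<le> \<epsilon> / cmod w"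
proof -
  obtain v where v: "v \<in> rhp"
    and b: "\<And>w. w \<in> rhp \<Longrightarrow> cmod w \<le> cmod v \<Longrightarrow> cmod (residual w + cnj (residual v)) \<le> (\<epsilon> * k / 2) / Re w"
    using residual_bound[of "\<epsilon> * k / 2"] assms by (metis half_gt_zero mult_pos_pos)
  \<comment> \<open>The summand 1 keeps \<open>\<epsilon> / (2 * K)\<close> a positive radius even
    if \<open>residual v = 0\<close>.\<close>
  define K where "K = cmod (residual v) + 1"
  have K: "K > 0" by (simp add: K_def add_nonneg_pos)
  show ?thesis
  proof (intro exI[of _ "min (cmod v) (\<epsilon> / (2 * K))"] conjI ballI impI)
    show "0 < min (cmod v) (\<epsilon> / (2 * K))" using v assms K by auto
    fix w assume w: "w \<in> sector k" "cmod w < min (cmod v) (\<epsilon> / (2 * K))"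
    have w': "w \<in> rhp" "w \<noteq> 0" "k * cmod w \<le> Re w" 
      using w sector_subset_rhp[OF assms(1)] by (auto simp: sector_def)
    have "cmod (residual w) \<le> cmod (residual w + cnj (residual v)) + cmod (residual v)"
      using norm_triangle_ineq4[of "residual w + cnj (residual v)" "cnj (residual v)"] by simp
    also have "cmod (residual w + cnj (residual v)) \<le> (\<epsilon> * k / 2) / Re w"
      using b w w' by auto
    also have "(\<epsilon> * k / 2) / Re w \<le> (\<epsilon> * k / 2) / (k * cmod w)"
      using assms w' by (intro divide_left_mono) auto
    also have "\<dots> = (\<epsilon> / 2) / cmod w" using assms by simp
    also have "cmod (residual v) \<le> (\<epsilon> / 2) / cmod w"
    proof -
      have "cmod (residual v) \<le> K" by (simp add: K_def)
      also have "K \<le> (\<epsilon> / 2) / cmod w" using w w' K by (simp add: field_simps)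
      finally show ?thesis .
    qed
    finally show "cmod (residual w) \<le> \<epsilon> / cmod w" by simp
  qed
qed

lemma deriv_sector_limit:
  assumes "0 < k"
  shows "((\<lambda>w. w * deriv f w) \<longlongrightarrow> of_real mass) (at 0 within sector k)"
  unfolding Lim_within
proof (intro allI impI)
  fix \<epsilon> :: real assume "0 < \<epsilon>"
  then obtain \<delta> where d: "0 < \<delta>" "\<And>w. w \<in> sector k \<Longrightarrow> cmod w < \<delta> \<Longrightarrow> cmod (residual w) \<le> (\<epsilon> / 2) / cmod w"
    using residual_sector[OF assms, of "\<epsilon> / 2"] by auto
  show "\<exists>d>0. \<forall>w\<in>sector k. 0 < dist w 0 \<and> dist w 0 < d \<longrightarrow> dist (w * deriv f w) (of_real mass) < \<epsilon>"
  proof (intro exI[of _ \<delta>] conjI ballI impI d(1))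
    fix w assume w: "w \<in> sector k" "0 < dist w 0 \<and> dist w 0 < \<delta>"
    then have "w * deriv f w - of_real mass = w * residual w"
      by (auto simp: residual_def algebra_simps)
    then have "dist (w * deriv f w) (of_real mass) = cmod w * cmod (residual w)"
      by (simp add: dist_norm norm_mult)
    also have "\<dots> \<le> \<epsilon> / 2" using d(2)[OF w(1)] w by (simp add: field_simps)
    finally show "dist (w * deriv f w) (of_real mass) < \<epsilon>" using \<open>0 < \<epsilon>\<close> by simp
  qed
qed

definition f0 :: "complex \<Rightarrow> complex" where
  "f0 w = f w - of_real mass * Ln w"

lemma f0_has_deriv: "w \<in> rhp \<Longrightarrow> (f0 has_field_derivative residual w) (at w)"
  unfolding f0_def residual_def
  by (auto intro!: derivative_eq_intros has_deriv simp: complex_nonpos_Reals_iff divide_inverse)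

text \<open>The derivative of \<open>f0\<close> is o(1/\<bar>w\<bar>), and a segment between points
  of comparable modulus has length O(\<bar>w\<bar>). Only increments over such pairs are controlled;
  convergence of \<open>f0\<close> is not claimed.\<close>

lemma f0_slow:
  assumes "0 < k" "0 < M" "0 < \<epsilon>"
  shows "\<exists>\<delta>>0. \<forall>w\<in>sector k. \<forall>w'\<in>sector k. cmod w < \<delta> \<and> cmod w' < \<delta> \<and>
       cmod w' \<le> M * cmod w \<and> cmod w \<le> M * cmod w' \<longrightarrow> cmod (f0 w' - f0 w) \<le> \<epsilon>"
proof -
  define N where "N = 1 + M"
  \<comment> \<open>On the segment the modulus is at least \<open>k * cmod w\<close>, and the length
    is at most \<open>N * cmod w\<close>; this \<eta> makes the product of the two bounds equal to
    \<epsilon>.\<close>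
  define \<eta> where "\<eta> = \<epsilon> * k / N"
  have "N > 0" using assms(2) by (simp add: N_def)
  then have "\<eta> > 0" using assms by (simp add: \<eta>_def)
  obtain \<delta> where d: "0 < \<delta>" "\<And>w. w \<in> sector k \<Longrightarrow> cmod w < \<delta> \<Longrightarrow> cmod (residual w) \<le> \<eta> / cmod w"
    using residual_sector[OF assms(1) \<open>0 < \<eta>\<close>] by auto
  have main: "cmod (f0 w' - f0 w) \<le> \<epsilon>"
    if w: "w \<in> sector k" "w' \<in> sector k" "cmod w < \<delta>" "cmod w' < \<delta>" "cmod w' \<le> M * cmod w" "cmod w \<le> cmod w'" for w w'
  proof -
    have w0: "cmod w > 0" using w by (auto simp: sector_def)
    have kw: "k * cmod w \<le> Re w" "k * cmod w \<le> Re w'"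
    proof -
      have "k * cmod w \<le> k * cmod w'" using w(6) assms by simp
      moreover have "k * cmod w' \<le> Re w'" using w(2) by (simp add: sector_def)
      ultimately show "k * cmod w \<le> Re w'" by linarith
      show "k * cmod w \<le> Re w" using w(1) by (simp add: sector_def)
    qed
    \<comment> \<open>A sector is convex, and real parts on the segment stay above the smaller
      endpoint bound, so the segment keeps away from the vertex.\<close>
    have seg: "z \<in> sector k \<and> k * cmod w \<le> cmod z \<and> cmod z < \<delta>" if z: "z \<in> closed_segment w w'" for z
    proof -
      obtain u where u: "0 \<le> u" "u \<le> 1" "z = (1 - u) *\<^sub>R w + u *\<^sub>R w'"
        using z by (auto simp: closed_segment_def)
      have n: "cmod z \<le> (1 - u) * cmod w + u * cmod w'"
        using norm_triangle_ineq[of "(1 - u) *\<^sub>R w" "u *\<^sub>R w'"] u by simp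
      have "k * cmod z \<le> (1 - u) * (k * cmod w) + u * (k * cmod w')"
        using mult_left_mono[OF n, of k] assms by (simp add: algebra_simps)
      also have "\<dots> \<le> (1 - u) * Re w + u * Re w'"
        using w u by (intro add_mono mult_left_mono) (auto simp: sector_def)
      also have "\<dots> = Re z" using u by simp
      finally have 1: "k * cmod z \<le> Re z" .
      have "k * cmod w = (1 - u) * (k * cmod w) + u * (k * cmod w)" by (simp add: algebra_simps)
      also have "\<dots> \<le> (1 - u) * Re w + u * Re w'"
        using kw u by (intro add_mono mult_left_mono) auto
      also have "\<dots> = Re z" using u by simp
      finally have 2: "k * cmod w \<le> Re z" .
      have "cmod z \<le> cmod w'" 
      proof -
        have "(1 - u) * cmod w \<le> (1 - u) * cmod w'" using u w by (intro mult_left_mono) auto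
        moreover have "(1 - u) * cmod w' + u * cmod w' = cmod w'" by (simp add: algebra_simps)
        ultimately show ?thesis using n by linarith
      qed
      moreover have "0 < Re z" using 2 mult_pos_pos[OF assms(1) w0] by linarith
      then have "z \<noteq> 0" by auto
      ultimately show ?thesis using 1 2 w(4) complex_Re_le_cmod[of z] unfolding sector_def by simp
    qed
    have "cmod (f0 w' - f0 w) \<le> (\<eta> / (k * cmod w)) * cmod (w' - w)"
    proof (rule field_differentiable_bound[where f = f0 and f' = residual and S = "closed_segment w w'" and x = w' and y = w])
      fix z assume z: "z \<in> closed_segment w w'"
      show "(f0 has_field_derivative residual z) (at z within closed_segment w w')"
        using seg[OF z] sector_subset_rhp[OF assms(1)]
        by (intro has_field_derivative_at_within[OF f0_has_deriv]) auto
      have "cmod (residual z) \<le> \<eta> / cmod z" using d(2) seg[OF z] by auto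
      also have "\<dots> \<le> \<eta> / (k * cmod w)"
        using seg[OF z] w0 assms(1) \<open>\<eta> > 0\<close> unfolding sector_def by (intro divide_left_mono mult_pos_pos) auto
      finally show "cmod (residual z) \<le> \<eta> / (k * cmod w)" .
    qed (rule convex_closed_segment ends_in_segment)+
    also have "\<dots> \<le> (\<eta> / (k * cmod w)) * (N * cmod w)"
    proof (rule mult_left_mono)
      show "cmod (w' - w) \<le> N * cmod w"
        using norm_triangle_ineq4[of w' w] w by (simp add: N_def algebra_simps)
      show "0 \<le> \<eta> / (k * cmod w)"
        using w0 assms(1) \<open>\<eta> > 0\<close> by (intro divide_nonneg_pos mult_pos_pos) linarith+
    qed
    also have "\<dots> = \<epsilon>" using w0 assms(1) \<open>N > 0\<close> by (simp add: \<eta>_def)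
    finally show ?thesis .
  qed
  show ?thesis
  proof (intro exI[of _ \<delta>] conjI ballI impI d(1))
    fix w w' assume "w \<in> sector k" "w' \<in> sector k" "cmod w < \<delta> \<and> cmod w' < \<delta> \<and>
       cmod w' \<le> M * cmod w \<and> cmod w \<le> M * cmod w'"
    then have "cmod (f0 w' - f0 w) \<le> \<epsilon> \<or> cmod (f0 w - f0 w') \<le> \<epsilon>"
      using main by (meson linear)
    then show "cmod (f0 w' - f0 w) \<le> \<epsilon>"
      by (simp only: norm_minus_commute[of "f0 w'" "f0 w"] disj_absorb)
  qed
qed

end

subsection \<open>Oscillation of the imaginary part\<close>

lemma has_vector_derivative_horizontal: "((\<lambda>x. Complex x y) has_vector_derivative 1) (at x)"
  unfolding Complex_eq by (auto intro!: derivative_eq_intros)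

lemma has_vector_derivative_vertical: "((\<lambda>y. Complex x y) has_vector_derivative \<i>) (at y)"
  unfolding Complex_eq by (auto intro!: derivative_eq_intros)

lemma
  assumes "(g has_field_derivative D) (at (Complex x y))"
  shows Re_horizontal: "((\<lambda>x. Re (g (Complex x y))) has_real_derivative Re D) (at x)"
    and Re_vertical: "((\<lambda>y. Re (g (Complex x y))) has_real_derivative - Im D) (at y)"
    and Im_vertical: "((\<lambda>y. Im (g (Complex x y))) has_real_derivative Re D) (at y)"
proof -
  note h = field_vector_diff_chain_at[OF has_vector_derivative_horizontal assms]
  note v = field_vector_diff_chain_at[OF has_vector_derivative_vertical assms]
  show "((\<lambda>x. Re (g (Complex x y))) has_real_derivative Re D) (at x)"
    using bounded_linear.has_vector_derivative[OF bounded_linear_Re h]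
    by (simp add: has_real_derivative_iff_has_vector_derivative o_def)
  show "((\<lambda>y. Re (g (Complex x y))) has_real_derivative - Im D) (at y)"
    using bounded_linear.has_vector_derivative[OF bounded_linear_Re v]
    by (simp add: has_real_derivative_iff_has_vector_derivative o_def)
  show "((\<lambda>y. Im (g (Complex x y))) has_real_derivative Re D) (at y)"
    using bounded_linear.has_vector_derivative[OF bounded_linear_Im v]
    by (simp add: has_real_derivative_iff_has_vector_derivative o_def)
qed

lemma at_0_rhp_neq_bot: "at 0 within rhp \<noteq> (bot :: complex filter)"
  unfolding trivial_limit_within islimpt_approachable
proof (intro notI, elim notE, intro allI impI)
  fix e :: real assume "0 < e"
  then show "\<exists>x'\<in>rhp. x' \<noteq> 0 \<and> dist x' 0 < e"
    by (intro bexI[of _ "of_real (e / 2)"]) auto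
qed

context half_plane_linearizer
begin

section \<open>Monotonicity along lines and logarithmic bounds\<close>

lemma Re_f_mono_horizontal:
  assumes "0 < x" "x \<le> x'"
  shows "Re (f (Complex x y)) \<le> Re (f (Complex x' y))"
proof (rule DERIV_nonneg_imp_nondecreasing[OF assms(2)])
  fix s assume "x \<le> s" "s \<le> x'"
  then have s: "Complex s y \<in> rhp" using assms by simp
  show "\<exists>d. ((\<lambda>x. Re (f (Complex x y))) has_real_derivative d) (at s) \<and> 0 \<le> d"
    using Re_horizontal[OF has_deriv[OF s]] Re_deriv_nonneg[OF s] by blast
qed

lemma Im_f_mono_vertical:
  assumes "0 < x" "y \<le> y'"
  shows "Im (f (Complex x y)) \<le> Im (f (Complex x y'))"
proof (rule DERIV_nonneg_imp_nondecreasing[OF assms(2)])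
  fix s
  have s: "Complex x s \<in> rhp" using assms by simp
  show "\<exists>d. ((\<lambda>y. Im (f (Complex x y))) has_real_derivative d) (at s) \<and> 0 \<le> d"
    using Im_vertical[OF has_deriv[OF s]] Re_deriv_nonneg[OF s] by blast
qed

text \<open>\<open>mass_le\<close> is integrated along the real axis, where
  \<open>Re (1 / s)\<close> is \<open>1 / s\<close>.\<close>

lemma Re_f_le_log:
  assumes "0 < x" "x \<le> 1"
  shows "Re (f (of_real x)) \<le> Re (f 1) + mass * ln x"
proof -
  have "Re (f (Complex x 0)) - mass * ln x \<le> Re (f (Complex 1 0)) - mass * ln 1"
  proof (rule DERIV_nonneg_imp_nondecreasing[OF assms(2)])
    fix s assume "x \<le> s" "s \<le> 1"
    then have s: "Complex s 0 \<in> rhp" "0 < s" using assms by auto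
    have "((\<lambda>x. Re (f (Complex x 0)) - mass * ln x) has_real_derivative
        Re (deriv f (Complex s 0)) - mass * (1 / s)) (at s)"
      by (intro DERIV_diff Re_horizontal has_deriv s(1) DERIV_cmult DERIV_ln_divide s(2))
    moreover have "0 \<le> Re (deriv f (Complex s 0)) - mass * (1 / s)"
    proof -
      have "Re (1 / Complex s 0) = 1 / s" using s(2) by (simp add: Re_divide power2_eq_square)
      then show ?thesis using mass_le[OF s(1)] by simp
    qed
    ultimately show "\<exists>d. ((\<lambda>x. Re (f (Complex x 0)) - mass * ln x) has_real_derivative d) (at s) \<and> 0 \<le> d"
      by blast
  qed
  then show ?thesis by (simp add: complex_of_real_def one_complex.code)
qed

lemma continuous_near:
  assumes "w \<in> rhp" "0 < \<epsilon>"
  shows "\<exists>d>0. \<forall>z. cmod (z - w) < d \<longrightarrow> cmod (f z - f w) < \<epsilon>"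
proof -
  have "isCont f w" using has_deriv[OF assms(1)] by (rule DERIV_isCont)
  then show ?thesis using assms(2)
    unfolding continuous_at_eps_delta dist_norm by blast
qed

text \<open>The logarithmic bound lives on the real axis only. By continuity it spreads to a short
  vertical segment through \<rho>, and monotonicity along horizontal lines carries it to all points
  to the left of that segment, hence to a half-disc at 0.\<close>

lemma Re_f_to_neg_infinity:
  assumes "0 < mass"
  shows "filterlim (\<lambda>w. Re (f w)) at_bot (at 0 within rhp)"
  unfolding filterlim_at_bot
proof
  fix Z :: real
  \<comment> \<open>Chosen so that \<open>Re_f_le_log\<close> gives the value \<open>Z - 1\<close>
    at \<rho>; the missing 1 is spent on continuity near \<rho>.\<close>
  define \<rho> where "\<rho> = min 1 (exp ((Z - 1 - Re (f 1)) / mass))"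
  have \<rho>: "0 < \<rho>" "\<rho> \<le> 1" by (auto simp: \<rho>_def)
  have "ln \<rho> \<le> (Z - 1 - Re (f 1)) / mass"
  proof -
    have "ln \<rho> \<le> ln (exp ((Z - 1 - Re (f 1)) / mass))"
      using \<rho> by (subst ln_le_cancel_iff) (auto simp: \<rho>_def)
    then show ?thesis by simp
  qed
  then have "mass * ln \<rho> \<le> Z - 1 - Re (f 1)" using assms by (simp add: field_simps)
  then have Z: "Re (f (of_real \<rho>)) \<le> Z - 1" using Re_f_le_log[OF \<rho>] by linarith
  have "complex_of_real \<rho> \<in> rhp" using \<rho> by simp
  then obtain d where d: "0 < d" "\<And>z. cmod (z - of_real \<rho>) < d \<Longrightarrow> cmod (f z - f (of_real \<rho>)) < 1"
    using continuous_near[OF _ zero_less_one] by blast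
  have "Re (f w) \<le> Z" if w: "w \<in> rhp" "cmod w < min d \<rho>" for w
  proof -
    have "Re w \<le> \<rho>" "\<bar>Im w\<bar> < d"
      using w abs_Re_le_cmod[of w] abs_Im_le_cmod[of w] by auto
    then have "Re (f (Complex (Re w) (Im w))) \<le> Re (f (Complex \<rho> (Im w)))"
      using w by (intro Re_f_mono_horizontal) auto
    moreover have "cmod (Complex \<rho> (Im w) - of_real \<rho>) < d"
      using \<open>\<bar>Im w\<bar> < d\<close> by (simp add: complex_of_real_def cmod_def)
    then have "cmod (f (Complex \<rho> (Im w)) - f (of_real \<rho>)) < 1" by (rule d)
    then have "Re (f (Complex \<rho> (Im w))) < Re (f (of_real \<rho>)) + 1"
      using abs_Re_le_cmod[of "f (Complex \<rho> (Im w)) - f (of_real \<rho>)"] by simp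
    ultimately show ?thesis using Z by simp
  qed
  then show "\<forall>\<^sub>F w in at 0 within rhp. Re (f w) \<le> Z"
    unfolding eventually_at using d(1) \<rho>(1) by (intro exI[of _ "min d \<rho>"]) auto
qed

text \<open>\<open>Re_deriv_upper\<close> is integrated from \<open>w\<close> horizontally to a
  fixed vertical segment, on which \<open>f\<close> is bounded by continuity.\<close>

lemma Re_f_ge_log:
  assumes "mass < b"
  shows "\<exists>\<delta>>0. \<exists>C. \<forall>w\<in>rhp. cmod w < \<delta> \<longrightarrow> b * ln (Re w) - C \<le> Re (f w)"
proof -
  obtain \<delta> where \<delta>: "0 < \<delta>" "\<And>w. w \<in> rhp \<Longrightarrow> cmod w < \<delta> \<Longrightarrow> Re (deriv f w) \<le> b / Re w"
    using Re_deriv_upper[of "b - mass"] assms by auto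
  define x0 where "x0 = \<delta> / 2"
  have x0: "0 < x0" using \<delta> by (simp add: x0_def)
  then have "complex_of_real x0 \<in> rhp" by simp
  then obtain d where d: "0 < d" "\<And>z. cmod (z - of_real x0) < d \<Longrightarrow> cmod (f z - f (of_real x0)) < 1"
    using continuous_near[OF _ zero_less_one] by blast
  have "b * ln (Re w) - (b * ln x0 - Re (f (of_real x0)) + 1) \<le> Re (f w)"
    if w: "w \<in> rhp" "cmod w < min d x0" for w
  proof -
    have rw: "0 < Re w" "Re w \<le> x0" "\<bar>Im w\<bar> < d" "\<bar>Im w\<bar> < x0"
      using w abs_Re_le_cmod[of w] abs_Im_le_cmod[of w] by auto
    have "b * ln (Re w) - Re (f (Complex (Re w) (Im w))) \<le> b * ln x0 - Re (f (Complex x0 (Im w)))"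
    proof (rule DERIV_nonneg_imp_nondecreasing[OF rw(2)])
      fix s assume s: "Re w \<le> s" "s \<le> x0"
      have s': "Complex s (Im w) \<in> rhp" "0 < s" using rw s by auto
      have "cmod (Complex s (Im w)) < \<delta>"
        using cmod_le[of "Complex s (Im w)"] s s' rw by (simp add: x0_def)
      then have le: "Re (deriv f (Complex s (Im w))) \<le> b / s" using \<delta>(2)[OF s'(1)] by simp
      have "((\<lambda>x. b * ln x - Re (f (Complex x (Im w)))) has_real_derivative
          b * (1 / s) - Re (deriv f (Complex s (Im w)))) (at s)"
        by (intro DERIV_diff Re_horizontal has_deriv s'(1) DERIV_cmult DERIV_ln_divide s'(2))
      then show "\<exists>d. ((\<lambda>x. b * ln x - Re (f (Complex x (Im w)))) has_real_derivative d) (at s) \<and> 0 \<le> d"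
        using le by (intro exI conjI) auto
    qed
    moreover have "cmod (Complex x0 (Im w) - of_real x0) < d"
      using rw by (simp add: complex_of_real_def cmod_def)
    then have "cmod (f (Complex x0 (Im w)) - f (of_real x0)) < 1" by (rule d)
    then have "Re (f (of_real x0)) - 1 < Re (f (Complex x0 (Im w)))"
      using abs_Re_le_cmod[of "f (Complex x0 (Im w)) - f (of_real x0)"] by simp
    ultimately show ?thesis by simp
  qed
  moreover have "0 < min d x0" using d(1) x0 by simp
  ultimately show ?thesis by blast
qed

text \<open>Small half-discs are connected, so \<open>Im f\<close> takes all intermediate values
  there. Together with \<open>shift\<close>, values with arbitrarily negative real part fill a whole
  horizontal line of the range.\<close>

lemma Im_f_attains:
  assumes lim: "filterlim (\<lambda>w. Re (f w)) at_bot (at 0 within rhp)"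
    and freq: "\<exists>\<^sub>F w in at 0 within rhp. Im (f w) \<le> A" "\<exists>\<^sub>F w in at 0 within rhp. B \<le> Im (f w)"
    and c: "A \<le> c" "c \<le> B" and \<delta>: "0 < \<delta>"
  shows "\<exists>w\<in>rhp. cmod w < \<delta> \<and> Im (f w) = c \<and> Re (f w) \<le> X"
proof -
  have "\<forall>\<^sub>F w in at 0 within rhp. Re (f w) \<le> X"
    using lim by (simp add: filterlim_at_bot)
  then obtain d where d: "0 < d" "\<And>w. w \<in> rhp \<Longrightarrow> w \<noteq> 0 \<Longrightarrow> cmod w < d \<Longrightarrow> Re (f w) \<le> X"
    by (auto simp: eventually_at)
  define S where "S = rhp \<inter> ball 0 (min d \<delta>)"
  have ev: "\<forall>\<^sub>F w in at 0 within rhp. w \<in> S"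
    unfolding eventually_at S_def using d \<delta> by (intro exI[of _ "min d \<delta>"]) auto
  obtain w1 where w1: "w1 \<in> S" "Im (f w1) \<le> A"
    using frequently_ex[OF frequently_eventually_conj[OF freq(1) ev]] by blast
  obtain w2 where w2: "w2 \<in> S" "B \<le> Im (f w2)"
    using frequently_ex[OF frequently_eventually_conj[OF freq(2) ev]] by blast
  have "connected S" unfolding S_def by (intro convex_connected convex_Int convex_rhp convex_ball)
  moreover have "continuous_on S (\<lambda>w. Im (f w))"
    using holomorphic_on_imp_continuous_on[OF holo] unfolding S_def
    by (intro continuous_intros) (auto intro: continuous_on_subset)
  ultimately have "connected ((\<lambda>w. Im (f w)) ` S)" by (rule connected_continuous_image[rotated])
  then have "c \<in> (\<lambda>w. Im (f w)) ` S"
    by (rule connectedD_interval[of _ "Im (f w1)" "Im (f w2)"]) (use w1 w2 c in auto)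
  then obtain w where "w \<in> S" "c = Im (f w)" by blast
  moreover from this have "w \<noteq> 0" by (auto simp: S_def)
  ultimately show ?thesis using d(2)[of w] by (intro bexI[of _ w]) (auto simp: S_def)
qed

text \<open>If the strip \<open>A \<le> Im \<zeta> \<le> B\<close> lies in the range of \<open>f\<close>, the inverse of \<open>f\<close> on it,
  precomposed with the Riemann map of the half plane onto the strip, is a self-map of the
  half plane and so decays at most linearly at the origin; this is incompatible with the
  logarithmic lower bound for \<open>Re f\<close> unless \<open>B - A \<le> \<pi> mass\<close>.\<close>

lemma oscillation_le:
  assumes lim: "filterlim (\<lambda>w. Re (f w)) at_bot (at 0 within rhp)"
    and freq: "\<exists>\<^sub>F w in at 0 within rhp. Im (f w) \<le> A" "\<exists>\<^sub>F w in at 0 within rhp. B \<le> Im (f w)"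
  shows "B - A \<le> pi * mass"
proof (rule ccontr)
  assume contra: "\<not> ?thesis"
  note attains = Im_f_attains[OF lim freq]
  \<comment> \<open>\<open>\<i> * c + l * Ln w\<close> maps the half plane onto the open strip
    between heights A and B, so \<open>mass < l\<close> is exactly the negated claim.\<close>
  define l where "l = (B - A) / pi"
  define c where "c = (A + B) / 2"
  have ml: "mass < l" using contra by (simp add: l_def field_simps)
  have l0: "0 < l" using ml mass_nonneg by linarith
  have AB: "A < B" using l0 by (simp add: l_def zero_less_divide_iff)
  have lpi: "l * pi = B - A" by (simp add: l_def)
  have strip: "\<zeta> \<in> f ` rhp" if z: "A \<le> Im \<zeta>" "Im \<zeta> \<le> B" for \<zeta>
  proof -
    obtain w where w: "w \<in> rhp" "Im (f w) = Im \<zeta>" "Re (f w) \<le> Re \<zeta>"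
      using attains[OF z zero_less_one, of "Re \<zeta>"] by auto
    then have "\<zeta> = f w + of_real (Re \<zeta> - Re (f w))" by (simp add: complex_eq_iff)
    then show ?thesis using shift[OF w(1), of "Re \<zeta> - Re (f w)"] w(3) by simp
  qed
  obtain g where g: "g holomorphic_on (f ` rhp)" "\<And>w. w \<in> rhp \<Longrightarrow> g (f w) = w"
    using holomorphic_has_inverse[OF holo open_rhp inj] by metis
  define e where "e w = \<i> * of_real c + of_real l * Ln w" for w
  have e_mem: "e w \<in> f ` rhp" if "w \<in> rhp" for w
  proof (rule strip)
    have "\<bar>Arg w\<bar> < pi / 2" using that unfolding Arg_Re_pos by simp
    then have "\<bar>l * Arg w\<bar> \<le> l * (pi / 2)" using l0 by (simp add: abs_mult)
    then have "\<bar>l * Arg w\<bar> \<le> (B - A) / 2" using lpi by simp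
    moreover have "Im (e w) = c + l * Arg w" using that by (auto simp: e_def Arg_def)
    ultimately show "A \<le> Im (e w)" "Im (e w) \<le> B" by (auto simp: c_def abs_le_iff field_simps)
  qed
  have e_holo: "e holomorphic_on rhp"
    unfolding e_def by (intro holomorphic_intros) (auto simp: complex_nonpos_Reals_iff)
  define \<kappa> where "\<kappa> = g \<circ> e"
  have \<kappa>: "\<kappa> holomorphic_on rhp"
    unfolding \<kappa>_def using e_mem by (intro holomorphic_on_compose_gen[OF e_holo g(1)]) auto
  have \<kappa>_pos: "0 < Re (\<kappa> w)" if w: "w \<in> rhp" for w
    using e_mem[OF w] g(2) by (auto simp: \<kappa>_def)
  \<comment> \<open>The 4 bounds \<open>(x + 1)\<^sup>2\<close> for \<open>x \<le> 1\<close> in the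
    linear lower bound for \<kappa>.\<close>
  define q where "q = Re (\<kappa> 1) / 4"
  have q0: "0 < q" using \<kappa>_pos[of 1] by (simp add: q_def)
  \<comment> \<open>Strictly between: above \<open>mass\<close> for the logarithmic lower bound,
    below \<open>l\<close> so that this bound loses to the growth of the strip map.\<close>
  define b where "b = (mass + l) / 2"
  have b: "mass < b" "b < l" "0 < b" using ml mass_nonneg by (auto simp: b_def)
  obtain \<delta> C where \<delta>: "0 < \<delta>" "\<And>w. w \<in> rhp \<Longrightarrow> cmod w < \<delta> \<Longrightarrow> b * ln (Re w) - C \<le> Re (f w)"
    using Re_f_ge_log[OF b(1)] by blast
  \<comment> \<open>Below this level the final inequality
    \<open>(b * ln q - C) * l \<le> \<xi> * (l - b)\<close> fails, the 1 giving strictness; the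
    minimum with 0 ensures \<open>x \<le> 1\<close>.\<close>
  define X where "X = min 0 ((b * ln q - C - 1) * l / (l - b))"
  obtain w where w: "w \<in> rhp" "cmod w < \<delta>" "Im (f w) = c" "Re (f w) \<le> X"
    using attains[of c, OF _ _ \<delta>(1), of X] AB by (auto simp: c_def)
  define \<xi> where "\<xi> = Re (f w)"
  \<comment> \<open>The point of the positive axis that the strip map sends to \<open>f w\<close>,
    which is possible because \<open>f w\<close> lies on the midline; hence \<kappa> maps
    \<open>x\<close> to \<open>w\<close>.\<close>
  define x where "x = exp (\<xi> / l)"
  have x: "0 < x" "x \<le> 1" "ln x = \<xi> / l" 
    using w(4) l0 by (auto simp: x_def X_def \<xi>_def divide_nonpos_pos)
  have "e (of_real x) = f w"
    using x l0 w(3) by (simp add: e_def Ln_of_real complex_eq_iff \<xi>_def)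
  then have \<kappa>x: "\<kappa> (of_real x) = w" using g(2)[OF w(1)] by (simp add: \<kappa>_def)
  have "q * x \<le> Re (\<kappa> 1) * x / (x + 1)\<^sup>2"
  proof -
    have "(x + 1)\<^sup>2 \<le> 2\<^sup>2" using x by (intro power_mono) auto
    then have "Re (\<kappa> 1) * x / 4 \<le> Re (\<kappa> 1) * x / (x + 1)\<^sup>2"
      using x \<kappa>_pos[of 1] by (intro divide_left_mono mult_nonneg_nonneg) auto
    then show ?thesis by (simp add: q_def)
  qed
  also have "\<dots> \<le> Re (\<kappa> (of_real x))"
  proof -
    have "cmod (complex_of_real x + 1) = x + 1"
      using x by (metis add_nonneg_nonneg less_imp_le norm_of_real of_real_1 of_real_add abs_of_nonneg zero_le_one)
    then show ?thesis using Re_lower_bound_rhp[OF \<kappa> \<kappa>_pos, of "of_real x"] x by simp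
  qed
  finally have "q * x \<le> Re w" by (simp add: \<kappa>x)
  then have "ln (q * x) \<le> ln (Re w)" using q0 x w(1) by (subst ln_le_cancel_iff) auto
  then have "b * (ln q + \<xi> / l) \<le> b * ln (Re w)"
    using q0 x b by (simp add: ln_mult)
  then have "b * ln q + b * \<xi> / l - C \<le> \<xi>"
    using \<delta>(2)[OF w(1,2)] by (simp add: \<xi>_def algebra_simps)
  then have "(b * ln q - C) * l \<le> \<xi> * (l - b)" using l0 by (simp add: field_simps)
  moreover have "\<xi> * (l - b) \<le> (b * ln q - C - 1) * l"
  proof -
    have "\<xi> \<le> (b * ln q - C - 1) * l / (l - b)" using w(4) by (simp add: X_def \<xi>_def)
    then show ?thesis using b by (simp add: pos_le_divide_eq)
  qed
  ultimately show False using l0 by (simp add: algebra_simps)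
qed

end

subsection \<open>Boundary values in sectors\<close>

lemma sector_polar:
  assumes "0 < r" "k \<le> cos \<theta>"
  shows "rcis r \<theta> \<in> sector k"
  using assms by (simp add: sector_def mult.commute)

lemma sector_mono: "k \<le> k' \<Longrightarrow> sector k' \<subseteq> sector k"
  by (auto simp: sector_def intro: order_trans[OF mult_right_mono])

context half_plane_linearizer
begin

text \<open>A primitive of \<open>f\<close> stays bounded at the origin because \<open>Re f\<close> has only a logarithmic
  singularity there. As \<open>Im f\<close> increases along vertical lines, it is squeezed between two
  difference quotients of this primitive.\<close>

lemma Im_f_bounded_real: "\<exists>M. \<exists>\<delta>>0. \<forall>x. 0 < x \<and> x < \<delta> \<longrightarrow> \<bar>Im (f (of_real x))\<bar> \<le> M"
proof -
  obtain F where F': "\<And>w. w \<in> rhp \<Longrightarrow> (F has_field_derivative f w) (at w within rhp)"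
    using holomorphic_convex_primitive'[OF convex_rhp open_rhp holo] by blast
  have F: "(F has_field_derivative f w) (at w)" if "w \<in> rhp" for w
    using F'[OF that] that open_rhp by (simp add: at_within_open[of w rhp])
  define b where "b = mass + 1"
  have b: "mass < b" "0 \<le> b" using mass_nonneg by (auto simp: b_def)
  obtain \<delta> C where \<delta>: "0 < \<delta>" "\<And>w. w \<in> rhp \<Longrightarrow> cmod w < \<delta> \<Longrightarrow> b * ln (Re w) - C \<le> Re (f w)"
    using Re_f_ge_log[OF b(1)] by blast
  define x1 where "x1 = min 1 (\<delta> / 2)"
  have x1: "0 < x1" "x1 \<le> 1" "x1 < \<delta>" using \<delta>(1) by (auto simp: x1_def)
  \<comment> \<open>A primitive of \<open>b * ln x - C\<close>; unlike that function it stays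
    bounded as \<open>x\<close> tends to 0.\<close>
  define H where "H x = b * (x * ln x - x) - C * x" for x
  define K1 where "K1 = Re (F (Complex x1 0)) - H x1 + \<bar>C\<bar>"
  have upper: "Re (F (Complex x 0)) \<le> K1" if x: "0 < x" "x < x1" for x
  proof -
    have "Re (F (Complex x 0)) - H x \<le> Re (F (Complex x1 0)) - H x1"
    proof (rule DERIV_nonneg_imp_nondecreasing[OF less_imp_le[OF x(2)]])
      fix s assume "x \<le> s" "s \<le> x1"
      then have s: "Complex s 0 \<in> rhp" "0 < s" "s < \<delta>" using x x1 by auto
      have H: "(H has_real_derivative b * ln s - C) (at s)"
        unfolding H_def using s(2) by (auto intro!: derivative_eq_intros)
      have "((\<lambda>x. Re (F (Complex x 0)) - H x) has_real_derivative
          Re (f (Complex s 0)) - (b * ln s - C)) (at s)"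
        by (intro DERIV_diff Re_horizontal F s(1) H)
      moreover have "cmod (Complex s 0) < \<delta>" using s by (simp add: cmod_def)
      ultimately show "\<exists>d. ((\<lambda>x. Re (F (Complex x 0)) - H x) has_real_derivative d) (at s) \<and> 0 \<le> d"
        using \<delta>(2)[OF s(1)] by (intro exI conjI) auto
    qed
    moreover have "H x \<le> \<bar>C\<bar>"
    proof -
      have "ln x \<le> 0" using x x1 by simp
      then have "x * ln x \<le> 0" using x by (simp add: mult_nonneg_nonpos)
      then have "b * (x * ln x - x) \<le> 0" using x b by (intro mult_nonneg_nonpos) linarith+
      moreover have "- (C * x) \<le> \<bar>C\<bar>"
      proof -
        have "- (C * x) \<le> \<bar>C * x\<bar>" by simp
        also have "\<dots> \<le> \<bar>C\<bar> * 1" unfolding abs_mult using x x1 by (intro mult_left_mono) auto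
        finally show ?thesis by simp
      qed
      ultimately show ?thesis by (simp add: H_def)
    qed
    ultimately show ?thesis by (simp add: K1_def)
  qed
  \<comment> \<open>\<open>Re f\<close> increases to its value at \<open>Complex 1 y\<close>, so
    integrating back from there bounds \<open>Re F\<close> below uniformly in
    \<open>x\<close>.\<close>
  define K2 where "K2 y = Re (F (Complex 1 y)) - Re (f (Complex 1 y)) - \<bar>Re (f (Complex 1 y))\<bar>" for y
  have lower: "K2 y \<le> Re (F (Complex x y))" if x: "0 < x" "x < x1" for x y
  proof -
    define R where "R = Re (f (Complex 1 y))"
    have "x \<le> 1" using x x1 by simp
    then have "R * x - Re (F (Complex x y)) \<le> R * 1 - Re (F (Complex 1 y))"
    proof (rule DERIV_nonneg_imp_nondecreasing)
      fix s assume s: "x \<le> s" "s \<le> 1"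
      then have s': "Complex s y \<in> rhp" using x by auto
      have "((\<lambda>x. R * x - Re (F (Complex x y))) has_real_derivative R * 1 - Re (f (Complex s y))) (at s)"
        by (intro DERIV_diff Re_horizontal F s' DERIV_cmult DERIV_ident)
      moreover have "Re (f (Complex s y)) \<le> R"
        unfolding R_def using s x by (intro Re_f_mono_horizontal) auto
      ultimately show "\<exists>d. ((\<lambda>x. R * x - Re (F (Complex x y))) has_real_derivative d) (at s) \<and> 0 \<le> d"
        by (intro exI conjI) auto
    qed
    moreover have "- \<bar>R\<bar> \<le> R * x"
    proof -
      have "- (R * x) \<le> \<bar>R * x\<bar>" by simp
      also have "\<dots> \<le> \<bar>R\<bar> * 1" unfolding abs_mult using x x1 by (intro mult_left_mono) auto
      finally show ?thesis by simp
    qed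
    ultimately show ?thesis by (simp add: K2_def R_def)
  qed
  have "\<bar>Im (f (of_real x))\<bar> \<le> max (K1 - K2 1) (K1 - K2 (-1))" if x: "0 < x" "x < x1" for x
  proof -
    define u where "u = Im (f (Complex x 0))"
    have D: "((\<lambda>y. u * y + Re (F (Complex x y))) has_real_derivative u * 1 + - Im (f (Complex x s))) (at s)" for s
      by (intro DERIV_add Re_vertical F DERIV_cmult DERIV_ident) (use x in auto)
    \<comment> \<open>The vertical derivative of \<open>Re F\<close> is \<open>- Im f\<close>, and
      \<open>Im f \<ge> u\<close> above the axis; hence u is at most a difference of two bounded
      values of \<open>Re F\<close>. The step to -1 bounds \<open>- u\<close> in the same
      way.\<close>
    have "u * 1 + Re (F (Complex x 1)) \<le> u * 0 + Re (F (Complex x 0))"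
    proof (rule DERIV_nonpos_imp_nonincreasing[OF zero_le_one])
      fix s :: real assume "0 \<le> s" "s \<le> 1"
      then have "u \<le> Im (f (Complex x s))" unfolding u_def using x by (intro Im_f_mono_vertical) auto
      then have "u * 1 + - Im (f (Complex x s)) \<le> 0" by simp
      with D[of s] show "\<exists>d. ((\<lambda>y. u * y + Re (F (Complex x y))) has_real_derivative d) (at s) \<and> d \<le> 0"
        by blast
    qed
    moreover have "u * (-1) + Re (F (Complex x (-1))) \<le> u * 0 + Re (F (Complex x 0))"
    proof (rule DERIV_nonneg_imp_nondecreasing[of "-1" 0])
      fix s :: real assume "-1 \<le> s" "s \<le> 0"
      then have "Im (f (Complex x s)) \<le> u" unfolding u_def using x by (intro Im_f_mono_vertical) auto
      then have "0 \<le> u * 1 + - Im (f (Complex x s))" by simp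
      with D[of s] show "\<exists>d. ((\<lambda>y. u * y + Re (F (Complex x y))) has_real_derivative d) (at s) \<and> 0 \<le> d"
        by blast
    qed simp
    ultimately have "\<bar>u\<bar> \<le> max (K1 - K2 1) (K1 - K2 (-1))"
      using upper[OF x] lower[OF x, of 1] lower[OF x, of "-1"] by auto
    then show ?thesis by (simp add: u_def complex_of_real_def)
  qed
  then show ?thesis using x1(1) by blast
qed

text \<open>On the real axis \<open>Im f\<close> is bounded, so values of modulus at most M recur at
  0; by \<open>oscillation_le\<close> unrestricted values can exceed them by at most
  \<open>pi * mass\<close> in the limit.\<close>

lemma Im_f_bounded:
  assumes lim: "filterlim (\<lambda>w. Re (f w)) at_bot (at 0 within rhp)"
  shows "\<exists>M. \<forall>\<^sub>F w in at 0 within rhp. \<bar>Im (f w)\<bar> \<le> M"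
proof -
  obtain M \<delta> where M: "0 < \<delta>" "\<And>x. 0 < x \<Longrightarrow> x < \<delta> \<Longrightarrow> \<bar>Im (f (of_real x))\<bar> \<le> M"
    using Im_f_bounded_real by blast
  have freq: "\<exists>\<^sub>F w in at 0 within rhp. \<bar>Im (f w)\<bar> \<le> M"
    unfolding frequently_def eventually_at
  proof (rule notI, elim exE conjE)
    fix d :: real assume d: "0 < d" "\<forall>w\<in>rhp. w \<noteq> 0 \<and> dist w 0 < d \<longrightarrow> \<not> \<bar>Im (f w)\<bar> \<le> M"
    define x where "x = min d \<delta> / 2"
    have "0 < x" "x < d" "x < \<delta>" using d M(1) by (auto simp: x_def)
    then show False using d(2)[rule_format, of "of_real x"] M(2)[of x] by simp
  qed
  define B where "B = M + pi * mass + 1"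
  have "\<not> (\<exists>\<^sub>F w in at 0 within rhp. B \<le> Im (f w))"
  proof
    assume "\<exists>\<^sub>F w in at 0 within rhp. B \<le> Im (f w)"
    moreover have "\<exists>\<^sub>F w in at 0 within rhp. Im (f w) \<le> M"
      using freq by (rule frequently_elim1) auto
    ultimately have "B - M \<le> pi * mass" by (intro oscillation_le lim)
    then show False by (simp add: B_def)
  qed
  moreover have "\<not> (\<exists>\<^sub>F w in at 0 within rhp. Im (f w) \<le> - B)"
  proof
    assume "\<exists>\<^sub>F w in at 0 within rhp. Im (f w) \<le> - B"
    moreover have "\<exists>\<^sub>F w in at 0 within rhp. - M \<le> Im (f w)"
      using freq by (rule frequently_elim1) auto
    ultimately have "- M - (- B) \<le> pi * mass" by (intro oscillation_le lim)
    then show False by (simp add: B_def)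
  qed
  ultimately have "\<forall>\<^sub>F w in at 0 within rhp. \<bar>Im (f w)\<bar> \<le> B"
    unfolding not_frequently by eventually_elim auto
  then show ?thesis by blast
qed

text \<open>The real upper and lower limits are built as \<open>Inf U\<close> and
  \<open>Sup V\<close>; boundedness makes them finite, and \<open>oscillation_le\<close> bounds
  their distance.\<close>

lemma Im_f_Limsup_Liminf:
  assumes lim: "filterlim (\<lambda>w. Re (f w)) at_bot (at 0 within rhp)"
  obtains hi lo where "hi - lo \<le> pi * mass"
    "\<And>\<epsilon>. 0 < \<epsilon> \<Longrightarrow> \<forall>\<^sub>F w in at 0 within rhp. lo - \<epsilon> \<le> Im (f w) \<and> Im (f w) \<le> hi + \<epsilon>"
proof -
  let ?F = "at 0 within rhp :: complex filter"
  define U where "U = {B. \<forall>\<^sub>F w in ?F. Im (f w) \<le> B}"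
  define V where "V = {A. \<forall>\<^sub>F w in ?F. A \<le> Im (f w)}"
  obtain M where M: "\<forall>\<^sub>F w in ?F. \<bar>Im (f w)\<bar> \<le> M" using Im_f_bounded[OF lim] by blast
  have MU: "M \<in> U" unfolding U_def using M by (auto elim: eventually_mono)
  have MV: "- M \<in> V" unfolding V_def using M by (auto elim: eventually_mono)
  have UV: "A \<le> B" if "A \<in> V" "B \<in> U" for A B
  proof -
    have "\<forall>\<^sub>F w in ?F. A \<le> Im (f w)" "\<forall>\<^sub>F w in ?F. Im (f w) \<le> B" using that by (auto simp: U_def V_def)
    then have "\<forall>\<^sub>F w in ?F. A \<le> B" by eventually_elim simp
    then show ?thesis using at_0_rhp_neq_bot by (simp add: eventually_const_iff)
  qed
  have bU: "bdd_below U" using UV MV by (auto simp: bdd_below_def)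
  have bV: "bdd_above V" using UV MU by (auto simp: bdd_above_def)
  show ?thesis
  proof (rule that[of "Inf U" "Sup V"])
    show "Inf U - Sup V \<le> pi * mass"
    proof (rule ccontr)
      assume c: "\<not> ?thesis"
      \<comment> \<open>The two relaxed levels lose 2 \<eta> in total, half of the assumed excess 4
        \<eta>.\<close>
      define \<eta> where "\<eta> = (Inf U - Sup V - pi * mass) / 4"
      have "0 < \<eta>" using c by (simp add: \<eta>_def)
      then have "Inf U - \<eta> \<notin> U" "Sup V + \<eta> \<notin> V"
        using cInf_lower[OF _ bU, of "Inf U - \<eta>"] cSup_upper[OF _ bV, of "Sup V + \<eta>"] by auto
      then have "\<exists>\<^sub>F w in ?F. Inf U - \<eta> \<le> Im (f w)" "\<exists>\<^sub>F w in ?F. Im (f w) \<le> Sup V + \<eta>"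
        unfolding U_def V_def by (auto simp: not_eventually not_le elim: frequently_elim1)
      then have "(Inf U - \<eta>) - (Sup V + \<eta>) \<le> pi * mass" by (intro oscillation_le lim)
      moreover have "4 * \<eta> = Inf U - Sup V - pi * mass" by (simp add: \<eta>_def)
      ultimately show False using \<open>0 < \<eta>\<close> by linarith
    qed
    show "\<forall>\<^sub>F w in ?F. Sup V - \<epsilon> \<le> Im (f w) \<and> Im (f w) \<le> Inf U + \<epsilon>" if "0 < \<epsilon>" for \<epsilon>
    proof -
      have "U \<noteq> {}" "V \<noteq> {}" using MU MV by auto
      obtain B where B: "B \<in> U" "B < Inf U + \<epsilon>"
        using cInf_lessD[OF \<open>U \<noteq> {}\<close>, of "Inf U + \<epsilon>"] \<open>0 < \<epsilon>\<close> by auto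
      obtain A where A: "A \<in> V" "Sup V - \<epsilon> < A"
        using less_cSupD[OF \<open>V \<noteq> {}\<close>, of "Sup V - \<epsilon>"] \<open>0 < \<epsilon>\<close> by auto
      have "\<forall>\<^sub>F w in ?F. A \<le> Im (f w)" "\<forall>\<^sub>F w in ?F. Im (f w) \<le> B" using A B by (auto simp: U_def V_def)
      then show ?thesis by eventually_elim (use A(2) B(2) in auto)
    qed
  qed
qed

text \<open>On an arc of a fixed small radius \<open>Im f0\<close> is almost constant, while
  \<open>Im f = Im f0 + mass * Arg\<close>. At angles near \<pi>/2 and -\<pi>/2 the values of
  \<open>Im f\<close> must stay within an interval of length at most \<open>pi * mass\<close>, which
  pins \<open>Im f0\<close> from above and below. The limit \<open>hi - mass * (pi / 2)\<close> is
  the same for all sectors.\<close>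

lemma Im_f_sector_limit:
  assumes m: "0 < mass"
  obtains a where "\<And>k. 0 < k \<Longrightarrow> ((\<lambda>w. Im (f w) - mass * Arg w) \<longlongrightarrow> a) (at 0 within sector k)"
proof -
  obtain hi lo where hl: "hi - lo \<le> pi * mass"
    and ev: "\<And>\<epsilon>. 0 < \<epsilon> \<Longrightarrow> \<forall>\<^sub>F w in at 0 within rhp. lo - \<epsilon> \<le> Im (f w) \<and> Im (f w) \<le> hi + \<epsilon>"
    using Im_f_Limsup_Liminf[OF Re_f_to_neg_infinity[OF m]] by blast
  have Im_f0: "Im (f0 w) = Im (f w) - mass * Arg w" if "w \<noteq> 0" for w
    using that by (simp add: f0_def Arg_def)
  show ?thesis
  proof (rule that[of "hi - mass * (pi / 2)"])
    fix k :: real assume k: "0 < k"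
    show "((\<lambda>w. Im (f w) - mass * Arg w) \<longlongrightarrow> hi - mass * (pi / 2)) (at 0 within sector k)"
      unfolding Lim_within
    proof (intro allI impI)
      fix \<epsilon>' :: real assume "0 < \<epsilon>'"
      define \<epsilon> where "\<epsilon> = \<epsilon>' / 4"
      have \<epsilon>: "0 < \<epsilon>" using \<open>0 < \<epsilon>'\<close> by (simp add: \<epsilon>_def)
      \<comment> \<open>Replacing \<pi>/2 by this angle costs at most \<epsilon> after
        multiplication by the mass; strict inequality keeps both rays inside a sector.\<close>
      define \<theta> where "\<theta> = max 0 (pi / 2 - \<epsilon> / mass)"
      have \<theta>: "0 \<le> \<theta>" "\<theta> < pi / 2" "mass * (pi / 2) - \<epsilon> \<le> mass * \<theta>"
      proof -
        show "0 \<le> \<theta>" by (simp add: \<theta>_def)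
        have "0 < pi / 2" "pi / 2 - \<epsilon> / mass < pi / 2" using \<epsilon> m by simp_all
        then show "\<theta> < pi / 2" by (simp only: \<theta>_def max_less_iff_conj)
        have "mass * (pi / 2 - \<epsilon> / mass) \<le> mass * \<theta>" using m by (simp add: \<theta>_def)
        then show "mass * (pi / 2) - \<epsilon> \<le> mass * \<theta>" using m by (simp add: algebra_simps)
      qed
      have cp: "0 < cos \<theta>" using \<theta> by (intro cos_gt_zero_pi) auto
      \<comment> \<open>A sector wide enough for the given points and for the two rays at angles
        \<theta> and -\<theta>.\<close>
      define k' where "k' = min k (cos \<theta>)"
      have k': "0 < k'" using cp k by (simp add: k'_def)
      obtain d1 where d1: "0 < d1" "\<And>w w'. w \<in> sector k' \<Longrightarrow> w' \<in> sector k' \<Longrightarrow> cmod w < d1 \<Longrightarrow>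
          cmod w' = cmod w \<Longrightarrow> cmod (f0 w' - f0 w) \<le> \<epsilon>"
        using f0_slow[OF k' zero_less_one \<epsilon>] by auto
      obtain d2 where d2: "0 < d2"
        "\<And>w. w \<in> rhp \<Longrightarrow> cmod w < d2 \<Longrightarrow> lo - \<epsilon> \<le> Im (f w) \<and> Im (f w) \<le> hi + \<epsilon>"
      proof -
        obtain d where d: "0 < d" "\<forall>w\<in>rhp. w \<noteq> 0 \<and> dist w 0 < d \<longrightarrow> lo - \<epsilon> \<le> Im (f w) \<and> Im (f w) \<le> hi + \<epsilon>"
          using ev[OF \<epsilon>] unfolding eventually_at by blast
        show ?thesis
        proof (rule that[OF d(1)])
          fix w assume "w \<in> rhp" "cmod w < d"
          moreover from this have "w \<noteq> 0" by auto
          ultimately show "lo - \<epsilon> \<le> Im (f w) \<and> Im (f w) \<le> hi + \<epsilon>" using d(2) by simp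
        qed
      qed
      have "dist (Im (f w) - mass * Arg w) (hi - mass * (pi / 2)) < \<epsilon>'"
        if w: "w \<in> sector k" "cmod w < min d1 d2" for w
      proof -
        have w0: "w \<noteq> 0" "0 < cmod w" using w by (auto simp: sector_def)
        have wk: "w \<in> sector k'" using w sector_mono[of k' k] by (auto simp: k'_def)
        have rot: "\<bar>Im (f0 (rcis (cmod w) \<alpha>)) - Im (f0 w)\<bar> \<le> \<epsilon> \<and>
            lo - \<epsilon> \<le> Im (f0 (rcis (cmod w) \<alpha>)) + mass * \<alpha> \<and> Im (f0 (rcis (cmod w) \<alpha>)) + mass * \<alpha> \<le> hi + \<epsilon>"
          if \<alpha>: "\<bar>\<alpha>\<bar> = \<theta>" for \<alpha>
        proof -
          let ?v = "rcis (cmod w) \<alpha>"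
          have "cos \<alpha> = cos \<theta>" using \<alpha> by (metis cos_abs_real)
          then have v: "?v \<in> sector k'" using w0 by (intro sector_polar) (auto simp: k'_def)
          then have v': "?v \<in> rhp" using sector_subset_rhp[OF k'] by blast
          have nv: "cmod ?v = cmod w" by simp
          have "cmod (f0 ?v - f0 w) \<le> \<epsilon>" using d1(2)[OF wk v _ nv] w by simp
          then have "\<bar>Im (f0 ?v) - Im (f0 w)\<bar> \<le> \<epsilon>"
            using abs_Im_le_cmod[of "f0 ?v - f0 w"] by simp
          moreover have "Arg ?v = \<alpha>"
            using \<alpha> \<theta> w0 by (intro Arg_unique'[of "cmod w"]) (auto simp: rcis_def cis_conv_exp)
          then have "Im (f0 ?v) + mass * \<alpha> = Im (f ?v)"
            using v' by (subst Im_f0) auto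
          moreover have "lo - \<epsilon> \<le> Im (f ?v) \<and> Im (f ?v) \<le> hi + \<epsilon>"
            using d2(2)[OF v'] w nv by simp
          ultimately show ?thesis by simp
        qed
        have "\<bar>\<theta>\<bar> = \<theta>" "\<bar>-\<theta>\<bar> = \<theta>" using \<theta> by auto
        note r = rot[OF this(1)] rot[OF this(2)]
        have "Im (f0 w) \<le> hi - mass * (pi / 2) + 3 * \<epsilon>"
          using r(1) \<theta>(3) by linarith
        moreover have "hi - mass * (pi / 2) - 3 * \<epsilon> \<le> Im (f0 w)"
        proof -
          have "lo - \<epsilon> \<le> Im (f0 w) + \<epsilon> - mass * \<theta>" using r(2) by simp linarith
          moreover have "pi * mass = mass * (pi / 2) + mass * (pi / 2)" by simp
          ultimately show ?thesis using \<theta>(3) hl by linarith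
        qed
        ultimately show ?thesis using \<epsilon> Im_f0[OF w0(1)] by (simp add: dist_real_def \<epsilon>_def abs_less_iff)
      qed
      moreover have "0 < min d1 d2" using d1 d2 by simp
      ultimately show "\<exists>d>0. \<forall>w\<in>sector k. 0 < dist w 0 \<and> dist w 0 < d \<longrightarrow>
          dist (Im (f w) - mass * Arg w) (hi - mass * (pi / 2)) < \<epsilon>'"
        by (metis dist_0_norm dist_commute)
    qed
  qed
qed

end

subsection \<open>The flow in sectors\<close>

text \<open>Multiplication by a positive real preserves a sector, and a small relative error only
  widens it. This keeps the images under the flow in a sector without a separate estimate.\<close>

lemma filterlim_sector_perturb:
  assumes w: "filterlim w (at 0 within sector k) F" and k: "0 < k" and \<alpha>: "0 < \<alpha>"
    and ratio: "((\<lambda>x. v x / w x) \<longlongrightarrow> of_real \<alpha>) F"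
  shows "filterlim v (at 0 within sector (k / 2)) F"
  unfolding filterlim_at
proof
  have w0: "(w \<longlongrightarrow> 0) F" and wk: "\<forall>\<^sub>F x in F. w x \<in> sector k \<and> w x \<noteq> 0"
    using w by (auto simp: filterlim_at)
  have "((\<lambda>x. v x / w x * w x) \<longlongrightarrow> of_real \<alpha> * 0) F" by (intro tendsto_mult ratio w0)
  moreover have "\<forall>\<^sub>F x in F. v x / w x * w x = v x"
    using wk by eventually_elim auto
  ultimately show "(v \<longlongrightarrow> 0) F" by (simp add: tendsto_cong)
  \<comment> \<open>Solves \<open>(k / 2) * (\<alpha> + \<eta>) = \<alpha> * k - \<eta>\<close>: the
    bounds for modulus and real part then meet at the constant \<open>k / 2\<close>.\<close>
  define \<eta> where "\<eta> = \<alpha> * k / (2 + k)"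
  have \<eta>: "0 < \<eta>" "\<eta> * (2 + k) = \<alpha> * k" using k \<alpha> by (auto simp: \<eta>_def)
  have "\<forall>\<^sub>F x in F. dist (v x / w x) (of_real \<alpha>) < \<eta>"
    using ratio \<eta>(1) by (rule tendstoD)
  then show "\<forall>\<^sub>F x in F. v x \<in> sector (k / 2) \<and> v x \<noteq> 0"
    using wk
  proof eventually_elim
    case (elim x)
    define W where "W = cmod (w x)"
    have W: "0 < W" "k * W \<le> Re (w x)" using elim(2) by (auto simp: W_def sector_def)
    have "v x - of_real \<alpha> * w x = (v x / w x - of_real \<alpha>) * w x" using elim(2) by (simp add: field_simps)
    then have "cmod (v x - of_real \<alpha> * w x) = cmod (v x / w x - of_real \<alpha>) * W"
      by (simp add: norm_mult W_def)
    also have "\<dots> < \<eta> * W" using elim(1) W(1) by (simp add: dist_norm)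
    finally have d: "cmod (v x - of_real \<alpha> * w x) < \<eta> * W" .
    have "\<alpha> * (k * W) \<le> \<alpha> * Re (w x)" using W \<alpha> by (intro mult_left_mono) auto
    then have "\<alpha> * (k * W) - \<eta> * W < Re (v x)"
      using d abs_Re_le_cmod[of "v x - of_real \<alpha> * w x"] by simp
    moreover have "cmod (v x) \<le> \<eta> * W + \<alpha> * W"
      using norm_triangle_ineq[of "v x - of_real \<alpha> * w x" "of_real \<alpha> * w x"] d \<alpha>
      by (simp add: norm_mult W_def)
    then have "(k / 2) * cmod (v x) \<le> (k / 2) * (\<eta> * W + \<alpha> * W)" using k by (intro mult_left_mono) auto
    moreover have "(k / 2) * (\<eta> * W + \<alpha> * W) = \<alpha> * (k * W) - \<eta> * W"
    proof -
      have "(k / 2) * (\<eta> * W + \<alpha> * W) - (\<alpha> * (k * W) - \<eta> * W) = (\<eta> * (2 + k) - \<alpha> * k) * (W / 2)"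
        by (simp add: field_simps)
      then show ?thesis using \<eta>(2) by simp
    qed
    ultimately have 1: "(k / 2) * cmod (v x) < Re (v x)" by linarith
    moreover have "0 \<le> (k / 2) * cmod (v x)" using k by simp
    ultimately have "0 < Re (v x)" by linarith
    then have "v x \<noteq> 0" by auto
    then show ?case using 1 by (simp add: sector_def)
  qed
qed

context half_plane_linearizer
begin

text \<open>The semigroup rebuilt from its linearizer, total by virtue of \<open>inv_into\<close>;
  \<open>chart_\<phi>\<close> identifies it with the given semigroup.\<close>

definition flow :: "real \<Rightarrow> complex \<Rightarrow> complex" where
  "flow t w = inv_into rhp f (f w + of_real t)"

lemma flow_rhp: "w \<in> rhp \<Longrightarrow> 0 \<le> t \<Longrightarrow> flow t w \<in> rhp"
  unfolding flow_def by (intro inv_into_into shift)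

lemma f_flow: "w \<in> rhp \<Longrightarrow> 0 \<le> t \<Longrightarrow> f (flow t w) = f w + of_real t"
  unfolding flow_def by (intro f_inv_into_f shift)

lemma flow_eqI: "v \<in> rhp \<Longrightarrow> f v = f w + of_real t \<Longrightarrow> flow t w = v"
  unfolding flow_def using inj by (metis inv_into_f_f)

lemma f0_diff_tendsto_0:
  assumes w: "filterlim w (at 0 within sector k) F" and v: "filterlim v (at 0 within sector k) F"
    and k: "0 < k" and \<alpha>: "0 < \<alpha>" and ratio: "((\<lambda>x. v x / w x) \<longlongrightarrow> of_real \<alpha>) F"
  shows "((\<lambda>x. f0 (v x) - f0 (w x)) \<longlongrightarrow> 0) F"
proof (rule tendstoI)
  fix e :: real assume e: "0 < e"
  \<comment> \<open>Eventually the ratio of moduli lies between \<open>\<alpha> / 2\<close> and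
    \<open>2 * \<alpha>\<close>, so this M compares them in both directions.\<close>
  define M where "M = max (2 * \<alpha>) (2 / \<alpha>)"
  have M: "0 < M" "2 * \<alpha> \<le> M" "2 / \<alpha> \<le> M" using \<alpha> by (auto simp: M_def)
  have e2: "0 < e / 2" using e by simp
  obtain \<delta> where \<delta>: "0 < \<delta>" "\<And>w w'. w \<in> sector k \<Longrightarrow> w' \<in> sector k \<Longrightarrow> cmod w < \<delta> \<and> cmod w' < \<delta> \<and>
       cmod w' \<le> M * cmod w \<and> cmod w \<le> M * cmod w' \<Longrightarrow> cmod (f0 w' - f0 w) \<le> e / 2"
    using f0_slow[OF k M(1) e2] by blast
  have "\<forall>\<^sub>F x in F. dist (w x) 0 < \<delta>" "\<forall>\<^sub>F x in F. dist (v x) 0 < \<delta>"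
    using w v tendstoD[OF _ \<delta>(1), of w 0 F] tendstoD[OF _ \<delta>(1), of v 0 F]
    by (auto simp: filterlim_at)
  moreover have "\<forall>\<^sub>F x in F. w x \<in> sector k \<and> w x \<noteq> 0" "\<forall>\<^sub>F x in F. v x \<in> sector k \<and> v x \<noteq> 0"
    using w v by (auto simp: filterlim_at)
  moreover have "((\<lambda>x. cmod (v x / w x)) \<longlongrightarrow> cmod (of_real \<alpha>)) F" by (intro tendsto_norm ratio)
  then have "\<forall>\<^sub>F x in F. cmod (v x / w x) < 2 * \<alpha>" "\<forall>\<^sub>F x in F. \<alpha> / 2 < cmod (v x / w x)"
    using \<alpha> order_tendstoD(1)[of _ \<alpha> F "\<alpha> / 2"] order_tendstoD(2)[of _ \<alpha> F "2 * \<alpha>"]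
    by simp_all
  ultimately show "\<forall>\<^sub>F x in F. dist (f0 (v x) - f0 (w x)) 0 < e"
  proof eventually_elim
    case (elim x)
    have W: "0 < cmod (w x)" "0 < cmod (v x)" using elim by auto
    have "cmod (v x) \<le> 2 * \<alpha> * cmod (w x)" using elim(5) W by (simp add: norm_divide field_simps)
    also have "\<dots> \<le> M * cmod (w x)" using M W by (intro mult_right_mono) auto
    finally have 1: "cmod (v x) \<le> M * cmod (w x)" .
    have "cmod (w x) \<le> 2 / \<alpha> * cmod (v x)" using elim(6) W \<alpha> by (simp add: norm_divide field_simps)
    also have "\<dots> \<le> M * cmod (v x)" using M W by (intro mult_right_mono) auto
    finally have "cmod (f0 (v x) - f0 (w x)) \<le> e / 2" using 1 elim by (intro \<delta>(2)) auto
    then show ?case using e by simp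
  qed
qed

text \<open>The increment t of \<open>f\<close> is the increment of \<open>f0\<close>, which
  vanishes in the limit, plus \<open>mass * Ln\<close> of the ratio. An arbitrary filter is allowed
  because the multiplier is first known along the radius only.\<close>

lemma mass_from_multiplier:
  assumes w: "filterlim w (at 0 within sector k) F" and F: "F \<noteq> bot"
    and k: "0 < k" and \<alpha>: "0 < \<alpha>" and t: "0 \<le> t"
    and ratio: "((\<lambda>x. flow t (w x) / w x) \<longlongrightarrow> of_real \<alpha>) F"
  shows "t = mass * ln \<alpha>"
proof -
  let ?v = "\<lambda>x. flow t (w x)"
  have w2: "filterlim w (at 0 within sector (k / 2)) F"
    using w sector_mono[of "k / 2" k] k by (auto simp: filterlim_at elim: eventually_mono)
  have v2: "filterlim ?v (at 0 within sector (k / 2)) F"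
    by (rule filterlim_sector_perturb[OF w k \<alpha> ratio])
  have k2: "0 < k / 2" using k by simp
  have "((\<lambda>x. f0 (?v x) - f0 (w x)) \<longlongrightarrow> 0) F"
    by (rule f0_diff_tendsto_0[OF w2 v2 k2 \<alpha> ratio])
  moreover have "((\<lambda>x. Ln (?v x / w x)) \<longlongrightarrow> Ln (of_real \<alpha>)) F"
    using \<alpha> by (intro tendsto_Ln ratio) (auto simp: complex_nonpos_Reals_iff)
  ultimately have "((\<lambda>x. (f0 (?v x) - f0 (w x)) + of_real mass * Ln (?v x / w x)) \<longlongrightarrow>
      0 + of_real mass * Ln (of_real \<alpha>)) F"
    by (intro tendsto_add tendsto_mult tendsto_const)
  moreover have "\<forall>\<^sub>F x in F. (f0 (?v x) - f0 (w x)) + of_real mass * Ln (?v x / w x) = of_real t"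
  proof -
    have "((\<lambda>x. Re (?v x / w x)) \<longlongrightarrow> Re (of_real \<alpha>)) F" by (intro tendsto_Re ratio)
    then have "\<forall>\<^sub>F x in F. 0 < Re (?v x / w x)" using \<alpha> by (auto elim!: order_tendstoD)
    moreover have "\<forall>\<^sub>F x in F. w x \<in> sector k" using w by (simp add: filterlim_at eventually_conj_iff)
    ultimately show ?thesis
    proof eventually_elim
      case (elim x)
      have wr: "w x \<in> rhp" using elim sector_subset_rhp[OF k] by auto
      have "Ln (w x * (?v x / w x)) = Ln (w x) + Ln (?v x / w x)"
      \<comment> \<open>Both factors have positive real part, so their arguments add without leaving
        the principal range.\<close>
      proof (rule Ln_times_simple)
        have "\<bar>Im (Ln (w x))\<bar> < pi / 2" "\<bar>Im (Ln (?v x / w x))\<bar> < pi / 2"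
          using wr elim by (intro Re_Ln_pos_lt_imp; simp)+
        then show "- pi < Im (Ln (w x)) + Im (Ln (?v x / w x))" "Im (Ln (w x)) + Im (Ln (?v x / w x)) \<le> pi"
          by linarith+
      qed (use wr elim in auto)
      moreover have "w x \<noteq> 0" using wr by auto
      ultimately have "Ln (?v x) = Ln (w x) + Ln (?v x / w x)" by simp
      then show ?case using f_flow[OF wr t] by (simp add: f0_def algebra_simps)
    qed
  qed
  ultimately have "((\<lambda>x. of_real t) \<longlongrightarrow> 0 + of_real mass * Ln (of_real \<alpha>)) F"
    by (rule Lim_transform_eventually)
  then have "complex_of_real t = 0 + of_real mass * Ln (of_real \<alpha>)"
    using F by (simp add: tendsto_const_iff)
  then have "complex_of_real t = of_real (mass * ln \<alpha>)" using \<alpha> by (simp add: Ln_of_real)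
  then show ?thesis by (simp only: of_real_eq_iff)
qed

text \<open>In the rescaled variable \<open>s = flow t w / (\<alpha> w)\<close> the equation \<open>f (flow t w) = f w + t\<close>
  converges, as \<open>w\<close> tends to \<open>0\<close>, to \<open>mass * Ln s = 0\<close>; Hurwitz's theorem provides a root near
  \<open>s = 1\<close>, which must be the flow by injectivity of \<open>f\<close>.\<close>

lemma flow_multiplier:
  assumes m: "0 < mass" and t: "0 \<le> t" and k: "0 < k"
  shows "((\<lambda>w. flow t w / w) \<longlongrightarrow> of_real (exp (t / mass))) (at 0 within sector k)"
proof (rule ccontr)
  assume contra: "\<not> ?thesis"
  define \<alpha> where "\<alpha> = exp (t / mass)"
  have \<alpha>: "1 \<le> \<alpha>" "0 < \<alpha>" "mass * ln \<alpha> = t" using m t by (auto simp: \<alpha>_def)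
  obtain \<epsilon> where \<epsilon>: "0 < \<epsilon>"
    "\<And>d. 0 < d \<Longrightarrow> \<exists>w\<in>sector k. cmod w < d \<and> \<epsilon> \<le> cmod (flow t w / w - of_real \<alpha>)"
  proof -
    obtain e where e: "0 < e" "\<And>d. 0 < d \<Longrightarrow>
        \<exists>w\<in>sector k. (0 < dist w 0 \<and> dist w 0 < d) \<and> \<not> dist (flow t w / w) (of_real \<alpha>) < e"
      using contra unfolding Lim_within \<alpha>_def[symmetric] by blast
    show ?thesis
    proof (rule that[OF e(1)])
      fix d :: real assume "0 < d"
      then show "\<exists>w\<in>sector k. cmod w < d \<and> e \<le> cmod (flow t w / w - of_real \<alpha>)"
        using e(2)[of d] by (auto simp: dist_norm not_less)
    qed
  qed
  have "\<exists>w. \<forall>n. w n \<in> sector k \<and> cmod (w n) < inverse (real (Suc n)) \<and> \<epsilon> \<le> cmod (flow t (w n) / w n - of_real \<alpha>)"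
    using \<epsilon>(2) by (intro choice allI) (meson inverse_positive_iff_positive of_nat_0_less_iff zero_less_Suc)
  then obtain w where w: "\<And>n. w n \<in> sector k" "\<And>n. cmod (w n) < inverse (real (Suc n))"
    "\<And>n. \<epsilon> \<le> cmod (flow t (w n) / w n - of_real \<alpha>)" by blast
  \<comment> \<open>The three bounds serve in turn to keep \<open>w n * s\<close> in a sector, to
    keep \<open>s\<close> in the half plane with modulus comparable to 1, and to bring a root closer
    than \<epsilon> to the expected multiplier.\<close>
  define \<rho> where "\<rho> = Min {k / 2, 1 / 2, \<epsilon> / (2 * \<alpha>)}"
  have \<rho>: "0 < \<rho>" "\<rho> \<le> k / 2" "\<rho> \<le> 1 / 2" "\<rho> \<le> \<epsilon> / (2 * \<alpha>)"
    using k \<epsilon>(1) \<alpha> by (auto simp: \<rho>_def)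
  define S where "S = ball (1 :: complex) \<rho>"
  have s: "1 / 2 \<le> cmod s" "cmod s \<le> 2" "0 < Re s" "cmod (s - 1) < \<rho>" if "s \<in> S" for s
  proof -
    show *: "cmod (s - 1) < \<rho>" using that by (simp add: S_def dist_norm norm_minus_commute)
    show "1 / 2 \<le> cmod s" using * \<rho>(3) norm_triangle_ineq2[of 1 "1 - s"] by (simp add: norm_minus_commute)
    show "cmod s \<le> 2" using * \<rho>(3) norm_triangle_ineq[of "s - 1" 1] by simp
    show "0 < Re s" using * \<rho>(3) abs_Re_le_cmod[of "s - 1"] by simp
  qed
  define k' where "k' = k / 4"
  have k': "0 < k'" using k by (simp add: k'_def)
  define v where "v n s = of_real \<alpha> * w n * s" for n s
  have w0: "0 < cmod (w n)" for n using w(1)[of n] by (auto simp: sector_def)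
  have ws: "w n * s \<in> sector k'" if "s \<in> S" for n s
  proof -
    have "cmod (w n * s - w n) \<le> k / 2 * cmod (w n)"
    proof -
      have "w n * s - w n = (s - 1) * w n" by (simp add: algebra_simps)
      then have "cmod (w n * s - w n) = cmod (s - 1) * cmod (w n)" by (simp only: norm_mult)
      moreover have "cmod (s - 1) \<le> k / 2" using s(4)[OF that] \<rho>(2) by linarith
      ultimately show ?thesis by (simp only: mult_right_mono norm_ge_zero)
    qed
    then have "Re (w n) - k / 2 * cmod (w n) \<le> Re (w n * s)"
      using abs_Re_le_cmod[of "w n * s - w n"] by (simp only: minus_complex.sel abs_le_iff) linarith
    moreover have "k * cmod (w n) \<le> Re (w n)" using w(1)[of n] by (simp add: sector_def)
    moreover have "k' * cmod (w n * s) \<le> k / 2 * cmod (w n)"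
    proof -
      have "cmod (w n) * cmod s \<le> cmod (w n) * 2" using s(2)[OF that] by (intro mult_left_mono) auto
      then have "k' * (cmod (w n) * cmod s) \<le> k' * (cmod (w n) * 2)"
        by (rule mult_left_mono[OF _ less_imp_le[OF k']])
      then show ?thesis by (simp add: norm_mult k'_def)
    qed
    ultimately have "k' * cmod (w n * s) \<le> Re (w n * s)" by linarith
    moreover have "w n * s \<noteq> 0" using w0[of n] s(1)[OF that] by auto
    ultimately show ?thesis by (simp add: sector_def)
  qed
  have vs: "v n s \<in> sector k'" if "s \<in> S" for n s
  proof -
    have "v n s = of_real \<alpha> * (w n * s)" by (simp add: v_def)
    moreover have "of_real \<alpha> * z \<in> sector k'" if "z \<in> sector k'" for z
      using that \<alpha>(2) by (auto simp: sector_def norm_mult mult.left_commute)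
    ultimately show ?thesis using ws[OF that] by simp
  qed
  have wk': "w n \<in> sector k'" for n using w(1)[of n] sector_mono[of k' k] k by (auto simp: k'_def)
  note sec = sector_subset_rhp[OF k']
  define G where "G n s = f (v n s) - f (w n) - of_real t" for n s
  \<comment> \<open>Since \<open>mass * ln \<alpha> = t\<close>, the constants cancel, and
    \<open>f0_slow\<close> gives convergence uniformly in \<open>s\<close>.\<close>
  have G_eq: "G n s - of_real mass * Ln s = f0 (v n s) - f0 (w n)" if "s \<in> S" for n s
  proof -
    have wr: "0 < Re (w n)" using wk' sec by auto
    have "Ln (of_real \<alpha> * (w n * s)) = of_real (ln \<alpha>) + Ln (w n * s)"
    proof -
      have "w n * s \<noteq> 0" using w0[of n] s(1)[OF that] by auto
      then show ?thesis using \<alpha>(2) Ln_times_of_real[of \<alpha> "w n * s"] by (simp add: Ln_of_real)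
    qed
    also have "Ln (w n * s) = Ln (w n) + Ln s"
    proof (rule Ln_times_simple)
      have "\<bar>Im (Ln (w n))\<bar> < pi / 2" "\<bar>Im (Ln s)\<bar> < pi / 2"
        using wr s(3)[OF that] by (intro Re_Ln_pos_lt_imp; simp)+
      then show "- pi < Im (Ln (w n)) + Im (Ln s)" "Im (Ln (w n)) + Im (Ln s) \<le> pi"
        by linarith+
    qed (use w0[of n] s(1)[OF that] in auto)
    finally have "of_real mass * Ln (v n s) = of_real (mass * ln \<alpha>) + of_real mass * (Ln (w n) + Ln s)"
      by (simp add: v_def algebra_simps)
    then show ?thesis using \<alpha>(3) by (simp add: G_def f0_def algebra_simps)
  qed
  have "\<exists>n. \<exists>s\<in>S. G n s = 0"
  proof (rule ccontr)
    assume nz: "\<not> ?thesis"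
    \<comment> \<open>If no \<open>G n\<close> had a zero in \<open>S\<close>, neither would their
      nonconstant limit; but the limit vanishes at 1.\<close>
    have "of_real mass * Ln 1 \<noteq> (0 :: complex)"
    proof (rule Hurwitz_no_zeros[where S = S and \<F> = G and g = "\<lambda>s. of_real mass * Ln s" and ?z0.0 = 1])
      show "open S" "connected S" "1 \<in> S" using \<rho>(1) by (auto simp: S_def)
      show "G n holomorphic_on S" for n
      proof -
        have "(\<lambda>s. v n s) holomorphic_on S" unfolding v_def by (intro holomorphic_intros)
        moreover have "(\<lambda>s. v n s) ` S \<subseteq> rhp" using vs sec by blast
        ultimately have "(\<lambda>s. f (v n s)) holomorphic_on S"
          using holomorphic_on_compose_gen[OF _ holo] by (simp add: o_def)
        then show ?thesis unfolding G_def by (intro holomorphic_intros)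
      qed
      show "(\<lambda>s. of_real mass * Ln s) holomorphic_on S"
        using s(3) by (intro holomorphic_intros) (fastforce simp: complex_nonpos_Reals_iff)
      show "\<not> (\<lambda>s. of_real mass * Ln s) constant_on S"
      proof
        assume "(\<lambda>s. complex_of_real mass * Ln s) constant_on S"
        then obtain c where c: "\<And>s. s \<in> S \<Longrightarrow> of_real mass * Ln s = c" unfolding constant_on_def by blast
        have "of_real (1 + \<rho> / 2) \<in> S" using \<rho>(1) by (simp add: S_def dist_norm)
        moreover have "1 \<in> S" using \<rho>(1) by (simp add: S_def)
        ultimately have "of_real mass * Ln (of_real (1 + \<rho> / 2)) = of_real mass * Ln (1 :: complex)"
          using c by metis
        then have "Ln (of_real (1 + \<rho> / 2)) = (0 :: complex)" using m by simp
        then have "ln (1 + \<rho> / 2) = 0"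
          by (subst (asm) Ln_of_real) (use \<rho>(1) in simp_all)
        then show False using \<rho>(1) by (simp add: ln_eq_zero_iff)
      qed
      show "G n s \<noteq> 0" if "s \<in> S" for n s using nz that by blast
      show "uniform_limit K G (\<lambda>s. of_real mass * Ln s) sequentially" if "K \<subseteq> S" for K
      proof (rule uniform_limitI)
        fix e :: real assume "0 < e"
        then have e: "0 < e / 2" by simp
        \<comment> \<open>As \<open>\<alpha> \<ge> 1\<close> and \<open>cmod s\<close> lies between
          1/2 and 2, the factor \<open>2 * \<alpha>\<close> compares \<open>w n\<close> and
          \<open>v n s\<close> in both directions.\<close>
        have M: "0 < 2 * \<alpha>" using \<alpha> by simp
        obtain \<delta> where \<delta>: "0 < \<delta>" "\<And>w w'. w \<in> sector k' \<Longrightarrow> w' \<in> sector k' \<Longrightarrow> cmod w < \<delta> \<and> cmod w' < \<delta> \<and>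
            cmod w' \<le> 2 * \<alpha> * cmod w \<and> cmod w \<le> 2 * \<alpha> * cmod w' \<Longrightarrow> cmod (f0 w' - f0 w) \<le> e / 2"
          using f0_slow[OF k' M e] by blast
        have "(\<lambda>n. inverse (real (Suc n))) \<longlonglongrightarrow> 0" by (rule LIMSEQ_inverse_real_of_nat)
        then have "\<forall>\<^sub>F n in sequentially. inverse (real (Suc n)) < \<delta> / (2 * \<alpha>)"
          using \<delta>(1) \<alpha> by (intro order_tendstoD) auto
        then show "\<forall>\<^sub>F n in sequentially. \<forall>s\<in>K. dist (G n s) (of_real mass * Ln s) < e"
        proof eventually_elim
          case (elim n)
          show ?case
          proof
            fix s' assume "s' \<in> K"
            then have s': "s' \<in> S" using that by blast
            have small: "2 * \<alpha> * cmod (w n) < \<delta>"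
            proof -
              have "cmod (w n) < \<delta> / (2 * \<alpha>)" using w(2)[of n] elim by linarith
              then show ?thesis using M by (simp only: pos_less_divide_eq mult.commute)
            qed
            have nv: "cmod (v n s') = \<alpha> * cmod (w n) * cmod s'" using \<alpha> by (simp add: v_def norm_mult)
            have up: "cmod (v n s') \<le> 2 * \<alpha> * cmod (w n)"
              unfolding nv using s(2)[OF s'] \<alpha> mult_left_mono[of "cmod s'" 2 "\<alpha> * cmod (w n)"]
              by (simp add: mult.assoc mult.left_commute)
            have "1 * cmod (w n) \<le> (\<alpha> * \<alpha>) * cmod (w n)"
              using mult_mono[OF \<alpha>(1) \<alpha>(1)] \<alpha>(2) by (intro mult_right_mono) auto
            also have "\<dots> = 2 * \<alpha> * (\<alpha> * cmod (w n) * (1 / 2))" by simp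
            also have "\<dots> \<le> 2 * \<alpha> * cmod (v n s')"
              unfolding nv using s(1)[OF s'] \<alpha> by (intro mult_left_mono) auto
            finally have low: "cmod (w n) \<le> 2 * \<alpha> * cmod (v n s')" by simp
            have "1 * cmod (w n) \<le> 2 * \<alpha> * cmod (w n)" using \<alpha> by (intro mult_right_mono) auto
            then have "cmod (f0 (v n s') - f0 (w n)) \<le> e / 2"
              using \<delta>(2)[OF wk' vs[OF s']] small up low by auto
            then show "dist (G n s') (of_real mass * Ln s') < e"
              unfolding dist_norm G_eq[OF s'] using \<open>0 < e\<close> by linarith
          qed
        qed
      qed
    qed
    then show False by simp
  qed
  then obtain n s' where n: "s' \<in> S" "G n s' = 0" by blast
  have "flow t (w n) = v n s'"
    using n vs[OF n(1), of n] sec by (intro flow_eqI) (auto simp: G_def algebra_simps)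
  then have "flow t (w n) / w n - of_real \<alpha> = of_real \<alpha> * (s' - 1)"
    using w0[of n] by (simp add: v_def algebra_simps)
  then have "cmod (flow t (w n) / w n - of_real \<alpha>) = \<alpha> * cmod (s' - 1)"
    using \<alpha> by (simp add: norm_mult)
  also have "\<dots> < \<alpha> * (\<epsilon> / \<alpha>)"
  proof (rule mult_strict_left_mono)
    have "\<epsilon> / (2 * \<alpha>) \<le> \<epsilon> / \<alpha>" using \<epsilon>(1) \<alpha> by (simp add: field_simps)
    then show "cmod (s' - 1) < \<epsilon> / \<alpha>" using s(4)[OF n(1)] \<rho>(4) by linarith
  qed (use \<alpha> in auto)
  also have "\<dots> = \<epsilon>" using \<alpha> by simp
  finally show False using w(3)[of n] by simp
qed

lemma flow_sector:
  assumes m: "0 < mass" and t: "0 \<le> t" and k: "0 < k"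
  shows "filterlim (flow t) (at 0 within sector (k / 2)) (at 0 within sector k)"
  by (rule filterlim_sector_perturb[OF filterlim_ident k _ flow_multiplier[OF m t k]]) simp

text \<open>Differentiating \<open>f (flow t w) = f w + t\<close> shows that this quotient is the
  derivative of the flow. Numerator and denominator behave like the mass over \<open>w\<close> and
  over \<open>flow t w\<close>, so only their ratio remains.\<close>

lemma deriv_quotient_flow:
  assumes m: "0 < mass" and t: "0 \<le> t" and k: "0 < k"
  shows "((\<lambda>w. deriv f w / deriv f (flow t w)) \<longlongrightarrow> of_real (exp (t / mass))) (at 0 within sector k)"
proof -
  let ?F = "at 0 within sector k"
  have k2: "0 < k / 2" using k by simp
  have "((\<lambda>w. flow t w * deriv f (flow t w)) \<longlongrightarrow> of_real mass) ?F"
    by (rule filterlim_compose[OF deriv_sector_limit[OF k2] flow_sector[OF m t k]])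
  then have "((\<lambda>w. (w * deriv f w) / (flow t w * deriv f (flow t w)) * (flow t w / w)) \<longlongrightarrow>
      of_real mass / of_real mass * of_real (exp (t / mass))) ?F"
    using m by (intro tendsto_mult tendsto_divide deriv_sector_limit flow_multiplier k t) auto
  moreover have "\<forall>\<^sub>F w in ?F. (w * deriv f w) / (flow t w * deriv f (flow t w)) * (flow t w / w) =
      deriv f w / deriv f (flow t w)"
    unfolding eventually_at_topological
  proof (intro exI[of _ UNIV] conjI ballI impI)
    fix w assume w: "w \<noteq> 0" "w \<in> sector k"
    then have "w \<in> rhp" using sector_subset_rhp[OF k] by auto
    then have "flow t w \<in> rhp" using flow_rhp t by blast
    then have "flow t w \<noteq> 0" by auto
    then show "(w * deriv f w) / (flow t w * deriv f (flow t w)) * (flow t w / w) = deriv f w / deriv f (flow t w)"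
      using w by simp
  qed auto
  ultimately show ?thesis using m by (simp add: tendsto_cong)
qed

end

subsection \<open>The chart of the disc at a boundary point\<close>

lemma frequently_filterlim:
  assumes "filterlim g F G" "\<exists>\<^sub>F x in G. P (g x)"
  shows "\<exists>\<^sub>F y in F. P y"
  using assms eventually_compose_filterlim[of "\<lambda>y. \<not> P y" F g G] unfolding frequently_def by blast

lemma filterlim_at_withinI:
  assumes "(g \<longlongrightarrow> c) F" "\<forall>\<^sub>F x in F. g x \<in> S" "c \<notin> S"
  shows "filterlim g (at c within S) F"
  using assms unfolding filterlim_at by (auto elim: eventually_mono)

lemma eventually_in_at_within: "\<forall>\<^sub>F z in at a within S. z \<in> S"
  by (auto simp: eventually_at_filter)

lemma stolz_subset: "stolz \<sigma> R \<subseteq> unit_disc"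
  by (auto simp: stolz_def)

lemma filterlim_radial_stolz:
  assumes "cmod \<sigma> = 1" "1 < R"
  shows "filterlim (\<lambda>r. of_real r * \<sigma>) (at \<sigma> within stolz \<sigma> R) (at_left 1)"
proof (rule filterlim_at_withinI)
  have "((\<lambda>r. of_real r * \<sigma>) \<longlongrightarrow> of_real 1 * \<sigma>) (at_left 1)" by (intro tendsto_intros)
  then show "((\<lambda>r. of_real r * \<sigma>) \<longlongrightarrow> \<sigma>) (at_left 1)" by simp
  have "of_real r * \<sigma> \<in> stolz \<sigma> R" if r: "0 < r" "r < 1" for r
  proof -
    have "\<sigma> - of_real r * \<sigma> = of_real (1 - r) * \<sigma>" by (simp add: algebra_simps)
    then have "cmod (\<sigma> - of_real r * \<sigma>) = \<bar>1 - r\<bar> * cmod \<sigma>" by (simp only: norm_mult norm_of_real)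
    then show ?thesis using r assms by (simp add: stolz_def norm_mult)
  qed
  moreover have "\<forall>\<^sub>F r in at_left 1. r \<in> {0<..<1::real}"
    by (rule eventually_at_leftI[of 0]) auto
  ultimately show "\<forall>\<^sub>F r in at_left 1. of_real r * \<sigma> \<in> stolz \<sigma> R"
    by (auto elim: eventually_mono)
  show "\<sigma> \<notin> stolz \<sigma> R" using assms by (simp add: stolz_def)
qed

lemma at_within_stolz_neq_bot:
  assumes "cmod \<sigma> = 1" "1 < R"
  shows "at \<sigma> within stolz \<sigma> R \<noteq> bot"
proof
  assume "at \<sigma> within stolz \<sigma> R = bot"
  then have "\<forall>\<^sub>F z in at \<sigma> within stolz \<sigma> R. False" by simp
  from eventually_compose_filterlim[OF this filterlim_radial_stolz[OF assms]]
  show False by simp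
qed

text \<open>\<open>g z - D * z\<close> has small derivative near the end of the radius; the mean
  value inequality between two radial points passes to the limit as the outer one tends to \<sigma>.
  The limit \<open>L\<close> replaces the value of \<open>g\<close> at \<sigma>, which carries no
  information.\<close>

lemma radial_difference_quotient:
  assumes \<sigma>: "cmod \<sigma> = 1" and g: "g holomorphic_on unit_disc"
    and L: "(g \<longlongrightarrow> L) (at \<sigma> within stolz \<sigma> 2)" and D: "(deriv g \<longlongrightarrow> D) (at \<sigma> within stolz \<sigma> 2)"
  shows "((\<lambda>r. (g (of_real r * \<sigma>) - L) / (of_real r * \<sigma> - \<sigma>)) \<longlongrightarrow> D) (at_left 1)"
proof (rule tendstoI)
  fix \<epsilon>' :: real assume "0 < \<epsilon>'"
  define \<epsilon> where "\<epsilon> = \<epsilon>' / 2"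
  have \<epsilon>: "0 < \<epsilon>" using \<open>0 < \<epsilon>'\<close> by (simp add: \<epsilon>_def)
  have rad: "filterlim (\<lambda>r. of_real r * \<sigma>) (at \<sigma> within stolz \<sigma> 2) (at_left 1)"
    using filterlim_radial_stolz[OF \<sigma>] by simp
  have "((\<lambda>r. deriv g (of_real r * \<sigma>)) \<longlongrightarrow> D) (at_left 1)"
    by (rule filterlim_compose[OF D rad])
  then have "\<forall>\<^sub>F r in at_left 1. dist (deriv g (of_real r * \<sigma>)) D < \<epsilon>"
    using \<epsilon> by (rule tendstoD)
  then obtain b where b: "b < 1" "\<And>r. b < r \<Longrightarrow> r < 1 \<Longrightarrow> dist (deriv g (of_real r * \<sigma>)) D < \<epsilon>"
    by (auto simp: eventually_at_left_field)
  have gL: "((\<lambda>r. g (of_real r * \<sigma>)) \<longlongrightarrow> L) (at_left 1)"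
    by (rule filterlim_compose[OF L rad])
  define G where "G z = g z - D * z" for z
  have main: "dist ((g (of_real r * \<sigma>) - L) / (of_real r * \<sigma> - \<sigma>)) D < \<epsilon>'"
    if r: "b < r" "0 < r" "r < 1" for r
  proof -
    have step: "cmod (G (of_real r' * \<sigma>) - G (of_real r * \<sigma>)) \<le> \<epsilon> * (1 - r)" if r': "r < r'" "r' < 1" for r'
    proof -
      have seg: "\<exists>s. z = of_real s * \<sigma> \<and> b < s \<and> 0 < s \<and> s < 1"
        if z: "z \<in> closed_segment (of_real r * \<sigma>) (of_real r' * \<sigma>)" for z
      proof -
        obtain u where u: "0 \<le> u" "u \<le> 1" "z = (1 - u) *\<^sub>R (of_real r * \<sigma>) + u *\<^sub>R (of_real r' * \<sigma>)"
          using z by (auto simp: closed_segment_def)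
        define s where "s = (1 - u) * r + u * r'"
        have "z = of_real s * \<sigma>" using u(3) by (simp add: s_def scaleR_conv_of_real algebra_simps)
        moreover have "r \<le> s"
          using mult_left_mono[OF less_imp_le[OF r'(1)] u(1)] by (simp add: s_def algebra_simps)
        moreover have "s \<le> r'"
          using mult_left_mono[OF less_imp_le[OF r'(1)], of "1 - u"] u(2) by (simp add: s_def algebra_simps)
        ultimately show ?thesis using r r' by auto
      qed
      have "cmod (G (of_real r' * \<sigma>) - G (of_real r * \<sigma>)) \<le> \<epsilon> * cmod (of_real r' * \<sigma> - of_real r * \<sigma>)"
      proof (rule field_differentiable_bound[where f = G and f' = "\<lambda>z. deriv g z - D"
            and S = "closed_segment (of_real r * \<sigma>) (of_real r' * \<sigma>)"])
        fix z assume "z \<in> closed_segment (of_real r * \<sigma>) (of_real r' * \<sigma>)"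
        from seg[OF this] obtain s where s: "z = of_real s * \<sigma>" "b < s" "0 < s" "s < 1" by blast
        have "z \<in> unit_disc" using s \<sigma> by (simp add: norm_mult)
        then have "(g has_field_derivative deriv g z) (at z)" by (rule holomorphic_derivI[OF g open_ball])
        then have "(G has_field_derivative deriv g z - D) (at z)"
          unfolding G_def by (auto intro!: derivative_eq_intros)
        then show "(G has_field_derivative deriv g z - D)
            (at z within closed_segment (of_real r * \<sigma>) (of_real r' * \<sigma>))"
          by (rule has_field_derivative_at_within)
        show "cmod (deriv g z - D) \<le> \<epsilon>" using b(2)[OF s(2,4)] s(1) by (simp add: dist_norm)
      qed (rule convex_closed_segment ends_in_segment)+
      also have "cmod (of_real r' * \<sigma> - of_real r * \<sigma>) = r' - r"
      proof -
        have "of_real r' * \<sigma> - of_real r * \<sigma> = of_real (r' - r) * \<sigma>" by (simp add: algebra_simps)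
        then show ?thesis using r' \<sigma> by (simp only: norm_mult norm_of_real) simp
      qed
      also have "\<epsilon> * (r' - r) \<le> \<epsilon> * (1 - r)" using r' \<epsilon> by (intro mult_left_mono) auto
      finally show ?thesis .
    qed
    have "((\<lambda>r'. cmod (G (of_real r' * \<sigma>) - G (of_real r * \<sigma>))) \<longlongrightarrow>
        cmod ((L - D * (of_real 1 * \<sigma>)) - G (of_real r * \<sigma>))) (at_left 1)"
      unfolding G_def by (intro tendsto_intros gL)
    moreover have "\<forall>\<^sub>F r' in at_left 1. cmod (G (of_real r' * \<sigma>) - G (of_real r * \<sigma>)) \<le> \<epsilon> * (1 - r)"
      by (rule eventually_at_leftI[of r]) (use step r in auto)
    ultimately have "cmod ((L - D * (of_real 1 * \<sigma>)) - G (of_real r * \<sigma>)) \<le> \<epsilon> * (1 - r)"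
      by (rule tendsto_upperbound) simp
    moreover define Q where "Q = of_real r * \<sigma> - \<sigma>"
    have Q: "cmod Q = 1 - r"
    proof -
      have "Q = of_real (r - 1) * \<sigma>" by (simp add: Q_def algebra_simps)
      then show ?thesis using r \<sigma> by (simp only: norm_mult norm_of_real) simp
    qed
    have "(L - D * (of_real 1 * \<sigma>)) - G (of_real r * \<sigma>) = - (g (of_real r * \<sigma>) - L - D * Q)"
      by (simp add: G_def Q_def algebra_simps)
    ultimately have le: "cmod (g (of_real r * \<sigma>) - L - D * Q) \<le> \<epsilon> * cmod Q"
      by (simp only: norm_minus_cancel Q)
    have "Q \<noteq> 0" using Q r by auto
    then have "(g (of_real r * \<sigma>) - L) / Q - D = (g (of_real r * \<sigma>) - L - D * Q) / Q"
      by (simp add: field_simps)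
    then have "cmod ((g (of_real r * \<sigma>) - L) / Q - D) \<le> \<epsilon>"
      using le Q r by (simp add: norm_divide pos_divide_le_eq)
    then show ?thesis using \<open>0 < \<epsilon>'\<close> by (simp add: dist_norm Q_def \<epsilon>_def)
  qed
  show "\<forall>\<^sub>F r in at_left 1. dist ((g (of_real r * \<sigma>) - L) / (of_real r * \<sigma> - \<sigma>)) D < \<epsilon>'"
    by (rule eventually_at_leftI[of "max 0 b"]) (use main b in auto)
qed

section \<open>The Cayley chart: Poisson kernel, inverse and sectors\<close>

locale boundary_chart =
  fixes \<sigma> \<tau> :: complex
  assumes \<sigma>: "cmod \<sigma> = 1" and \<tau>: "cmod \<tau> = 1" and neq: "\<sigma> \<noteq> \<tau>"
begin

text \<open>The factor \<open>\<tau> - \<sigma>\<close> makes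
  \<open>chart z / (1 - cnj \<sigma> * z)\<close> tend to 1 at \<sigma>, so that arguments in the
  disc and in the half plane have the same limits.\<close>

definition chart :: "complex \<Rightarrow> complex" where
  "chart z = (\<tau> - \<sigma>) * (1 - cnj \<sigma> * z) / (\<tau> - z)"

definition chart_inv :: "complex \<Rightarrow> complex" where
  "chart_inv w = (w * \<tau> - (\<tau> - \<sigma>)) / (w - (\<tau> - \<sigma>) * cnj \<sigma>)"

lemma \<sigma>_cnj: "\<sigma> * cnj \<sigma> = 1" "cnj \<sigma> * \<sigma> = 1"
  using \<sigma> by (simp_all add: complex_norm_square[symmetric] mult.commute)

lemma dist_pos: "0 < cmod (\<tau> - \<sigma>)"
  using neq by simp

lemma one_minus: "1 - cnj \<sigma> * z = cnj \<sigma> * (\<sigma> - z)"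
  using \<sigma>_cnj by (simp add: algebra_simps)

lemma cmod_chart: "cmod (chart z) = cmod (\<tau> - \<sigma>) * cmod (\<sigma> - z) / cmod (\<tau> - z)"
  unfolding chart_def one_minus using \<sigma> by (simp add: norm_mult norm_divide)

text \<open>Up to a constant factor this is the Poisson kernel with pole \<tau>; its sign decides
  membership in the disc.\<close>

lemma Re_chart:
  "Re (chart z) = (cmod (\<tau> - \<sigma>))\<^sup>2 * (1 - (cmod z)\<^sup>2) / (2 * (cmod (\<tau> - z))\<^sup>2)"
proof -
  have s: "Re \<sigma> * Re \<sigma> + Im \<sigma> * Im \<sigma> = 1" and t: "Re \<tau> * Re \<tau> + Im \<tau> * Im \<tau> = 1"
    using \<sigma> \<tau> cmod_power2[of \<sigma>] cmod_power2[of \<tau>] by (simp_all add: power2_eq_square)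
  define N where "N = (\<tau> - \<sigma>) * (1 - cnj \<sigma> * z) * cnj (\<tau> - z)"
  have N2: "2 * Re N = (cmod (\<tau> - \<sigma>))\<^sup>2 * (1 - (cmod z)\<^sup>2)"
    unfolding cmod_power2 N_def using s t by (simp add: power2_eq_square) algebra
  have "chart z = N / of_real ((cmod (\<tau> - z))\<^sup>2)"
    unfolding chart_def N_def by (subst complex_div_cnj) simp
  then have "Re (chart z) = Re N / (cmod (\<tau> - z))\<^sup>2"
    by (simp only: Re_divide_of_real)
  then show ?thesis unfolding N2[symmetric] by simp
qed

lemma chart_rhp: "z \<in> unit_disc \<Longrightarrow> chart z \<in> rhp"
proof -
  assume z: "z \<in> unit_disc"
  then have "z \<noteq> \<tau>" using \<tau> by auto
  moreover have "(cmod z)\<^sup>2 < 1" using z by (simp add: abs_square_less_1)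
  ultimately show ?thesis using dist_pos unfolding Re_chart mem_Collect_eq
    by (intro divide_pos_pos mult_pos_pos) auto
qed

lemma chart_inv_denom: "w \<in> rhp \<Longrightarrow> w - (\<tau> - \<sigma>) * cnj \<sigma> \<noteq> 0"
proof -
  assume w: "w \<in> rhp"
  \<comment> \<open>The pole of \<open>chart_inv\<close> has nonpositive real part because
    \<open>\<tau> * cnj \<sigma>\<close> is unimodular.\<close>
  have "(\<tau> - \<sigma>) * cnj \<sigma> = \<tau> * cnj \<sigma> - 1" using \<sigma>_cnj by (simp add: algebra_simps)
  moreover have "Re (\<tau> * cnj \<sigma>) \<le> 1"
    using complex_Re_le_cmod[of "\<tau> * cnj \<sigma>"] \<sigma> \<tau> by (simp add: norm_mult)
  ultimately have "0 < Re (w - (\<tau> - \<sigma>) * cnj \<sigma>)" using w by (simp del: complex_cnj_diff)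
  then show ?thesis by auto
qed

lemma \<tau>_cnj_neq_1: "1 - \<tau> * cnj \<sigma> \<noteq> 0"
proof
  assume "1 - \<tau> * cnj \<sigma> = 0"
  then have "\<tau> * (cnj \<sigma> * \<sigma>) = \<sigma>" by (simp add: algebra_simps)
  then show False using \<sigma>_cnj neq by simp
qed

lemma chart_chart_inv:
  assumes "w \<in> rhp"
  shows "chart (chart_inv w) = w" "chart_inv w \<in> unit_disc"
proof -
  define d where "d = w - (\<tau> - \<sigma>) * cnj \<sigma>"
  have d: "d \<noteq> 0" using chart_inv_denom[OF assms] by (simp add: d_def)
  define e where "e = 1 - \<tau> * cnj \<sigma>"
  have e: "e \<noteq> 0" using \<tau>_cnj_neq_1 by (simp add: e_def)
  have z: "chart_inv w = (w * \<tau> - (\<tau> - \<sigma>)) / d" by (simp add: chart_inv_def d_def)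
  have 1: "\<tau> - chart_inv w = (\<tau> - \<sigma>) * e / d"
    unfolding z using d by (simp add: field_simps) (simp add: d_def e_def algebra_simps)
  have 2: "1 - cnj \<sigma> * chart_inv w = w * e / d"
    unfolding z using d by (simp add: field_simps) (simp add: d_def e_def algebra_simps)
  show c: "chart (chart_inv w) = w"
    unfolding chart_def 1 2 using d e neq by simp
  have "0 < (cmod (\<tau> - \<sigma>))\<^sup>2 * (1 - (cmod (chart_inv w))\<^sup>2) / (2 * (cmod (\<tau> - chart_inv w))\<^sup>2)"
    using assms Re_chart[of "chart_inv w"] unfolding c by simp
  then have "0 < 1 - (cmod (chart_inv w))\<^sup>2"
    by (auto simp: zero_less_divide_iff zero_less_mult_iff)
  then show "chart_inv w \<in> unit_disc" by (simp add: abs_square_less_1)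
qed

lemma chart_inv_chart:
  assumes "z \<in> unit_disc"
  shows "chart_inv (chart z) = z"
proof -
  have nz: "\<tau> - z \<noteq> 0" using assms \<tau> by auto
  have "chart z * (\<tau> - z) = (\<tau> - \<sigma>) * (1 - cnj \<sigma> * z)"
    using nz by (simp add: chart_def)
  then have "chart z * \<tau> - (\<tau> - \<sigma>) = z * (chart z - (\<tau> - \<sigma>) * cnj \<sigma>)"
    by (simp add: algebra_simps)
  then show ?thesis
    using chart_inv_denom[OF chart_rhp[OF assms]] by (simp add: chart_inv_def)
qed

lemma chart_inv_holo: "chart_inv holomorphic_on rhp"
  unfolding chart_inv_def using chart_inv_denom by (intro holomorphic_intros) auto

lemma chart_has_deriv:
  assumes "z \<in> unit_disc"
  shows "(chart has_field_derivative - ((\<tau> - \<sigma>)\<^sup>2 * cnj \<sigma>) / (\<tau> - z)\<^sup>2) (at z)"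
proof -
  have nz: "\<tau> - z \<noteq> 0" using assms \<tau> by auto
  have e: "(\<tau> - \<sigma>) * (0 - cnj \<sigma> * 1) * (\<tau> - z) - (\<tau> - \<sigma>) * (1 - cnj \<sigma> * z) * (0 - 1)
      = - ((\<tau> - \<sigma>)\<^sup>2 * cnj \<sigma>)"
    unfolding one_minus by (simp add: algebra_simps power2_eq_square)
  have "(chart has_field_derivative ((\<tau> - \<sigma>) * (0 - cnj \<sigma> * 1) * (\<tau> - z) -
      (\<tau> - \<sigma>) * (1 - cnj \<sigma> * z) * (0 - 1)) / ((\<tau> - z) * (\<tau> - z))) (at z)"
    unfolding chart_def using nz
    by (intro DERIV_divide DERIV_cmult DERIV_diff DERIV_const DERIV_ident)
  then show ?thesis by (simp only: e power2_eq_square)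
qed

lemma chart_tendsto: "(chart \<longlongrightarrow> 0) (at \<sigma> within S)"
proof -
  have "((\<lambda>z. (\<tau> - \<sigma>) * (1 - cnj \<sigma> * z) / (\<tau> - z)) \<longlongrightarrow> (\<tau> - \<sigma>) * (1 - cnj \<sigma> * \<sigma>) / (\<tau> - \<sigma>)) (at \<sigma> within S)"
    using neq by (intro tendsto_intros) auto
  then show ?thesis using \<sigma>_cnj by (simp add: chart_def[abs_def])
qed

lemma chart_inv_tendsto: "(chart_inv \<longlongrightarrow> \<sigma>) (at 0 within S)"
proof -
  have n: "(\<tau> - \<sigma>) * cnj \<sigma> \<noteq> 0" using neq \<sigma>_cnj by auto
  have "((\<lambda>w. (w * \<tau> - (\<tau> - \<sigma>)) / (w - (\<tau> - \<sigma>) * cnj \<sigma>)) \<longlongrightarrow>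
      (0 * \<tau> - (\<tau> - \<sigma>)) / (0 - (\<tau> - \<sigma>) * cnj \<sigma>)) (at 0 within S)"
    using n by (intro tendsto_intros) auto
  moreover have "(0 * \<tau> - (\<tau> - \<sigma>)) / (0 - (\<tau> - \<sigma>) * cnj \<sigma>) = \<sigma>"
  proof -
    have e: "0 * \<tau> - (\<tau> - \<sigma>) = \<sigma> * (0 - (\<tau> - \<sigma>) * cnj \<sigma>)"
    proof -
      have "\<sigma> * (0 - (\<tau> - \<sigma>) * cnj \<sigma>) = 0 * \<tau> - (\<tau> - \<sigma>) * (\<sigma> * cnj \<sigma>)" by (simp add: algebra_simps)
      then show ?thesis by (simp only: \<sigma>_cnj mult_1_right)
    qed
    have "0 - (\<tau> - \<sigma>) * cnj \<sigma> \<noteq> 0" using n by simp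
    then show ?thesis unfolding e by (rule nonzero_mult_div_cancel_right)
  qed
  ultimately show ?thesis by (simp add: chart_inv_def[abs_def])
qed

lemma \<sigma>_notin: "\<sigma> \<notin> unit_disc"
  using \<sigma> by simp

lemma filterlim_chart: "filterlim chart (at 0 within rhp) (at \<sigma> within unit_disc)"
  by (rule filterlim_at_withinI[OF chart_tendsto])
    (use chart_rhp in \<open>auto intro: eventually_mono[OF eventually_in_at_within]\<close>)

lemma filterlim_chart_inv: "filterlim chart_inv (at \<sigma> within unit_disc) (at 0 within rhp)"
  by (rule filterlim_at_withinI[OF chart_inv_tendsto _ \<sigma>_notin])
    (use chart_chart_inv(2) in \<open>auto intro: eventually_mono[OF eventually_in_at_within]\<close>)

text \<open>The quotient of \<open>Re (chart z)\<close> by the modulus is \<open>cmod (\<tau> -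
  \<sigma>) * (1 - (cmod z)\<^sup>2) / (2 * cmod (\<sigma> - z) * cmod (\<tau> - z))\<close>. The
  bounds \<open>cmod (\<tau> - z) \<le> 2\<close> and
  \<open>1 - cmod z \<le> 1 - (cmod z)\<^sup>2\<close> give the 4.\<close>

lemma chart_stolz:
  assumes z: "z \<in> stolz \<sigma> R" and R: "1 < R"
  shows "chart z \<in> sector (cmod (\<tau> - \<sigma>) / (4 * R))"
proof -
  have zd: "z \<in> unit_disc" and zs: "cmod (\<sigma> - z) < R * (1 - cmod z)"
    using z by (auto simp: stolz_def)
  define a b c where "a = cmod (\<tau> - \<sigma>)" and "b = cmod (\<sigma> - z)" and "c = cmod (\<tau> - z)"
  have abc: "0 < a" "0 < c" "c \<le> 2"
    using dist_pos zd \<tau> norm_triangle_ineq4[of \<tau> z] by (auto simp: a_def c_def)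
  have b: "b < R * (1 - cmod z)" using zs by (simp add: b_def)
  have z1: "0 \<le> cmod z" "cmod z < 1" using zd by auto
  have "b * c \<le> R * (1 - cmod z) * 2"
    using b abc z1 R by (intro mult_mono) auto
  also have "\<dots> \<le> 2 * R * (1 - (cmod z)\<^sup>2)"
  proof -
    have "(cmod z)\<^sup>2 \<le> cmod z * 1" unfolding power2_eq_square using z1 by (intro mult_left_mono) auto
    then have "2 * R * (1 - cmod z) \<le> 2 * R * (1 - (cmod z)\<^sup>2)" using R by (intro mult_left_mono) auto
    then show ?thesis by simp
  qed
  finally have "a\<^sup>2 * (b * c) \<le> a\<^sup>2 * (2 * R * (1 - (cmod z)\<^sup>2))" by (intro mult_left_mono) auto
  then have "a / (4 * R) * (a * b / c) \<le> a\<^sup>2 * (1 - (cmod z)\<^sup>2) / (2 * c\<^sup>2)"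
    using abc R by (simp add: field_simps power2_eq_square)
  moreover have "chart z \<noteq> 0" using chart_rhp[OF zd] by auto
  ultimately show ?thesis
    by (simp only: sector_def mem_Collect_eq cmod_chart Re_chart a_def b_def c_def not_False_eq_True simp_thms)
qed

lemma filterlim_chart_stolz:
  assumes R: "1 < R"
  shows "filterlim chart (at 0 within sector (cmod (\<tau> - \<sigma>) / (4 * R))) (at \<sigma> within stolz \<sigma> R)"
  by (rule filterlim_at_withinI[OF chart_tendsto])
    (use chart_stolz[OF _ R] in \<open>auto simp: sector_def intro: eventually_mono[OF eventually_in_at_within]\<close>)

text \<open>Near \<sigma> the distance to \<tau> is at least half of
  \<open>cmod (\<tau> - \<sigma>)\<close>, which yields the Stolz constant \<open>2 / k\<close>; the
  added 2 makes the inequality strict. The statement must be local, since a sector also reaches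
  infinity, which corresponds to \<tau>.\<close>

lemma filterlim_chart_inv_sector:
  assumes k: "0 < k"
  shows "filterlim chart_inv (at \<sigma> within stolz \<sigma> (2 / k + 2)) (at 0 within sector k)"
proof (rule filterlim_at_withinI[OF chart_inv_tendsto])
  show "\<sigma> \<notin> stolz \<sigma> (2 / k + 2)" using \<sigma> by (simp add: stolz_def)
  have "\<forall>\<^sub>F w in at 0 within sector k. dist (chart_inv w) \<sigma> < cmod (\<tau> - \<sigma>) / 2"
    using dist_pos by (intro tendstoD[OF chart_inv_tendsto]) auto
  then show "\<forall>\<^sub>F w in at 0 within sector k. chart_inv w \<in> stolz \<sigma> (2 / k + 2)"
    using eventually_in_at_within[of "sector k" 0]
  proof eventually_elim
    case (elim w)
    have w: "w \<in> rhp" using elim sector_subset_rhp[OF k] by auto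
    define z where "z = chart_inv w"
    have z: "z \<in> unit_disc" "chart z = w" using chart_chart_inv[OF w] by (auto simp: z_def)
    define a b c where "a = cmod (\<tau> - \<sigma>)" and "b = cmod (\<sigma> - z)" and "c = cmod (\<tau> - z)"
    have a: "0 < a" using dist_pos by (simp add: a_def)
    have z1: "0 \<le> cmod z" "cmod z < 1" using z by auto
    have c: "a / 2 \<le> c"
      using elim(1) norm_triangle_ineq2[of "\<tau> - \<sigma>" "z - \<sigma>"] by (simp add: a_def c_def z_def dist_norm)
    have c0: "0 < c" using a c by linarith
    have "k * (a * b / c) \<le> a\<^sup>2 * (1 - (cmod z)\<^sup>2) / (2 * c\<^sup>2)"
      using elim(2) z(2) cmod_chart[of z] Re_chart[of z] by (simp add: sector_def a_def b_def c_def)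
    then have "a * (k * b * (2 * c)) \<le> a * (a * (1 - (cmod z)\<^sup>2))"
      using c0 by (simp add: field_simps power2_eq_square)
    then have "k * b * (2 * c) \<le> a * (1 - (cmod z)\<^sup>2)"
      using a by (rule mult_left_le_imp_le)
    also have "\<dots> \<le> a * (2 * (1 - cmod z))"
    proof (intro mult_left_mono)
      have "(1 - cmod z) * (1 + cmod z) \<le> (1 - cmod z) * 2" using z1 by (intro mult_left_mono) auto
      then show "1 - (cmod z)\<^sup>2 \<le> 2 * (1 - cmod z)" by (simp add: algebra_simps power2_eq_square)
    qed (use a in auto)
    finally have 1: "k * b * (2 * c) \<le> a * (2 * (1 - cmod z))" .
    have "k * b * a \<le> k * b * (2 * c)" using k c by (intro mult_left_mono) (auto simp: b_def)
    with 1 have "a * (k * b) \<le> a * (2 * (1 - cmod z))" by (simp add: algebra_simps)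
    then have "k * b \<le> 2 * (1 - cmod z)" using a by simp
    then have "b \<le> 2 / k * (1 - cmod z)" using k by (simp add: field_simps)
    also have "\<dots> < (2 / k + 2) * (1 - cmod z)" using z1 by (intro mult_strict_right_mono) auto
    finally show ?case using z by (simp add: stolz_def b_def z_def)
  qed
qed

end

subsection \<open>Semigroups in the chart\<close>

locale semigroup_chart = boundary_chart \<sigma> \<tau> for \<sigma> \<tau> :: complex +
  fixes \<phi> :: "real \<Rightarrow> complex \<Rightarrow> complex" and h :: "complex \<Rightarrow> complex"
  assumes semigroup: "holomorphic_semigroup \<phi>"
    and dw: "denjoy_wolff_point \<phi> \<tau>"
    and h_holo: "h holomorphic_on unit_disc" and h_inj: "inj_on h unit_disc"
    and h_\<phi>: "0 \<le> t \<Longrightarrow> z \<in> unit_disc \<Longrightarrow> h (\<phi> t z) = h z + \<i> * of_real t"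
begin

lemma \<phi>_holo: "0 \<le> t \<Longrightarrow> \<phi> t holomorphic_on unit_disc"
  and \<phi>_disc: "0 \<le> t \<Longrightarrow> z \<in> unit_disc \<Longrightarrow> \<phi> t z \<in> unit_disc"
  and \<phi>_0: "z \<in> unit_disc \<Longrightarrow> \<phi> 0 z = z"
  and \<phi>_add: "0 \<le> t \<Longrightarrow> 0 \<le> s \<Longrightarrow> z \<in> unit_disc \<Longrightarrow> \<phi> (t + s) z = \<phi> t (\<phi> s z)"
  and \<phi>_cont: "compact K \<Longrightarrow> K \<subseteq> unit_disc \<Longrightarrow> 0 \<le> t \<Longrightarrow> uniform_limit K \<phi> (\<phi> t) (at t within {0..})"
  using semigroup unfolding holomorphic_semigroup_def by (blast+)

text \<open>The factor -\<i> turns the vertical translation of the model into a translation to the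
  right.\<close>

definition lin :: "complex \<Rightarrow> complex" where
  "lin w = - \<i> * h (chart_inv w)"

lemma lin_chart: "z \<in> unit_disc \<Longrightarrow> lin (chart z) = - \<i> * h z"
  by (simp add: lin_def chart_inv_chart)

lemma h_eq_lin: "z \<in> unit_disc \<Longrightarrow> Re (h z) = - Im (lin (chart z))"
  "z \<in> unit_disc \<Longrightarrow> Im (h z) = Re (lin (chart z))"
  by (simp_all add: lin_chart)

definition conj_flow :: "real \<Rightarrow> complex \<Rightarrow> complex" where
  "conj_flow t w = chart (\<phi> t (chart_inv w))"

lemma conj_flow_rhp: "0 \<le> t \<Longrightarrow> w \<in> rhp \<Longrightarrow> conj_flow t w \<in> rhp"
  unfolding conj_flow_def by (intro chart_rhp \<phi>_disc chart_chart_inv(2))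

lemma lin_conj_flow: "0 \<le> t \<Longrightarrow> w \<in> rhp \<Longrightarrow> lin (conj_flow t w) = lin w + of_real t"
proof -
  assume t: "0 \<le> t" and w: "w \<in> rhp"
  have "lin (conj_flow t w) = - \<i> * h (\<phi> t (chart_inv w))"
    unfolding conj_flow_def by (intro lin_chart \<phi>_disc t chart_chart_inv(2) w)
  then show ?thesis
    using h_\<phi>[OF t chart_chart_inv(2)[OF w]] by (simp add: lin_def algebra_simps)
qed

lemma lin_holo: "lin holomorphic_on rhp"
proof -
  have "(h \<circ> chart_inv) holomorphic_on rhp"
    using chart_chart_inv(2) by (intro holomorphic_on_compose_gen[OF chart_inv_holo h_holo]) auto
  then show ?thesis unfolding lin_def by (auto intro!: holomorphic_intros simp: o_def)
qed

lemma chart_holo: "chart holomorphic_on unit_disc"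
  using chart_has_deriv unfolding holomorphic_on_open[OF open_ball] by blast

lemma conj_flow_holo:
  assumes "0 \<le> t"
  shows "conj_flow t holomorphic_on rhp"
proof -
  have "(\<phi> t \<circ> chart_inv) holomorphic_on rhp"
    using chart_chart_inv(2) by (intro holomorphic_on_compose_gen[OF chart_inv_holo \<phi>_holo[OF assms]]) auto
  then have "(chart \<circ> (\<phi> t \<circ> chart_inv)) holomorphic_on rhp"
    using chart_chart_inv(2) \<phi>_disc[OF assms] by (intro holomorphic_on_compose_gen[OF _ chart_holo]) auto
  then show ?thesis by (simp add: conj_flow_def[abs_def] o_def)
qed

text \<open>The orbit of one point at the times n t converges to \<tau>, hence escapes to infinity
  in the chart; this is the orbit that \<open>wolff_rhp\<close> needs.\<close>

lemma Re_conj_flow: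
  assumes t: "0 < t" and w: "w \<in> rhp"
  shows "Re w \<le> Re (conj_flow t w)"
proof -
  define z0 where "z0 = chart_inv 1"
  have z0: "z0 \<in> unit_disc" using chart_chart_inv(2)[of 1] by (simp add: z0_def)
  define z where "z n = \<phi> (real n * t) z0" for n
  have zd: "z n \<in> unit_disc" for n unfolding z_def using z0 t by (intro \<phi>_disc) auto
  have zS: "\<phi> t (z n) = z (Suc n)" for n
    unfolding z_def using \<phi>_add[of t "real n * t" z0] t z0 by (simp add: algebra_simps)
  have z_lim: "z \<longlonglongrightarrow> \<tau>"
  proof -
    have "uniform_limit {z0} \<phi> (\<lambda>_. \<tau>) at_top"
    proof -
      have "compact {z0}" "{z0} \<subseteq> unit_disc" using z0 by auto
      then show ?thesis using dw unfolding denjoy_wolff_point_def by blast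
    qed
    then have "((\<lambda>s. \<phi> s z0) \<longlongrightarrow> \<tau>) at_top"
      by (rule tendsto_uniform_limitI) simp
    moreover have "filterlim (\<lambda>n. real n * t) at_top sequentially"
      using t by (intro filterlim_at_top_mult_tendsto_pos[OF tendsto_const _ filterlim_real_sequentially]) auto
    ultimately show ?thesis unfolding z_def by (rule filterlim_compose)
  qed
  have "filterlim (\<lambda>n. (\<tau> - \<sigma>) * (1 - cnj \<sigma> * z n) * inverse (\<tau> - z n)) at_infinity sequentially"
  proof (rule tendsto_mult_filterlim_at_infinity)
    show "(\<lambda>n. (\<tau> - \<sigma>) * (1 - cnj \<sigma> * z n)) \<longlonglongrightarrow> (\<tau> - \<sigma>) * (1 - cnj \<sigma> * \<tau>)"
      by (intro tendsto_intros z_lim)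
    show "(\<tau> - \<sigma>) * (1 - cnj \<sigma> * \<tau>) \<noteq> 0" using neq \<tau>_cnj_neq_1 by (simp add: mult.commute)
    have "(\<lambda>n. \<tau> - z n) \<longlonglongrightarrow> \<tau> - \<tau>" by (intro tendsto_intros z_lim)
    moreover have "\<tau> - z n \<noteq> 0" for n using zd[of n] \<tau> by auto
    ultimately have "filterlim (\<lambda>n. \<tau> - z n) (at 0) sequentially"
      by (simp add: filterlim_at)
    then show "filterlim (\<lambda>n. inverse (\<tau> - z n)) at_infinity sequentially"
      by (rule filterlim_compose[OF filterlim_inverse_at_infinity])
  qed
  then have inf: "filterlim (\<lambda>n. chart (z n)) at_infinity sequentially"
    by (simp add: chart_def divide_inverse)
  show ?thesis
  proof (rule wolff_rhp[OF conj_flow_holo _ _ _ inf w])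
    show "0 < Re (conj_flow t v)" if "v \<in> rhp" for v using conj_flow_rhp[of t v] that t by simp
    show "chart (z n) \<in> rhp" for n by (rule chart_rhp[OF zd])
    show "conj_flow t (chart (z n)) = chart (z (Suc n))" for n
      by (simp add: conj_flow_def chart_inv_chart[OF zd] zS)
  qed (use t in simp)
qed

text \<open>\<open>1 / deriv lin\<close> is the infinitesimal generator of the conjugated semigroup, which pushes
  points to the right by Wolff's inequality.\<close>

lemma Re_deriv_lin_nonneg:
  assumes w: "w \<in> rhp"
  shows "0 \<le> Re (deriv lin w)"
proof -
  define z where "z = chart_inv w"
  have z: "z \<in> unit_disc" "chart z = w" using chart_chart_inv[OF w] by (auto simp: z_def)
  have "uniform_limit {z} \<phi> (\<phi> 0) (at 0 within {0..})" using z by (intro \<phi>_cont) auto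
  then have "((\<lambda>t. \<phi> t z) \<longlongrightarrow> \<phi> 0 z) (at 0 within {0..})" by (rule tendsto_uniform_limitI) simp
  then have "((\<lambda>t. \<phi> t z) \<longlongrightarrow> z) (at_right 0)"
    using \<phi>_0[OF z(1)] by (auto intro: tendsto_within_subset)
  moreover have "isCont chart z" using chart_has_deriv[OF z(1)] by (rule DERIV_isCont)
  ultimately have "((\<lambda>t. chart (\<phi> t z)) \<longlongrightarrow> chart z) (at_right 0)"
    by (rule isCont_tendsto_compose[rotated])
  then have lim: "((\<lambda>t. conj_flow t w) \<longlongrightarrow> w) (at_right 0)"
    by (simp add: conj_flow_def z_def[symmetric] z(2))
  have pos: "\<forall>\<^sub>F t in at_right 0. 0 < (t::real)" by (rule eventually_at_right_less)
  have ne: "conj_flow t w \<noteq> w" if "0 < t" for t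
    using lin_conj_flow[of t w] that w by auto
  \<comment> \<open>The orbit never returns to \<open>w\<close>, so it can be inserted into the
    difference quotient of \<open>lin\<close>, whose numerator becomes t. This avoids
    differentiating the semigroup in t.\<close>
  have fl: "filterlim (\<lambda>t. conj_flow t w) (at w) (at_right 0)"
    unfolding filterlim_at using lim pos ne by (auto elim: eventually_mono)
  have "(lin has_field_derivative deriv lin w) (at w)"
    by (rule holomorphic_derivI[OF lin_holo open_rhp w])
  then have "((\<lambda>v. (lin v - lin w) / (v - w)) \<longlongrightarrow> deriv lin w) (at w)"
    by (simp add: has_field_derivative_iff)
  from tendsto_Re[OF filterlim_compose[OF this fl]]
  have "((\<lambda>t. Re ((lin (conj_flow t w) - lin w) / (conj_flow t w - w))) \<longlongrightarrow> Re (deriv lin w)) (at_right 0)" .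
  moreover have "\<forall>\<^sub>F t in at_right 0. 0 \<le> Re ((lin (conj_flow t w) - lin w) / (conj_flow t w - w))"
    using pos
  proof eventually_elim
    case (elim t)
    have "lin (conj_flow t w) - lin w = of_real t" using lin_conj_flow[of t w] elim w by simp
    moreover have "0 \<le> Re (conj_flow t w - w)" using Re_conj_flow[OF elim w] by simp
    ultimately show ?case using elim by (simp add: Re_divide)
  qed
  ultimately show ?thesis by (rule tendsto_lowerbound) simp
qed

sublocale half_plane_linearizer lin
proof
  show "lin holomorphic_on rhp" by (rule lin_holo)
  show "inj_on lin rhp"
  proof (rule inj_onI)
    fix v w assume vw: "v \<in> rhp" "w \<in> rhp" "lin v = lin w"
    then have "h (chart_inv v) = h (chart_inv w)" by (simp add: lin_def)
    then have "chart_inv v = chart_inv w"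
      using vw chart_chart_inv(2) by (auto dest: inj_onD[OF h_inj])
    then show "v = w" using vw chart_chart_inv(1) by metis
  qed
  show "0 \<le> Re (deriv lin w)" if "w \<in> rhp" for w using that by (rule Re_deriv_lin_nonneg)
  show "lin w + of_real t \<in> lin ` rhp" if "w \<in> rhp" "0 \<le> t" for w t
    using lin_conj_flow[OF that(2,1)] conj_flow_rhp[OF that(2,1)] by (metis imageI)
qed

lemma chart_\<phi>:
  assumes "0 \<le> t" "z \<in> unit_disc"
  shows "chart (\<phi> t z) = flow t (chart z)"
proof -
  note w = chart_rhp[OF assms(2)]
  have "flow t (chart z) = conj_flow t (chart z)"
    by (rule flow_eqI[OF conj_flow_rhp[OF assms(1) w] lin_conj_flow[OF assms(1) w]])
  then show ?thesis by (simp add: conj_flow_def chart_inv_chart[OF assms(2)])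
qed

text \<open>The radial difference quotient of \<open>\<phi> 1\<close> at \<sigma> tends to
  \<open>exp (- \<nu>)\<close>. In the chart it becomes the ratio of \<open>flow 1\<close> to the
  identity, up to a factor tending to 1, and \<open>mass_from_multiplier\<close> turns its limit
  into the mass.\<close>

lemma repelling_imp_mass:
  assumes "repelling_spectral_value \<phi> \<sigma> \<nu>"
  shows "mass = - 1 / \<nu>" "0 < mass"
proof -
  have \<nu>: "\<nu> < 0" and 1: "angular_lim (\<phi> 1) \<sigma> \<sigma>" "angular_lim (deriv (\<phi> 1)) \<sigma> (of_real (exp (- \<nu> * 1)))"
    using assms unfolding repelling_spectral_value_def by (auto dest: spec[of _ 1])
  define \<alpha> where "\<alpha> = exp (- \<nu>)"
  have L: "(\<phi> 1 \<longlongrightarrow> \<sigma>) (at \<sigma> within stolz \<sigma> 2)" "(deriv (\<phi> 1) \<longlongrightarrow> of_real \<alpha>) (at \<sigma> within stolz \<sigma> 2)"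
    using 1 by (auto simp: angular_lim_def \<alpha>_def)
  let ?z = "\<lambda>r. of_real r * \<sigma>"
  have rad: "filterlim ?z (at \<sigma> within stolz \<sigma> 2) (at_left 1)"
    using filterlim_radial_stolz[OF \<sigma>] by simp
  have zd: "\<forall>\<^sub>F r in at_left 1. ?z r \<in> unit_disc"
  proof (rule eventually_mono)
    show "\<forall>\<^sub>F r in at_left 1. ?z r \<in> stolz \<sigma> 2" using rad by (simp add: filterlim_at eventually_conj_iff)
  qed (use stolz_subset in blast)
  have "((\<lambda>r. (\<phi> 1 (?z r) - \<sigma>) / (?z r - \<sigma>)) \<longlongrightarrow> of_real \<alpha>) (at_left 1)"
    using radial_difference_quotient[OF \<sigma> \<phi>_holo L] by simp
  moreover have "((\<lambda>r. (\<tau> - ?z r) / (\<tau> - \<phi> 1 (?z r))) \<longlongrightarrow> (\<tau> - \<sigma>) / (\<tau> - \<sigma>)) (at_left 1)"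
  proof -
    have "((\<lambda>r. \<phi> 1 (?z r)) \<longlongrightarrow> \<sigma>) (at_left 1)" by (rule filterlim_compose[OF L(1) rad])
    moreover have "(?z \<longlongrightarrow> \<sigma>) (at_left 1)" using rad by (simp add: filterlim_at)
    ultimately show ?thesis using neq by (intro tendsto_intros) auto
  qed
  ultimately have "((\<lambda>r. (\<phi> 1 (?z r) - \<sigma>) / (?z r - \<sigma>) * ((\<tau> - ?z r) / (\<tau> - \<phi> 1 (?z r)))) \<longlongrightarrow>
      of_real \<alpha> * ((\<tau> - \<sigma>) / (\<tau> - \<sigma>))) (at_left 1)"
    by (rule tendsto_mult)
  moreover have "\<forall>\<^sub>F r in at_left 1. (\<phi> 1 (?z r) - \<sigma>) / (?z r - \<sigma>) * ((\<tau> - ?z r) / (\<tau> - \<phi> 1 (?z r))) =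
      flow 1 (chart (?z r)) / chart (?z r)"
    using zd
  proof eventually_elim
    case (elim r)
    define z where "z = ?z r"
    have z: "z \<in> unit_disc" using elim by (simp add: z_def)
    define p where "p = \<phi> 1 z"
    have p: "p \<in> unit_disc" using \<phi>_disc[of 1 z] z by (simp add: p_def)
    have nz: "\<sigma> - z \<noteq> 0" "\<tau> - z \<noteq> 0" "\<tau> - p \<noteq> 0" using z p \<sigma> \<tau> by auto
    have b: "(\<tau> - \<sigma>) * cnj \<sigma> \<noteq> 0" using neq \<sigma> by auto
    have "chart p / chart z = ((\<tau> - \<sigma>) * cnj \<sigma> * ((\<sigma> - p) / (\<tau> - p))) / ((\<tau> - \<sigma>) * cnj \<sigma> * ((\<sigma> - z) / (\<tau> - z)))"
      unfolding chart_def one_minus by (simp add: mult.assoc)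
    also have "\<dots> = ((\<sigma> - p) / (\<tau> - p)) / ((\<sigma> - z) / (\<tau> - z))"
      using b by (rule nonzero_mult_divide_mult_cancel_left)
    also have "\<dots> = (\<sigma> - p) / (\<sigma> - z) * ((\<tau> - z) / (\<tau> - p))" using nz by simp
    also have "(\<sigma> - p) / (\<sigma> - z) = (p - \<sigma>) / (z - \<sigma>)"
      using minus_divide_divide[of "\<sigma> - p" "\<sigma> - z"] by simp
    finally have "(p - \<sigma>) / (z - \<sigma>) * ((\<tau> - z) / (\<tau> - p)) = flow 1 (chart z) / chart z"
      using chart_\<phi>[of 1 z] z by (simp add: p_def)
    then have "(\<phi> 1 z - \<sigma>) / (z - \<sigma>) * ((\<tau> - z) / (\<tau> - \<phi> 1 z)) = flow 1 (chart z) / chart z"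
      by (simp only: p_def)
    then show ?case by (simp add: z_def)
  qed
  ultimately have "((\<lambda>r. flow 1 (chart (?z r)) / chart (?z r)) \<longlongrightarrow> of_real \<alpha> * ((\<tau> - \<sigma>) / (\<tau> - \<sigma>))) (at_left 1)"
    by (rule Lim_transform_eventually)
  then have ratio: "((\<lambda>r. flow 1 (chart (?z r)) / chart (?z r)) \<longlongrightarrow> of_real \<alpha>) (at_left 1)"
    using neq by simp
  have "filterlim (\<lambda>r. chart (?z r)) (at 0 within sector (cmod (\<tau> - \<sigma>) / (4 * 2))) (at_left 1)"
    by (rule filterlim_compose[OF filterlim_chart_stolz rad]) simp
  then have "1 = mass * ln \<alpha>"
    by (rule mass_from_multiplier[OF _ _ _ _ _ ratio]) (use dist_pos in \<open>auto simp: \<alpha>_def\<close>)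
  then have "1 = mass * (- \<nu>)" by (simp add: \<alpha>_def)
  then show "mass = - 1 / \<nu>" using \<nu> by (simp add: field_simps)
  then show "0 < mass" using \<nu> by (simp add: divide_neg_neg)
qed

lemma \<phi>_stolz_tendsto:
  assumes m: "0 < mass" and t: "0 \<le> t" and R: "1 < R"
  shows "(\<phi> t \<longlongrightarrow> \<sigma>) (at \<sigma> within stolz \<sigma> R)"
proof -
  define k where "k = cmod (\<tau> - \<sigma>) / (4 * R)"
  have k: "0 < k" using R dist_pos by (simp add: k_def)
  have "filterlim (\<lambda>z. flow t (chart z)) (at 0 within sector (k / 2)) (at \<sigma> within stolz \<sigma> R)"
    by (rule filterlim_compose[OF flow_sector[OF m t k] filterlim_chart_stolz[OF R, folded k_def]])
  then have "((\<lambda>z. chart_inv (flow t (chart z))) \<longlongrightarrow> \<sigma>) (at \<sigma> within stolz \<sigma> R)"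
    by (rule filterlim_compose[OF chart_inv_tendsto])
  moreover have "\<forall>\<^sub>F z in at \<sigma> within stolz \<sigma> R. chart_inv (flow t (chart z)) = \<phi> t z"
    using eventually_in_at_within[of "stolz \<sigma> R" \<sigma>]
  proof eventually_elim
    case (elim z)
    then have z: "z \<in> unit_disc" using stolz_subset by blast
    then show ?case using chart_\<phi>[OF t z] chart_inv_chart[OF \<phi>_disc[OF t z]] by simp
  qed
  ultimately show ?thesis by (rule Lim_transform_eventually)
qed

text \<open>Chain rule for \<open>lin (chart (\<phi> t z)) = lin (chart z) + t\<close>. Of the chart
  derivatives only the squared ratio survives, and it tends to 1 at \<sigma>.\<close>

lemma deriv_\<phi>:
  assumes t: "0 \<le> t" and z: "z \<in> unit_disc"
  shows "deriv (\<phi> t) z = deriv lin (chart z) / deriv lin (flow t (chart z)) * ((\<tau> - \<phi> t z) / (\<tau> - z))\<^sup>2"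
proof -
  define c where "c = - ((\<tau> - \<sigma>)\<^sup>2 * cnj \<sigma>)"
  have c: "c \<noteq> 0" using neq \<sigma> by (auto simp: c_def)
  have pz: "\<phi> t z \<in> unit_disc" using \<phi>_disc t z by blast
  have nz: "\<tau> - z \<noteq> 0" "\<tau> - \<phi> t z \<noteq> 0" using z pz \<tau> by auto
  have d0: "(chart has_field_derivative c / (\<tau> - v)\<^sup>2) (at v)" if "v \<in> unit_disc" for v
    using chart_has_deriv[OF that] by (simp add: c_def)
  have L: "(lin has_field_derivative deriv lin v) (at v)" if "v \<in> rhp" for v
    by (rule holomorphic_derivI[OF lin_holo open_rhp that])
  have D\<phi>: "(\<phi> t has_field_derivative deriv (\<phi> t) z) (at z)"
    by (rule holomorphic_derivI[OF \<phi>_holo[OF t] open_ball z])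
  have "((\<lambda>z. lin (chart (\<phi> t z))) has_field_derivative
      deriv lin (chart (\<phi> t z)) * (c / (\<tau> - \<phi> t z)\<^sup>2 * deriv (\<phi> t) z)) (at z)"
    by (rule DERIV_chain2[OF L[OF chart_rhp[OF pz]] DERIV_chain2[OF d0[OF pz] D\<phi>]])
  moreover have "((\<lambda>z. lin (chart z) + of_real t) has_field_derivative
      deriv lin (chart z) * (c / (\<tau> - z)\<^sup>2) + 0) (at z)"
    by (rule DERIV_add[OF DERIV_chain2[OF L[OF chart_rhp[OF z]] d0[OF z]] DERIV_const])
  then have "((\<lambda>z. lin (chart (\<phi> t z))) has_field_derivative
      deriv lin (chart z) * (c / (\<tau> - z)\<^sup>2) + 0) (at z)"
  proof (rule has_field_derivative_transform_within_open[OF _ open_ball z])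
    fix v assume "v \<in> unit_disc"
    then show "lin (chart v) + of_real t = lin (chart (\<phi> t v))"
      using t h_\<phi>[of t v] \<phi>_disc[of t v] by (simp add: lin_chart algebra_simps)
  qed
  ultimately have eq: "deriv lin (chart (\<phi> t z)) * (c / (\<tau> - \<phi> t z)\<^sup>2 * deriv (\<phi> t) z) =
      deriv lin (chart z) * (c / (\<tau> - z)\<^sup>2)"
    using DERIV_unique by fastforce
  have "deriv lin (chart (\<phi> t z)) \<noteq> 0"
    using holomorphic_injective_imp_regular[OF lin_holo open_rhp inj chart_rhp[OF pz]] .
  then show ?thesis
    using eq c nz unfolding chart_\<phi>[OF t z] by (simp add: field_simps power_divide)
qed

lemma mass_imp_repelling:
  assumes m: "0 < mass"
  shows "repelling_spectral_value \<phi> \<sigma> (- 1 / mass)"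
  unfolding repelling_spectral_value_def angular_lim_def
proof (intro conjI allI impI)
  show "- 1 / mass < 0" using m by simp
  fix t R :: real assume t: "0 \<le> t" and R: "1 < R"
  show lim: "(\<phi> t \<longlongrightarrow> \<sigma>) (at \<sigma> within stolz \<sigma> R)" by (rule \<phi>_stolz_tendsto[OF m t R])
  define k where "k = cmod (\<tau> - \<sigma>) / (4 * R)"
  have k: "0 < k" using R dist_pos by (simp add: k_def)
  have "((\<lambda>z. deriv lin (chart z) / deriv lin (flow t (chart z))) \<longlongrightarrow> of_real (exp (t / mass)))
      (at \<sigma> within stolz \<sigma> R)"
    by (rule filterlim_compose[OF deriv_quotient_flow[OF m t k] filterlim_chart_stolz[OF R, folded k_def]])
  moreover have "((\<lambda>z. ((\<tau> - \<phi> t z) / (\<tau> - z))\<^sup>2) \<longlongrightarrow> ((\<tau> - \<sigma>) / (\<tau> - \<sigma>))\<^sup>2) (at \<sigma> within stolz \<sigma> R)"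
    using neq by (intro tendsto_intros lim) auto
  ultimately have "((\<lambda>z. deriv lin (chart z) / deriv lin (flow t (chart z)) * ((\<tau> - \<phi> t z) / (\<tau> - z))\<^sup>2) \<longlongrightarrow>
      of_real (exp (t / mass)) * ((\<tau> - \<sigma>) / (\<tau> - \<sigma>))\<^sup>2) (at \<sigma> within stolz \<sigma> R)"
    by (rule tendsto_mult)
  moreover have "\<forall>\<^sub>F z in at \<sigma> within stolz \<sigma> R.
      deriv lin (chart z) / deriv lin (flow t (chart z)) * ((\<tau> - \<phi> t z) / (\<tau> - z))\<^sup>2 = deriv (\<phi> t) z"
    using eventually_in_at_within[of "stolz \<sigma> R" \<sigma>]
  proof eventually_elim
    case (elim z)
    then have "z \<in> unit_disc" using stolz_subset by blast
    then show ?case by (simp only: deriv_\<phi>[OF t])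
  qed
  ultimately have "(deriv (\<phi> t) \<longlongrightarrow> of_real (exp (t / mass)) * ((\<tau> - \<sigma>) / (\<tau> - \<sigma>))\<^sup>2) (at \<sigma> within stolz \<sigma> R)"
    by (rule Lim_transform_eventually)
  then show "(deriv (\<phi> t) \<longlongrightarrow> of_real (exp (- (- 1 / mass) * t))) (at \<sigma> within stolz \<sigma> R)"
    using neq by simp
qed

end

subsection \<open>Limit values at the boundary point\<close>

lemma Liminf_le_along:
  fixes X :: "'a \<Rightarrow> ereal"
  assumes z: "filterlim z F G" "G \<noteq> bot" and l: "((\<lambda>x. X (z x)) \<longlongrightarrow> l) G"
  shows "Liminf F X \<le> l"
proof (rule ccontr)
  assume "\<not> ?thesis"
  then obtain y where y: "l < y" "y < Liminf F X" using dense[of l "Liminf F X"] by (auto simp: not_le)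
  have "\<forall>\<^sub>F x in G. y < X (z x)" by (rule eventually_compose_filterlim[OF less_LiminfD[OF y(2)] z(1)])
  moreover have "\<forall>\<^sub>F x in G. X (z x) < y" using l y(1) by (rule order_tendstoD)
  ultimately have "\<forall>\<^sub>F x in G. False" by eventually_elim simp
  then show False using z(2) by simp
qed

lemma le_Limsup_along:
  fixes X :: "'a \<Rightarrow> ereal"
  assumes z: "filterlim z F G" "G \<noteq> bot" and l: "((\<lambda>x. X (z x)) \<longlongrightarrow> l) G"
  shows "l \<le> Limsup F X"
proof (rule ccontr)
  assume "\<not> ?thesis"
  then obtain y where y: "y < l" "Limsup F X < y" using dense[of "Limsup F X" l] by (auto simp: not_le)
  have "\<forall>\<^sub>F x in G. X (z x) < y" by (rule eventually_compose_filterlim[OF Limsup_lessD[OF y(2)] z(1)])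
  moreover have "\<forall>\<^sub>F x in G. y < X (z x)" using l y(1) by (rule order_tendstoD)
  ultimately have "\<forall>\<^sub>F x in G. False" by eventually_elim simp
  then show False using z(2) by simp
qed

text \<open>\<open>nontangential_seq\<close> asks for all terms to lie in one Stolz region, so an
  initial segment has to be dropped.\<close>

lemma nontangential_seqI:
  assumes "filterlim z (at \<sigma> within stolz \<sigma> R) sequentially" "1 < R"
  obtains N where "nontangential_seq (\<lambda>n. z (n + N)) \<sigma>"
proof -
  have lim: "z \<longlonglongrightarrow> \<sigma>" and ev: "\<forall>\<^sub>F n in sequentially. z n \<in> stolz \<sigma> R"
    using assms(1) by (auto simp: filterlim_at eventually_conj_iff)
  then obtain N where "\<And>n. N \<le> n \<Longrightarrow> z n \<in> stolz \<sigma> R" by (auto simp: eventually_sequentially)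
  then have "nontangential_seq (\<lambda>n. z (n + N)) \<sigma>"
    unfolding nontangential_seq_def using LIMSEQ_ignore_initial_segment[OF lim] assms(2) by auto
  then show ?thesis by (rule that)
qed

lemma nontangential_seq_filterlim:
  assumes "nontangential_seq z \<sigma>" "cmod \<sigma> = 1"
  shows "filterlim z (at \<sigma> within unit_disc) sequentially"
proof (rule filterlim_at_withinI)
  show "z \<longlonglongrightarrow> \<sigma>" using assms(1) by (simp add: nontangential_seq_def)
  obtain R where "\<And>n. z n \<in> stolz \<sigma> R" using assms(1) unfolding nontangential_seq_def by blast
  then have "z n \<in> unit_disc" for n using stolz_subset by blast
  then show "\<forall>\<^sub>F n in sequentially. z n \<in> unit_disc" by simp
  show "\<sigma> \<notin> unit_disc" using assms(2) by simp
qed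

lemma angular_limit_values_between:
  assumes "cmod \<sigma> = 1" "l \<in> angular_limit_values u \<sigma>"
  shows "Liminf (at \<sigma> within unit_disc) (\<lambda>z. ereal (u z)) \<le> l"
    and "l \<le> Limsup (at \<sigma> within unit_disc) (\<lambda>z. ereal (u z))"
proof -
  obtain z where z: "nontangential_seq z \<sigma>" "(\<lambda>n. ereal (u (z n))) \<longlonglongrightarrow> l"
    using assms(2) by (auto simp: angular_limit_values_def)
  note lim = nontangential_seq_filterlim[OF z(1) assms(1)]
  show "Liminf (at \<sigma> within unit_disc) (\<lambda>z. ereal (u z)) \<le> l"
    by (rule Liminf_le_along[OF lim _ z(2)]) simp
  show "l \<le> Limsup (at \<sigma> within unit_disc) (\<lambda>z. ereal (u z))"
    by (rule le_Limsup_along[OF lim _ z(2)]) simp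
qed

text \<open>A radial sequence has a subsequence converging in the compact extended reals. For an
  empty set \<open>Inf\<close> would be \<infinity> and \<open>Sup\<close> -\<infinity>, reversing
  the order of the angular limits.\<close>

lemma angular_limit_values_nonempty:
  assumes "cmod \<sigma> = 1"
  shows "angular_limit_values u \<sigma> \<noteq> {}"
proof -
  have left: "filterlim (\<lambda>n. 1 - inverse (real (Suc n))) (at_left 1) sequentially"
    unfolding filterlim_at
  proof
    have "(\<lambda>n. 1 - inverse (real (Suc n))) \<longlonglongrightarrow> 1 - 0"
      by (intro tendsto_intros LIMSEQ_inverse_real_of_nat)
    then show "(\<lambda>n. 1 - inverse (real (Suc n))) \<longlonglongrightarrow> 1" by simp
  qed (auto intro!: always_eventually)
  have "filterlim (\<lambda>n. of_real (1 - inverse (real (Suc n))) * \<sigma>) (at \<sigma> within stolz \<sigma> 2) sequentially"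
    by (rule filterlim_compose[OF filterlim_radial_stolz[OF assms] left]) simp
  then obtain N where "nontangential_seq (\<lambda>n. of_real (1 - inverse (real (Suc (n + N)))) * \<sigma>) \<sigma>"
    by (rule nontangential_seqI) simp
  then obtain z where z: "nontangential_seq z \<sigma>" by blast
  obtain l r where r: "strict_mono r" "((\<lambda>n. ereal (u (z n))) \<circ> r) \<longlonglongrightarrow> l"
    using compact_complete_linorder[of "\<lambda>n. ereal (u (z n))"] by blast
  have "nontangential_seq (z \<circ> r) \<sigma>"
    using z LIMSEQ_subseq_LIMSEQ[OF _ r(1), of z \<sigma>] by (auto simp: nontangential_seq_def)
  then have "l \<in> angular_limit_values u \<sigma>"
    using r(2) by (auto simp: angular_limit_values_def o_def)
  then show ?thesis by blast
qed

lemma Liminf_le_angular_liminf: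
  assumes "cmod \<sigma> = 1"
  shows "Liminf (at \<sigma> within unit_disc) (\<lambda>z. ereal (u z)) \<le> angular_liminf u \<sigma>"
  unfolding angular_liminf_def by (intro Inf_greatest angular_limit_values_between(1) assms)

lemma angular_limsup_le_Limsup:
  assumes "cmod \<sigma> = 1"
  shows "angular_limsup u \<sigma> \<le> Limsup (at \<sigma> within unit_disc) (\<lambda>z. ereal (u z))"
  unfolding angular_limsup_def by (intro Sup_least angular_limit_values_between(2) assms)

lemma angular_liminf_le_angular_limsup:
  assumes "cmod \<sigma> = 1"
  shows "angular_liminf u \<sigma> \<le> angular_limsup u \<sigma>"
proof -
  obtain l where "l \<in> angular_limit_values u \<sigma>"
    using angular_limit_values_nonempty[OF assms] by blast
  then have "angular_liminf u \<sigma> \<le> l" "l \<le> angular_limsup u \<sigma>"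
    unfolding angular_liminf_def angular_limsup_def by (auto intro: Inf_lower Sup_upper)
  then show ?thesis by (rule order_trans)
qed

context semigroup_chart
begin

lemma Im_h_at_bot_iff:
  "filterlim (\<lambda>z. Im (h z)) at_bot (at \<sigma> within unit_disc) \<longleftrightarrow>
   filterlim (\<lambda>w. Re (lin w)) at_bot (at 0 within rhp)"
proof
  assume "filterlim (\<lambda>z. Im (h z)) at_bot (at \<sigma> within unit_disc)"
  from filterlim_compose[OF this filterlim_chart_inv]
  show "filterlim (\<lambda>w. Re (lin w)) at_bot (at 0 within rhp)" by (simp add: lin_def)
next
  assume "filterlim (\<lambda>w. Re (lin w)) at_bot (at 0 within rhp)"
  then have "filterlim (\<lambda>z. Re (lin (chart z))) at_bot (at \<sigma> within unit_disc)"
    by (rule filterlim_compose[OF _ filterlim_chart])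
  moreover have "\<forall>\<^sub>F z in at \<sigma> within unit_disc. Re (lin (chart z)) = Im (h z)"
    using eventually_in_at_within[of unit_disc \<sigma>] by eventually_elim (simp add: h_eq_lin)
  ultimately show "filterlim (\<lambda>z. Im (h z)) at_bot (at \<sigma> within unit_disc)"
    by (subst (asm) filterlim_cong[OF refl refl]) auto
qed

lemma at_\<sigma>_neq_bot: "at \<sigma> within unit_disc \<noteq> bot"
proof
  assume "at \<sigma> within unit_disc = bot"
  then have "\<forall>\<^sub>F z in at \<sigma> within unit_disc. False" by simp
  from eventually_compose_filterlim[OF this filterlim_chart_inv]
  show False using at_0_rhp_neq_bot by simp
qed

lemma Re_h_oscillation:
  assumes lim: "filterlim (\<lambda>z. Im (h z)) at_bot (at \<sigma> within unit_disc)"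
    and freq: "\<exists>\<^sub>F z in at \<sigma> within unit_disc. Re (h z) \<le> A"
      "\<exists>\<^sub>F z in at \<sigma> within unit_disc. B \<le> Re (h z)"
  shows "B - A \<le> pi * mass"
proof -
  note disc = eventually_in_at_within[of unit_disc \<sigma>]
  have "\<exists>\<^sub>F z in at \<sigma> within unit_disc. - A \<le> Im (lin (chart z))"
    using frequently_eventually_conj[OF freq(1) disc] by (rule frequently_elim1) (auto simp: h_eq_lin)
  then have "\<exists>\<^sub>F w in at 0 within rhp. - A \<le> Im (lin w)"
    by (rule frequently_filterlim[OF filterlim_chart])
  moreover have "\<exists>\<^sub>F z in at \<sigma> within unit_disc. Im (lin (chart z)) \<le> - B"
    using frequently_eventually_conj[OF freq(2) disc] by (rule frequently_elim1) (auto simp: h_eq_lin)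
  then have "\<exists>\<^sub>F w in at 0 within rhp. Im (lin w) \<le> - B"
    by (rule frequently_filterlim[OF filterlim_chart])
  ultimately have "- A - (- B) \<le> pi * mass"
    using lim unfolding Im_h_at_bot_iff by (intro oscillation_le)
  then show ?thesis by simp
qed

abbreviation "Re_h_Liminf \<equiv> Liminf (at \<sigma> within unit_disc) (\<lambda>z. ereal (Re (h z)))"
abbreviation "Re_h_Limsup \<equiv> Limsup (at \<sigma> within unit_disc) (\<lambda>z. ereal (Re (h z)))"

text \<open>Two levels A < B strictly between the lower and the upper limit are both crossed
  frequently, so \<open>pi * mass\<close> is at least \<open>B - A\<close>.\<close>

lemma oscillation_imp_mass:
  assumes lim: "filterlim (\<lambda>z. Im (h z)) at_bot (at \<sigma> within unit_disc)"
    and ne: "Re_h_Liminf \<noteq> Re_h_Limsup"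
  shows "0 < mass"
proof -
  have "Re_h_Liminf < Re_h_Limsup"
    using Liminf_le_Limsup[OF at_\<sigma>_neq_bot] ne by (simp add: less_le)
  then obtain B where B: "Re_h_Liminf < ereal B" "ereal B < Re_h_Limsup" using ereal_dense2 by blast
  obtain A where A: "Re_h_Liminf < ereal A" "ereal A < ereal B" using ereal_dense2[OF B(1)] by blast
  have "\<exists>\<^sub>F z in at \<sigma> within unit_disc. Re (h z) \<le> A"
  proof (rule ccontr)
    assume "\<not> ?thesis"
    then have "\<forall>\<^sub>F z in at \<sigma> within unit_disc. ereal A \<le> ereal (Re (h z))"
      unfolding not_frequently by (rule eventually_mono) simp
    then have "ereal A \<le> Re_h_Liminf" by (rule Liminf_bounded)
    then show False using A(1) by simp
  qed
  moreover have "\<exists>\<^sub>F z in at \<sigma> within unit_disc. B \<le> Re (h z)"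
  proof (rule ccontr)
    assume "\<not> ?thesis"
    then have "\<forall>\<^sub>F z in at \<sigma> within unit_disc. ereal (Re (h z)) \<le> ereal B"
      unfolding not_frequently by (rule eventually_mono) simp
    then have "Re_h_Limsup \<le> ereal B" by (rule Limsup_bounded)
    then show False using B(2) by simp
  qed
  ultimately have "B - A \<le> pi * mass" by (rule Re_h_oscillation[OF lim])
  then have "0 < pi * mass" using A(2) by simp
  then show ?thesis by (simp add: zero_less_mult_iff)
qed

text \<open>\<open>Re h\<close> is minus the imaginary part of \<open>lin\<close>, hence the sign of
  the slope. One constant serves all sectors and all sequences.\<close>

lemma Re_h_sector_limit:
  assumes m: "0 < mass"
  obtains a where "\<And>k (w :: nat \<Rightarrow> complex) \<beta>. 0 < k \<Longrightarrow> filterlim w (at 0 within sector k) sequentially \<Longrightarrow>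
    (\<lambda>n. Arg (w n)) \<longlonglongrightarrow> \<beta> \<Longrightarrow> (\<lambda>n. Re (h (chart_inv (w n)))) \<longlonglongrightarrow> a - mass * \<beta>"
proof -
  obtain a where a: "\<And>k. 0 < k \<Longrightarrow> ((\<lambda>w. Im (lin w) - mass * Arg w) \<longlongrightarrow> a) (at 0 within sector k)"
    using Im_f_sector_limit[OF m] by blast
  show ?thesis
  proof (rule that[of "- a"])
    fix k \<beta> and w :: "nat \<Rightarrow> complex"
    assume k: "0 < k" and w: "filterlim w (at 0 within sector k) sequentially"
      and \<beta>: "(\<lambda>n. Arg (w n)) \<longlonglongrightarrow> \<beta>"
    have "(\<lambda>n. - (Im (lin (w n)) - mass * Arg (w n)) - mass * Arg (w n)) \<longlonglongrightarrow> - a - mass * \<beta>"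
      by (intro tendsto_intros filterlim_compose[OF a[OF k] w] \<beta>)
    then show "(\<lambda>n. Re (h (chart_inv (w n)))) \<longlonglongrightarrow> - a - mass * \<beta>" by (simp add: lin_def)
  qed
qed

text \<open>Each ray of the half plane is carried by \<open>chart_inv\<close> to a nontangential
  path at \<sigma>, along which \<open>Re h\<close> converges.\<close>

lemma angular_value_of_angle:
  assumes m: "0 < mass"
  obtains a where "\<And>\<theta>. \<bar>\<theta>\<bar> < pi / 2 \<Longrightarrow> ereal (a - mass * \<theta>) \<in> angular_limit_values (\<lambda>z. Re (h z)) \<sigma>"
proof -
  obtain a where a: "\<And>k (w :: nat \<Rightarrow> complex) \<beta>. 0 < k \<Longrightarrow> filterlim w (at 0 within sector k) sequentially \<Longrightarrow>
    (\<lambda>n. Arg (w n)) \<longlonglongrightarrow> \<beta> \<Longrightarrow> (\<lambda>n. Re (h (chart_inv (w n)))) \<longlonglongrightarrow> a - mass * \<beta>"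
    using Re_h_sector_limit[OF m] by blast
  show ?thesis
  proof (rule that[of a])
    fix \<theta> :: real assume \<theta>: "\<bar>\<theta>\<bar> < pi / 2"
    define k where "k = cos \<theta>"
    have k: "0 < k" unfolding k_def using \<theta> by (intro cos_gt_zero_pi) auto
    define w where "w n = rcis (inverse (real (Suc n))) \<theta>" for n
    have w: "filterlim w (at 0 within sector k) sequentially"
    proof (rule filterlim_at_withinI)
      have "(\<lambda>n. of_real (inverse (real (Suc n))) * cis \<theta>) \<longlonglongrightarrow> of_real 0 * cis \<theta>"
        by (intro tendsto_intros LIMSEQ_inverse_real_of_nat)
      then show "w \<longlonglongrightarrow> 0" by (simp add: w_def[abs_def] rcis_def)
      show "\<forall>\<^sub>F n in sequentially. w n \<in> sector k"
        unfolding w_def k_def by (intro always_eventually allI sector_polar) auto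
    qed (simp add: sector_def)
    have "Arg (w n) = \<theta>" for n
      unfolding w_def using \<theta> by (intro Arg_rcis) auto
    then have lim: "(\<lambda>n. Re (h (chart_inv (w n)))) \<longlonglongrightarrow> a - mass * \<theta>"
      by (intro a[OF k w]) simp
    have "filterlim (\<lambda>n. chart_inv (w n)) (at \<sigma> within stolz \<sigma> (2 / k + 2)) sequentially"
      by (rule filterlim_compose[OF filterlim_chart_inv_sector[OF k] w])
    moreover have "1 < 2 / k + 2" using k by (simp add: add_pos_pos)
    ultimately obtain N where N: "nontangential_seq (\<lambda>n. chart_inv (w (n + N))) \<sigma>"
      by (rule nontangential_seqI)
    have "(\<lambda>n. ereal (Re (h (chart_inv (w (n + N)))))) \<longlonglongrightarrow> ereal (a - mass * \<theta>)"
      using LIMSEQ_ignore_initial_segment[OF lim, of N] by (intro tendsto_ereal)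
    with N show "ereal (a - mass * \<theta>) \<in> angular_limit_values (\<lambda>z. Re (h z)) \<sigma>"
      unfolding angular_limit_values_def by blast
  qed
qed

text \<open>Two different angles already give two different limit values, because the slope is
  nonzero.\<close>

lemma angular_liminf_less_limsup:
  assumes m: "0 < mass"
  shows "angular_liminf (\<lambda>z. Re (h z)) \<sigma> < angular_limsup (\<lambda>z. Re (h z)) \<sigma>"
proof -
  obtain a where a: "\<And>\<theta>. \<bar>\<theta>\<bar> < pi / 2 \<Longrightarrow> ereal (a - mass * \<theta>) \<in> angular_limit_values (\<lambda>z. Re (h z)) \<sigma>"
    using angular_value_of_angle[OF m] by blast
  have "angular_liminf (\<lambda>z. Re (h z)) \<sigma> \<le> ereal (a - mass * (pi / 4))"
    unfolding angular_liminf_def by (intro Inf_lower a) auto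
  also have "\<dots> < ereal (a - mass * 0)" using m by simp
  also have "\<dots> \<le> angular_limsup (\<lambda>z. Re (h z)) \<sigma>"
    unfolding angular_limsup_def by (intro Sup_upper a) auto
  finally show ?thesis .
qed

lemma Re_h_bounds:
  assumes m: "0 < mass"
  shows "- \<infinity> < Re_h_Liminf" "Re_h_Limsup < \<infinity>"
proof -
  obtain M where "\<forall>\<^sub>F w in at 0 within rhp. \<bar>Im (lin w)\<bar> \<le> M"
    using Im_f_bounded[OF Re_f_to_neg_infinity[OF m]] by blast
  then have "\<forall>\<^sub>F z in at \<sigma> within unit_disc. \<bar>Im (lin (chart z))\<bar> \<le> M"
    by (rule eventually_compose_filterlim[OF _ filterlim_chart])
  then have ev: "\<forall>\<^sub>F z in at \<sigma> within unit_disc. \<bar>Re (h z)\<bar> \<le> M"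
    using eventually_in_at_within[of unit_disc \<sigma>] by eventually_elim (simp add: h_eq_lin)
  have "ereal (- M) \<le> Re_h_Liminf"
    by (rule Liminf_bounded, rule eventually_mono[OF ev]) auto
  then show "- \<infinity> < Re_h_Liminf" by (rule less_le_trans[rotated]) simp
  have "Re_h_Limsup \<le> ereal M"
    by (rule Limsup_bounded, rule eventually_mono[OF ev]) auto
  then show "Re_h_Limsup < \<infinity>" by (rule le_less_trans) simp
qed

lemma Im_h_lim:
  assumes "0 < mass"
  shows "filterlim (\<lambda>z. Im (h z)) at_bot (at \<sigma> within unit_disc)"
  unfolding Im_h_at_bot_iff by (rule Re_f_to_neg_infinity[OF assms])

lemma repelling_iff_mass: "repelling_fixed_point \<phi> \<sigma> \<longleftrightarrow> 0 < mass"
  using repelling_imp_mass(2) mass_imp_repelling \<sigma> unfolding repelling_fixed_point_def by auto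

text \<open>Angular limit values lie between the unrestricted lower and upper limits. Distinct
  angular limits thus force distinct unrestricted ones, and conversely unrestricted bounds are
  inherited.\<close>

lemma angular_oscillation_iff_mass:
  "filterlim (\<lambda>z. Im (h z)) at_bot (at \<sigma> within unit_disc) \<and>
    - \<infinity> < angular_liminf (\<lambda>z. Re (h z)) \<sigma> \<and>
    angular_liminf (\<lambda>z. Re (h z)) \<sigma> \<noteq> angular_limsup (\<lambda>z. Re (h z)) \<sigma> \<and>
    angular_limsup (\<lambda>z. Re (h z)) \<sigma> < \<infinity> \<longleftrightarrow> 0 < mass" (is "?P \<longleftrightarrow> _")
proof
  assume P: ?P
  have "Re_h_Liminf \<noteq> Re_h_Limsup"
  proof
    assume "Re_h_Liminf = Re_h_Limsup"
    then have "angular_limsup (\<lambda>z. Re (h z)) \<sigma> \<le> angular_liminf (\<lambda>z. Re (h z)) \<sigma>"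
      using Liminf_le_angular_liminf[OF \<sigma>, of "\<lambda>z. Re (h z)"] angular_limsup_le_Limsup[OF \<sigma>, of "\<lambda>z. Re (h z)"] by simp
    with angular_liminf_le_angular_limsup[OF \<sigma>] have "angular_liminf (\<lambda>z. Re (h z)) \<sigma> = angular_limsup (\<lambda>z. Re (h z)) \<sigma>"
      by (rule antisym)
    then show False using P by simp
  qed
  then show "0 < mass" using P by (intro oscillation_imp_mass) auto
next
  assume m: "0 < mass"
  have "- \<infinity> < angular_liminf (\<lambda>z. Re (h z)) \<sigma>"
    using Re_h_bounds(1)[OF m] Liminf_le_angular_liminf[OF \<sigma>] by (rule less_le_trans)
  moreover have "angular_limsup (\<lambda>z. Re (h z)) \<sigma> < \<infinity>"
    using angular_limsup_le_Limsup[OF \<sigma>] Re_h_bounds(2)[OF m] by (rule le_less_trans)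
  ultimately show ?P using Im_h_lim[OF m] angular_liminf_less_limsup[OF m] by simp
qed

lemma oscillation_iff_mass:
  "filterlim (\<lambda>z. Im (h z)) at_bot (at \<sigma> within unit_disc) \<and>
    - \<infinity> < Re_h_Liminf \<and> Re_h_Liminf \<noteq> Re_h_Limsup \<and> Re_h_Limsup < \<infinity> \<longleftrightarrow> 0 < mass"
proof
  assume m: "0 < mass"
  have "Re_h_Liminf < Re_h_Limsup"
    using Liminf_le_angular_liminf[OF \<sigma>] angular_liminf_less_limsup[OF m] angular_limsup_le_Limsup[OF \<sigma>]
    by (meson le_less_trans less_le_trans)
  then show "filterlim (\<lambda>z. Im (h z)) at_bot (at \<sigma> within unit_disc) \<and>
      - \<infinity> < Re_h_Liminf \<and> Re_h_Liminf \<noteq> Re_h_Limsup \<and> Re_h_Limsup < \<infinity>"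
    using Im_h_lim[OF m] Re_h_bounds[OF m] by simp
qed (use oscillation_imp_mass in blast)

text \<open>\<open>chart z\<close> is \<open>1 - cnj \<sigma> * z\<close> times a factor tending to
  1, and eventually the two arguments are too small to wrap around. The arguments only tend to
  \<beta>, so the halved cosine leaves the necessary margin.\<close>

lemma chart_sector_of_Arg:
  assumes z: "\<And>n. z n \<in> unit_disc" "z \<longlonglongrightarrow> \<sigma>" and \<beta>: "\<bar>\<beta>\<bar> < pi / 2"
    and Arg: "(\<lambda>n. Arg (1 - cnj \<sigma> * z n)) \<longlonglongrightarrow> \<beta>"
  shows "(\<lambda>n. Arg (chart (z n))) \<longlonglongrightarrow> \<beta>"
    and "filterlim (\<lambda>n. chart (z n)) (at 0 within sector (cos \<beta> / 2)) sequentially"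
proof -
  define v where "v n = (\<tau> - \<sigma>) / (\<tau> - z n)" for n
  have nz: "\<tau> - z n \<noteq> 0" "1 - cnj \<sigma> * z n \<noteq> 0" for n
    using z(1)[of n] \<sigma> \<tau> unfolding one_minus by auto
  have "v \<longlonglongrightarrow> (\<tau> - \<sigma>) / (\<tau> - \<sigma>)"
    unfolding v_def using neq by (intro tendsto_intros z(2)) auto
  then have "v \<longlonglongrightarrow> 1" using neq by simp
  then have v: "(\<lambda>n. Arg (v n)) \<longlonglongrightarrow> 0"
    using tendsto_Arg[of v 1] by simp
  have "\<forall>\<^sub>F n in sequentially. \<bar>Arg (v n)\<bar> < pi / 2"
    using order_tendstoD(2)[OF tendsto_rabs[OF v], of "pi / 2"] by simp
  moreover have "\<forall>\<^sub>F n in sequentially. \<bar>Arg (1 - cnj \<sigma> * z n)\<bar> < pi / 2"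
    using tendsto_rabs[OF Arg] \<beta> by (rule order_tendstoD)
  ultimately have "\<forall>\<^sub>F n in sequentially. Arg (1 - cnj \<sigma> * z n) + Arg (v n) = Arg (chart (z n))"
  proof eventually_elim
    case (elim n)
    have "chart (z n) = (1 - cnj \<sigma> * z n) * v n" by (simp add: chart_def v_def)
    moreover have "v n \<noteq> 0" using nz[of n] neq by (simp add: v_def)
    moreover have "Arg (1 - cnj \<sigma> * z n) + Arg (v n) \<in> {- pi<..pi}"
      using elim unfolding greaterThanAtMost_iff abs_less_iff by linarith
    ultimately show ?case using Arg_times[OF _ nz(2)[of n], of "v n"] by simp
  qed
  moreover have "(\<lambda>n. Arg (1 - cnj \<sigma> * z n) + Arg (v n)) \<longlonglongrightarrow> \<beta> + 0"
    by (intro tendsto_intros Arg v)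
  ultimately show lim: "(\<lambda>n. Arg (chart (z n))) \<longlonglongrightarrow> \<beta>"
    using Lim_transform_eventually[of "\<lambda>n. Arg (1 - cnj \<sigma> * z n) + Arg (v n)" "\<beta> + 0"] by simp
  show "filterlim (\<lambda>n. chart (z n)) (at 0 within sector (cos \<beta> / 2)) sequentially"
  proof (rule filterlim_at_withinI)
    have "filterlim z (at \<sigma> within unit_disc) sequentially"
      using z \<sigma>_notin by (intro filterlim_at_withinI) auto
    then show "(\<lambda>n. chart (z n)) \<longlonglongrightarrow> 0" by (rule filterlim_compose[OF chart_tendsto])
    have "0 < cos \<beta>" using \<beta> by (intro cos_gt_zero_pi) auto
    then have "\<forall>\<^sub>F n in sequentially. cos \<beta> / 2 < cos (Arg (chart (z n)))"
      by (intro order_tendstoD(1)[OF tendsto_cos[OF lim]]) simp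
    then show "\<forall>\<^sub>F n in sequentially. chart (z n) \<in> sector (cos \<beta> / 2)"
    proof eventually_elim
      case (elim n)
      have "chart (z n) \<noteq> 0" using chart_rhp[OF z(1)[of n]] by auto
      then have "rcis (cmod (chart (z n))) (Arg (chart (z n))) \<in> sector (cos \<beta> / 2)"
        using elim by (intro sector_polar) auto
      then show ?case by (simp add: rcis_cmod_Arg)
    qed
  qed (simp add: sector_def)
qed

lemma Re_h_limit_of_angle:
  assumes rep: "repelling_spectral_value \<phi> \<sigma> \<nu>"
  shows "\<exists>a::real. \<forall>(z :: nat \<Rightarrow> complex) \<beta>.
     (\<forall>n. z n \<in> unit_disc) \<and> z \<longlonglongrightarrow> \<sigma> \<and>
     \<beta> \<in> {- pi / 2 <..< pi / 2} \<and> (\<lambda>n. Arg (1 - cnj \<sigma> * z n)) \<longlonglongrightarrow> \<beta>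
     \<longrightarrow> (\<lambda>n. Re (h (z n))) \<longlonglongrightarrow> a + \<beta> / \<nu>"
proof -
  note m = repelling_imp_mass[OF rep]
  obtain a where a: "\<And>k (w :: nat \<Rightarrow> complex) \<beta>. 0 < k \<Longrightarrow> filterlim w (at 0 within sector k) sequentially \<Longrightarrow>
    (\<lambda>n. Arg (w n)) \<longlonglongrightarrow> \<beta> \<Longrightarrow> (\<lambda>n. Re (h (chart_inv (w n)))) \<longlonglongrightarrow> a - mass * \<beta>"
    using Re_h_sector_limit[OF m(2)] by blast
  have "(\<lambda>n. Re (h (z n))) \<longlonglongrightarrow> a + \<beta> / \<nu>"
    if z: "\<And>n. z n \<in> unit_disc" "z \<longlonglongrightarrow> \<sigma>" and \<beta>: "\<beta> \<in> {- pi / 2 <..< pi / 2}"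
      and Arg: "(\<lambda>n. Arg (1 - cnj \<sigma> * z n)) \<longlonglongrightarrow> \<beta>" for z \<beta>
  proof -
    have b: "\<bar>\<beta>\<bar> < pi / 2" using \<beta> by auto
    have "0 < cos \<beta> / 2" using b by (intro half_gt_zero cos_gt_zero_pi) auto
    then have "(\<lambda>n. Re (h (chart_inv (chart (z n))))) \<longlonglongrightarrow> a - mass * \<beta>"
      by (rule a) (rule chart_sector_of_Arg[OF z b Arg])+
    then show ?thesis using chart_inv_chart[OF z(1)] m(1) by simp
  qed
  then show ?thesis by blast
qed

end

text \<open>The same angular limit of the derivative would have to be both greater than 1 and at
  most 1.\<close>

lemma repelling_neq_denjoy_wolff:
  assumes "cmod \<tau> = 1" "spectral_value \<phi> \<tau> lam"
  shows "\<not> repelling_spectral_value \<phi> \<tau> \<nu>"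
proof
  assume r: "repelling_spectral_value \<phi> \<tau> \<nu>"
  have "(deriv (\<phi> 1) \<longlongrightarrow> of_real (exp (- \<nu> * 1))) (at \<tau> within stolz \<tau> 2)"
    "(deriv (\<phi> 1) \<longlongrightarrow> of_real (exp (- lam * 1))) (at \<tau> within stolz \<tau> 2)"
    using r assms(2) unfolding repelling_spectral_value_def spectral_value_def angular_lim_def
    by (auto dest: spec[of _ 1])
  moreover have "at \<tau> within stolz \<tau> 2 \<noteq> bot" using at_within_stolz_neq_bot[OF assms(1)] by simp
  ultimately have "complex_of_real (exp (- \<nu> * 1)) = of_real (exp (- lam * 1))"
    using tendsto_unique by blast
  then have "\<nu> = lam" by (simp only: of_real_eq_iff) simp
  then show False using r assms(2) by (simp add: repelling_spectral_value_def spectral_value_def)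
qed

text \<open>Along the orbit of 0, which converges to \<tau>, the imaginary part of \<open>h\<close>
  increases.\<close>

lemma Im_koenigs_at_denjoy_wolff:
  assumes sg: "holomorphic_semigroup \<phi>" and dw: "denjoy_wolff_point \<phi> \<tau>" and \<tau>: "cmod \<tau> = 1"
    and h: "\<And>t z. 0 \<le> t \<Longrightarrow> z \<in> unit_disc \<Longrightarrow> h (\<phi> t z) = h z + \<i> * of_real t"
  shows "\<not> filterlim (\<lambda>z. Im (h z)) at_bot (at \<tau> within unit_disc)"
proof
  assume lim: "filterlim (\<lambda>z. Im (h z)) at_bot (at \<tau> within unit_disc)"
  have "compact {0 :: complex}" "{0 :: complex} \<subseteq> unit_disc" by auto
  then have "uniform_limit {0} \<phi> (\<lambda>_. \<tau>) at_top"
    using dw unfolding denjoy_wolff_point_def by blast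
  then have "((\<lambda>t. \<phi> t 0) \<longlongrightarrow> \<tau>) at_top" by (rule tendsto_uniform_limitI) simp
  moreover have nn: "\<forall>\<^sub>F t in at_top. (0 :: real) \<le> t" by (rule eventually_ge_at_top)
  then have "\<forall>\<^sub>F t in at_top. \<phi> t 0 \<in> unit_disc"
    by (rule eventually_mono) (use sg in \<open>auto simp: holomorphic_semigroup_def image_subset_iff\<close>)
  ultimately have "filterlim (\<lambda>t. \<phi> t 0) (at \<tau> within unit_disc) at_top"
    using \<tau> by (intro filterlim_at_withinI) auto
  from filterlim_compose[OF lim this]
  have "\<forall>\<^sub>F t in at_top. Im (h (\<phi> t 0)) \<le> Im (h 0) - 1" by (simp add: filterlim_at_bot)
  then have "\<forall>\<^sub>F t in at_top. (0 :: real) \<le> t \<and> Im (h (\<phi> t 0)) \<le> Im (h 0) - 1"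
    using nn by eventually_elim simp
  then obtain t :: real where "0 \<le> t" "Im (h (\<phi> t 0)) \<le> Im (h 0) - 1"
    using eventually_happens[of _ "at_top :: real filter"] by auto
  then show False using h[of t 0] by simp
qed

theorem theorem6p4:
  fixes \<phi> :: "real \<Rightarrow> complex \<Rightarrow> complex" and h :: "complex \<Rightarrow> complex"
    and \<tau> \<sigma> :: complex and lam :: real
  assumes "holomorphic_semigroup \<phi>"
    and "\<not> is_group_semigroup \<phi>"
    and "denjoy_wolff_point \<phi> \<tau>"
    and "\<tau> \<in> unit_circle"
    and "spectral_value \<phi> \<tau> lam"
    and "koenigs_function \<phi> lam h"
    and "\<sigma> \<in> unit_circle"
  defines "P1 \<equiv> repelling_fixed_point \<phi> \<sigma>"
    and "P2 \<equiv> filterlim (\<lambda>z. Im (h z)) at_bot (at \<sigma> within unit_disc) \<and>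
      - \<infinity> < angular_liminf (\<lambda>z. Re (h z)) \<sigma> \<and>
      angular_liminf (\<lambda>z. Re (h z)) \<sigma> \<noteq> angular_limsup (\<lambda>z. Re (h z)) \<sigma> \<and>
      angular_limsup (\<lambda>z. Re (h z)) \<sigma> < \<infinity>"
    and "P3 \<equiv> filterlim (\<lambda>z. Im (h z)) at_bot (at \<sigma> within unit_disc) \<and>
      - \<infinity> < Liminf (at \<sigma> within unit_disc) (\<lambda>z. ereal (Re (h z))) \<and>
      Liminf (at \<sigma> within unit_disc) (\<lambda>z. ereal (Re (h z)))
        \<noteq> Limsup (at \<sigma> within unit_disc) (\<lambda>z. ereal (Re (h z))) \<and>
      Limsup (at \<sigma> within unit_disc) (\<lambda>z. ereal (Re (h z))) < \<infinity>"
  shows "(P1 \<longleftrightarrow> P2) \<and> (P2 \<longleftrightarrow> P3) \<and>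
    (\<forall>\<nu>. repelling_spectral_value \<phi> \<sigma> \<nu> \<longrightarrow>
      (\<exists>a::real. \<forall>(z :: nat \<Rightarrow> complex) \<beta>.
         (\<forall>n. z n \<in> unit_disc) \<and> z \<longlonglongrightarrow> \<sigma> \<and>
         \<beta> \<in> {- pi / 2 <..< pi / 2} \<and> (\<lambda>n. Arg (1 - cnj \<sigma> * z n)) \<longlonglongrightarrow> \<beta>
         \<longrightarrow> (\<lambda>n. Re (h (z n))) \<longlonglongrightarrow> a + \<beta> / \<nu>))"
proof (cases "\<sigma> = \<tau>")
  case True
  \<comment> \<open>At the Denjoy-Wolff point all three conditions are false and the final statement
    is vacuous.\<close>
  have \<tau>: "cmod \<tau> = 1" using assms(4) by simp
  have "\<not> repelling_spectral_value \<phi> \<sigma> \<nu>" for \<nu>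
    using repelling_neq_denjoy_wolff[OF \<tau> assms(5)] True by simp
  moreover from this have "\<not> P1" unfolding P1_def repelling_fixed_point_def by blast
  moreover have "\<not> filterlim (\<lambda>z. Im (h z)) at_bot (at \<sigma> within unit_disc)"
    unfolding True by (rule Im_koenigs_at_denjoy_wolff[OF assms(1,3) \<tau>])
      (use assms(6) in \<open>simp add: koenigs_function_def\<close>)
  then have "\<not> P2" "\<not> P3" unfolding P2_def P3_def by blast+
  ultimately show ?thesis by blast
next
  case False
  interpret semigroup_chart \<sigma> \<tau> \<phi> h
    by unfold_locales (use False assms in \<open>auto simp: koenigs_function_def\<close>)
  have "P1 \<longleftrightarrow> 0 < mass" unfolding P1_def by (rule repelling_iff_mass)
  moreover have "P2 \<longleftrightarrow> 0 < mass" unfolding P2_def by (rule angular_oscillation_iff_mass)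
  moreover have "P3 \<longleftrightarrow> 0 < mass" unfolding P3_def by (rule oscillation_iff_mass)
  ultimately show ?thesis using Re_h_limit_of_angle by blast
qed

end
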